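(* Let $(\hat L^{(0)},\hat L_v)$ be any given stabilizer of system (S) and let $\epsilon>0$. Then there exists $\delta_2=\delta_2(\epsilon,\hat L^{(0)})>0$ such that if $Q_v:=Q-\gamma^2\hat L_v^\top\hat L_v>0$ and $\|\Delta M\|_\infty<\delta_2$, the disturbed inner policy iteration (R) started from $\hat L^{(0)}$ satisfies: (i) for all integers $j>0$, $[\hat M^{(j)}]_{uu}$ is invertible, $(\hat L^{(j)},\hat L_v)$ is a stabilizer of (S), and $\|\hat P^{(j)}\|_F<M_0$, where $M_0=M_0(\delta_2)>0$; (ii) $\limsup_{j\to\infty}\|\hat P^{(j)}-P^{\ast}\|_F<\epsilon$; (iii) $\lim_{j\to\infty}\|\Delta M^{(j)}\|_F=0$ implies $\lim_{j\to\infty}\|\hat P^{(j)}-P^{\ast}\|_F=0$.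
   Context: **System.** Let $A,C\in\mathbb R^{n\times n}$, $B_1,D\in\mathbb R^{n\times m_1}$, $B_2\in\mathbb R^{n\times m_2}$, $Q=Q^\top\ge0$, $R=R^\top>0$, $\gamma>0$. Consider $$dX=[AX+B_1u+B_2v]\,ds+[CX+Du]\,dW,\qquad (S)$$ with $W$ a one-dimensional standard Brownian motion. A pair $(L_u,L_v)\in\mathbb R^{m_1\times n}\times\mathbb R^{m_2\times n}$ is a *stabilizer* of (S) if the closed loop with $u=L_uX$, $v=L_vX$ satisfies $\lim_{s\to\infty}\mathbb E[X(s)^\top X(s)]=0$ for every initial state. Standing assumption: (S) admits a stabilizer. $\mathbb S^n$ is the set of symmetric $n\times n$ matrices, $\|\cdot\|_F$ the Frobenius norm. For $P\in\mathbb S^n$, $$M(P)=\begin{bmatrix}Q+A^\top P+PA+C^\top PC&PB_1+C^\top PD&PB_2\\ B_1^\top P+D^\top PC&R+D^\top PD&0\\ B_2^\top P&0&-\gamma^2I_{m_2}\end{bmatrix}.$$ For a symmetric matrix of size $n+m_1+m_2$ partitioned in the same way, $[\cdot]_{ux}$ and $[\cdot]_{uu}$ denote its $(2,1)$ and $(2,2)$ blocks. **Disturbed inner policy iteration (R)** with fixed $\hat L_v$: let $A_v=A+B_2\hat L_v$ and $Q_v=Q-\gamma^2\hat L_v^\top\hat L_v$. Given $\hat L^{(0)}$, for $j=0,1,2,\dots$, $\hat P^{(j+1)}\in\mathbb S^n$ satisfies $$(A_v+B_1\hat L^{(j)})^\top\hat P^{(j+1)}+\hat P^{(j+1)}(A_v+B_1\hat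 L^{(j)})+(C+D\hat L^{(j)})^\top\hat P^{(j+1)}(C+D\hat L^{(j)})+\hat L^{(j)\top}R\hat L^{(j)}+Q_v=0,$$ then $\hat M^{(j+1)}=M(\hat P^{(j+1)})+\Delta M^{(j+1)}$ with a disturbance $\Delta M^{(j+1)}\in\mathbb S^{n+m_1+m_2}$, and $\hat L^{(j+1)}=-[\hat M^{(j+1)}]_{uu}^{-1}[\hat M^{(j+1)}]_{ux}$. Put $\|\Delta M\|_\infty=\sup_j\|\Delta M^{(j)}\|_F$. $P^\ast\in\mathbb S^n$ denotes the limit of the same iteration without disturbance ($\Delta M\equiv0$); it is the solution of $$A_v^\top P+PA_v+C^\top PC+Q_v-(PB_1+C^\top PD)(R+D^\top PD)^{-1}(B_1^\top P+D^\top PC)=0$$ for which $(-(R+D^\top P D)^{-1}(B_1^\top P+D^\top PC),\hat L_v)$ is a stabilizer of (S). *)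

theory Defs
  imports "HOL-Probability.Probability"
begin

section \<open>Brownian motion and the Ito integral\<close>

text \<open>
  Time is the half-line \<open>t \<ge> 0\<close> of \<open>real\<close>; values of processes and filtrations at negative times
  are irrelevant.  No usual conditions are imposed on the filtration, so \<open>F\<close> may be the natural
  filtration of the Brownian motion, its augmentation, or a larger one.
\<close>

definition filtered_space :: "'w measure \<Rightarrow> (real \<Rightarrow> 'w measure) \<Rightarrow> bool" where
  "filtered_space M F \<longleftrightarrow> prob_space M \<and> (\<forall>t\<ge>0. subalgebra M (F t)) \<and>
     (\<forall>s t. 0 \<le> s \<and> s \<le> t \<longrightarrow> sets (F s) \<subseteq> sets (F t))"

definition brownian_motion ::
  "'w measure \<Rightarrow> (real \<Rightarrow> 'w measure) \<Rightarrow> (real \<Rightarrow> 'w \<Rightarrow> real) \<Rightarrow> bool" where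
  "brownian_motion M F W \<longleftrightarrow>
     (\<forall>t\<ge>0. W t \<in> borel_measurable (F t)) \<and>
     (AE \<omega> in M. W 0 \<omega> = 0) \<and>
     (AE \<omega> in M. continuous_on {0..} (\<lambda>t. W t \<omega>)) \<and>
     (\<forall>s t. 0 \<le> s \<and> s < t \<longrightarrow>
        distributed M lborel (\<lambda>\<omega>. W t \<omega> - W s \<omega>) (\<lambda>x. ennreal (normal_density 0 (sqrt (t - s)) x)) \<and>
        prob_space.indep_set M (sets (F s))
          {(\<lambda>\<omega>. W t \<omega> - W s \<omega>) -` B \<inter> space M | B. B \<in> sets borel})"

definition progressive :: "(real \<Rightarrow> 'w measure) \<Rightarrow> (real \<Rightarrow> 'w \<Rightarrow> 'b::euclidean_space) \<Rightarrow> bool" where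
  "progressive F X \<longleftrightarrow>
     (\<forall>t\<ge>0. (\<lambda>(s, \<omega>). X s \<omega>) \<in> borel_measurable (restrict_space borel {0..t} \<Otimes>\<^sub>M F t))"

text \<open>Progressive processes with \<open>E \<integral>\<^sub>0\<^sup>T |X s|\<^sup>2 ds < \<infinity>\<close> for every \<open>T\<close>.\<close>

definition L2_process ::
  "'w measure \<Rightarrow> (real \<Rightarrow> 'w measure) \<Rightarrow> (real \<Rightarrow> 'w \<Rightarrow> 'b::euclidean_space) \<Rightarrow> bool" where
  "L2_process M F X \<longleftrightarrow> progressive F X \<and>
     (\<forall>T\<ge>0. (\<integral>\<^sup>+ \<omega>. (\<integral>\<^sup>+ s\<in>{0..T}. ennreal ((norm (X s \<omega>))\<^sup>2) \<partial>lborel) \<partial>M) < \<infinity>)"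

text \<open>
  \<open>step_data M F T m \<tau> \<xi>\<close>: the data of the step process with value \<open>\<xi> k\<close> on \<open>[\<tau> k, \<tau> (k+1))\<close>, for a
  partition \<open>0 = \<tau> 0 \<le> \<dots> \<le> \<tau> m = T\<close> and square integrable \<open>F (\<tau> k)\<close>-measurable \<open>\<xi> k\<close>.
\<close>

definition step_data :: "'w measure \<Rightarrow> (real \<Rightarrow> 'w measure) \<Rightarrow> real \<Rightarrow> nat \<Rightarrow> (nat \<Rightarrow> real) \<Rightarrow>
    (nat \<Rightarrow> 'w \<Rightarrow> 'b::euclidean_space) \<Rightarrow> bool" where
  "step_data M F T m \<tau> \<xi> \<longleftrightarrow> \<tau> 0 = 0 \<and> \<tau> m = T \<and> (\<forall>k<m. \<tau> k \<le> \<tau> (Suc k)) \<and>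
     (\<forall>k<m. \<xi> k \<in> borel_measurable (F (\<tau> k)) \<and> integrable M (\<lambda>\<omega>. (norm (\<xi> k \<omega>))\<^sup>2))"

definition step_process ::
  "nat \<Rightarrow> (nat \<Rightarrow> real) \<Rightarrow> (nat \<Rightarrow> 'w \<Rightarrow> 'b::euclidean_space) \<Rightarrow> real \<Rightarrow> 'w \<Rightarrow> 'b" where
  "step_process m \<tau> \<xi> s \<omega> = (\<Sum>k<m. indicator {\<tau> k..<\<tau> (Suc k)} s *\<^sub>R \<xi> k \<omega>)"

definition step_integral :: "(real \<Rightarrow> 'w \<Rightarrow> real) \<Rightarrow> nat \<Rightarrow> (nat \<Rightarrow> real) \<Rightarrow>
    (nat \<Rightarrow> 'w \<Rightarrow> 'b::euclidean_space) \<Rightarrow> 'w \<Rightarrow> 'b" where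
  "step_integral W m \<tau> \<xi> \<omega> = (\<Sum>k<m. (W (\<tau> (Suc k)) \<omega> - W (\<tau> k) \<omega>) *\<^sub>R \<xi> k \<omega>)"

text \<open>
  \<open>Y = \<integral>\<^sub>0\<^sup>T \<Phi> dW\<close> almost surely, as the mean-square limit of integrals of step processes approximating
  \<open>\<Phi>\<close>.  By the isometry for step processes \<open>Y\<close> is determined up to a null set.
\<close>

definition has_ito_integral :: "'w measure \<Rightarrow> (real \<Rightarrow> 'w measure) \<Rightarrow> (real \<Rightarrow> 'w \<Rightarrow> real) \<Rightarrow>
    (real \<Rightarrow> 'w \<Rightarrow> 'b::euclidean_space) \<Rightarrow> real \<Rightarrow> ('w \<Rightarrow> 'b) \<Rightarrow> bool" where
  "has_ito_integral M F W \<Phi> T Y \<longleftrightarrow> L2_process M F \<Phi> \<and> Y \<in> borel_measurable M \<and>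
     (\<exists>m \<tau> \<xi>. (\<forall>i. step_data M F T (m i) (\<tau> i) (\<xi> i)) \<and>
        (\<lambda>i. \<integral>\<^sup>+ \<omega>. (\<integral>\<^sup>+ s\<in>{0..T}.
            ennreal ((norm (step_process (m i) (\<tau> i) (\<xi> i) s \<omega> - \<Phi> s \<omega>))\<^sup>2) \<partial>lborel) \<partial>M)
          \<longlonglongrightarrow> 0 \<and>
        (\<lambda>i. \<integral>\<^sup>+ \<omega>. ennreal ((norm (step_integral W (m i) (\<tau> i) (\<xi> i) \<omega> - Y \<omega>))\<^sup>2) \<partial>M)
          \<longlonglongrightarrow> 0)"


section \<open>The controlled system and its stabilizers\<close>

text \<open>
  \<open>dX = [A X + B1 u + B2 v] ds + [C X + D u] dW\<close>, \<open>X 0 = x0\<close>, in integral form.  Solutions are taken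
  in the class of square integrable progressive processes, where they are unique up to modification;
  since only the moments \<open>E |X s|\<^sup>2\<close> at fixed times matter below, no continuous version is selected.
\<close>

definition system_solution :: "'w measure \<Rightarrow> (real \<Rightarrow> 'w measure) \<Rightarrow> (real \<Rightarrow> 'w \<Rightarrow> real) \<Rightarrow>
    real^'n^'n \<Rightarrow> real^'m1^'n \<Rightarrow> real^'m2^'n \<Rightarrow> real^'n^'n \<Rightarrow> real^'m1^'n \<Rightarrow>
    (real \<Rightarrow> 'w \<Rightarrow> real^'m1) \<Rightarrow> (real \<Rightarrow> 'w \<Rightarrow> real^'m2) \<Rightarrow> real^'n \<Rightarrow>
    (real \<Rightarrow> 'w \<Rightarrow> real^'n) \<Rightarrow> bool" where
  "system_solution M F W A B1 B2 C D u v x0 X \<longleftrightarrow>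
     L2_process M F X \<and> L2_process M F u \<and> L2_process M F v \<and>
     (\<forall>t\<ge>0. \<exists>Y. has_ito_integral M F W (\<lambda>s \<omega>. C *v X s \<omega> + D *v u s \<omega>) t Y \<and>
        (AE \<omega> in M. X t \<omega> =
           x0 + (LINT s:{0..t}|lborel. A *v X s \<omega> + B1 *v u s \<omega> + B2 *v v s \<omega>) + Y \<omega>))"

definition stabilizer :: "'w measure \<Rightarrow> (real \<Rightarrow> 'w measure) \<Rightarrow> (real \<Rightarrow> 'w \<Rightarrow> real) \<Rightarrow>
    real^'n^'n \<Rightarrow> real^'m1^'n \<Rightarrow> real^'m2^'n \<Rightarrow> real^'n^'n \<Rightarrow> real^'m1^'n \<Rightarrow>
    real^'n^'m1 \<Rightarrow> real^'n^'m2 \<Rightarrow> bool" where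
  "stabilizer M F W A B1 B2 C D Lu Lv \<longleftrightarrow>
     (\<forall>x0 X. system_solution M F W A B1 B2 C D (\<lambda>s \<omega>. Lu *v X s \<omega>) (\<lambda>s \<omega>. Lv *v X s \<omega>) x0 X \<longrightarrow>
        ((\<lambda>s. \<integral>\<omega>. X s \<omega> \<bullet> X s \<omega> \<partial>M) \<longlongrightarrow> 0) at_top)"


section \<open>Matrices\<close>

text \<open>The library norm on \<open>real^'a^'b\<close> is the Frobenius norm, and is used as such throughout.\<close>

definition sym_mat :: "real^'k^'k \<Rightarrow> bool" where
  "sym_mat A \<longleftrightarrow> transpose A = A"

definition pos_semidef :: "real^'k^'k \<Rightarrow> bool" where
  "pos_semidef A \<longleftrightarrow> sym_mat A \<and> (\<forall>x. 0 \<le> x \<bullet> (A *v x))"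

definition pos_def :: "real^'k^'k \<Rightarrow> bool" where
  "pos_def A \<longleftrightarrow> sym_mat A \<and> (\<forall>x. x \<noteq> 0 \<longrightarrow> 0 < x \<bullet> (A *v x))"

text \<open>
  Matrices of size \<open>n + m1 + m2\<close> are indexed by the sum type \<open>'n + ('m1 + 'm2)\<close>, so that the blocks
  are selected by the injections.
\<close>

definition block_mat :: "real^'n^'n \<Rightarrow> real^'m1^'n \<Rightarrow> real^'m2^'n \<Rightarrow>
    real^'n^'m1 \<Rightarrow> real^'m1^'m1 \<Rightarrow> real^'m2^'m1 \<Rightarrow>
    real^'n^'m2 \<Rightarrow> real^'m1^'m2 \<Rightarrow> real^'m2^'m2 \<Rightarrow>
    real^('n + ('m1 + 'm2))^('n + ('m1 + 'm2))" where
  "block_mat XX XU XV UX UU UV VX VU VV = (\<chi> i j.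
     (case i of
        Inl x \<Rightarrow> (case j of Inl x' \<Rightarrow> XX $ x $ x' | Inr (Inl u') \<Rightarrow> XU $ x $ u' | Inr (Inr v') \<Rightarrow> XV $ x $ v')
      | Inr (Inl u) \<Rightarrow> (case j of Inl x' \<Rightarrow> UX $ u $ x' | Inr (Inl u') \<Rightarrow> UU $ u $ u' | Inr (Inr v') \<Rightarrow> UV $ u $ v')
      | Inr (Inr v) \<Rightarrow> (case j of Inl x' \<Rightarrow> VX $ v $ x' | Inr (Inl u') \<Rightarrow> VU $ v $ u' | Inr (Inr v') \<Rightarrow> VV $ v $ v')))"

definition block_ux :: "real^('n + ('m1 + 'm2::finite))^('n + ('m1 + 'm2)) \<Rightarrow> real^'n^'m1" where
  "block_ux N = (\<chi> a b. N $ Inr (Inl a) $ Inl b)"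

definition block_uu :: "real^('n::finite + ('m1 + 'm2::finite))^('n + ('m1 + 'm2)) \<Rightarrow> real^'m1^'m1" where
  "block_uu N = (\<chi> a b. N $ Inr (Inl a) $ Inr (Inl b))"

definition game_mat :: "real^'n^'n \<Rightarrow> real^'m1^'n \<Rightarrow> real^'m2^'n \<Rightarrow> real^'n^'n \<Rightarrow> real^'m1^'n \<Rightarrow>
    real^'n^'n \<Rightarrow> real^'m1^'m1 \<Rightarrow> real \<Rightarrow> real^'n^'n \<Rightarrow>
    real^('n + ('m1 + 'm2))^('n + ('m1 + 'm2))" where
  "game_mat A B1 B2 C D Q R \<gamma> P = block_mat
     (Q + transpose A ** P + P ** A + transpose C ** P ** C)
       (P ** B1 + transpose C ** P ** D) (P ** B2)
     (transpose B1 ** P + transpose D ** P ** C)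
       (R + transpose D ** P ** D) 0
     (transpose B2 ** P)
       0 (- (\<gamma>\<^sup>2) *\<^sub>R mat 1)"


section \<open>The disturbed inner policy iteration\<close>

definition Q_v :: "real^'n^'n \<Rightarrow> real \<Rightarrow> real^'n^'m2 \<Rightarrow> real^'n^'n" where
  "Q_v Q \<gamma> Lv = Q - \<gamma>\<^sup>2 *\<^sub>R (transpose Lv ** Lv)"

definition policy_eq :: "real^'n^'n \<Rightarrow> real^'m1^'n \<Rightarrow> real^'m2^'n \<Rightarrow> real^'n^'n \<Rightarrow> real^'m1^'n \<Rightarrow>
    real^'n^'n \<Rightarrow> real^'m1^'m1 \<Rightarrow> real \<Rightarrow> real^'n^'m2 \<Rightarrow> real^'n^'m1 \<Rightarrow> real^'n^'n \<Rightarrow> bool" where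
  "policy_eq A B1 B2 C D Q R \<gamma> Lv L P \<longleftrightarrow>
     (let Av = A + B2 ** Lv in
        transpose (Av + B1 ** L) ** P + P ** (Av + B1 ** L)
        + transpose (C + D ** L) ** P ** (C + D ** L)
        + transpose L ** R ** L + Q_v Q \<gamma> Lv = 0)"

text \<open>
  \<open>P j\<close> and the disturbance \<open>\<Delta> j\<close> are meaningful for \<open>j \<ge> 1\<close> only, \<open>L j\<close> for \<open>j \<ge> 0\<close>.
\<close>

definition M_hat :: "real^'n^'n \<Rightarrow> real^'m1^'n \<Rightarrow> real^'m2^'n \<Rightarrow> real^'n^'n \<Rightarrow> real^'m1^'n \<Rightarrow>
    real^'n^'n \<Rightarrow> real^'m1^'m1 \<Rightarrow> real \<Rightarrow>
    (nat \<Rightarrow> real^('n + ('m1 + 'm2))^('n + ('m1 + 'm2))) \<Rightarrow> (nat \<Rightarrow> real^'n^'n) \<Rightarrow>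
    nat \<Rightarrow> real^('n + ('m1 + 'm2))^('n + ('m1 + 'm2))" where
  "M_hat A B1 B2 C D Q R \<gamma> \<Delta> P j = game_mat A B1 B2 C D Q R \<gamma> (P j) + \<Delta> j"

definition inner_iteration :: "real^'n^'n \<Rightarrow> real^'m1^'n \<Rightarrow> real^'m2^'n \<Rightarrow> real^'n^'n \<Rightarrow> real^'m1^'n \<Rightarrow>
    real^'n^'n \<Rightarrow> real^'m1^'m1 \<Rightarrow> real \<Rightarrow> real^'n^'m2 \<Rightarrow> real^'n^'m1 \<Rightarrow>
    (nat \<Rightarrow> real^('n + ('m1 + 'm2))^('n + ('m1 + 'm2))) \<Rightarrow>
    (nat \<Rightarrow> real^'n^'n) \<Rightarrow> (nat \<Rightarrow> real^'n^'m1) \<Rightarrow> bool" where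
  "inner_iteration A B1 B2 C D Q R \<gamma> Lv L0 \<Delta> P L \<longleftrightarrow> L 0 = L0 \<and>
     (\<forall>j. sym_mat (P (Suc j)) \<and> policy_eq A B1 B2 C D Q R \<gamma> Lv (L j) (P (Suc j)) \<and>
        L (Suc j) = - (matrix_inv (block_uu (M_hat A B1 B2 C D Q R \<gamma> \<Delta> P (Suc j)))
                       ** block_ux (M_hat A B1 B2 C D Q R \<gamma> \<Delta> P (Suc j))))"

text \<open>The limit of the undisturbed iteration.\<close>

definition P_star :: "real^'n^'n \<Rightarrow> real^'m1^'n \<Rightarrow> real^'m2^'n \<Rightarrow> real^'n^'n \<Rightarrow> real^'m1^'n \<Rightarrow>
    real^'n^'n \<Rightarrow> real^'m1^'m1 \<Rightarrow> real \<Rightarrow> real^'n^'m2 \<Rightarrow> real^'n^'m1 \<Rightarrow> real^'n^'n" where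
  "P_star A B1 B2 C D Q R \<gamma> Lv L0 =
     (THE Pl. \<exists>P L. inner_iteration A B1 B2 C D Q R \<gamma> Lv L0 (\<lambda>_. 0) P L \<and> P \<longlonglongrightarrow> Pl)"

text \<open>\<open>\<parallel>\<Delta>\<parallel>\<^sub>\<infinity>\<close>, with value \<open>\<infinity>\<close> for unbounded disturbances.\<close>

definition sup_norm :: "(nat \<Rightarrow> real^'k^'l) \<Rightarrow> ereal" where
  "sup_norm \<Delta> = (SUP j\<in>{1..}. ereal (norm (\<Delta> j)))"

end

theory Submission
  imports Defs
begin

text \<open>
  The argument has a stochastic and a deterministic half. They meet in one criterion: a pair of
  feedback gains is a stabilizer iff some positive definite \<open>P\<close> satisfies \<open>lyap A C P < 0\<close> for the
  closed-loop matrices \<open>A\<close>, \<open>C\<close> (\<open>stabilizer_iff_lyapunov_stable\<close>). This condition is purely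
  algebraic and open in the gains.

  Stochastic half. Stabilizers are defined by second moments at fixed times, and the Euler scheme
  gives access to these without Ito's formula. Along the scheme, \<open>E (z \<bullet> P z)\<close> satisfies an exact
  recursion driven by \<open>lyap A C P\<close> (\<open>euler_quadratic_recursion\<close>). Every solution is the
  mean-square limit of Euler schemes (\<open>solution_euler_step_distance\<close>); this follows from the
  isometry for finite sums of Brownian increments and Gronwall's inequality. Passing to the limit,
  \<open>lyap A C P \<le> - \<kappa> P\<close> implies \<open>E (X t \<bullet> P (X t)) \<le> exp (- \<kappa> t) x0 \<bullet> P x0\<close>, whence decay under the
  criterion. Conversely, a stabilizer says something only about solutions that exist, so one
  solution for every initial state is constructed, as the limit of the schemes with steps \<open>4\<^sup>-\<^sup>n\<close>.
  If all these solutions decay, then \<open>lyap A C P \<le> 0\<close> forces \<open>P \<ge> 0\<close>; hence \<open>lyap A C\<close> is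
  injective, so bijective, on symmetric matrices, and the solution of \<open>lyap A C P = - I\<close> witnesses
  the criterion.

  Deterministic half. Let \<open>residual L P\<close> be the left-hand side of the equation that evaluates the
  policy \<open>L\<close>. By completion of squares (\<open>residual_gain\<close>), \<open>residual L P\<close> exceeds its value at
  \<open>L = gain P\<close>, the improved policy, by the square of \<open>L - gain P\<close> weighted with \<open>R + D\<^sup>T P D\<close>.
  This has two consequences. First, without disturbance the improved policy is again stabilizing
  and has a smaller cost matrix, so that the iterates decrease to a fixed point \<open>P\<^sup>*\<close>. Second, at
  \<open>P\<^sup>*\<close> the residual of a nearby policy is quadratic in its distance from \<open>gain P\<^sup>*\<close>. Since the
  cost of a nearby policy differs from \<open>P\<^sup>*\<close> by at most a multiple of that residual
  (\<open>evaluation_perturbation\<close>), near \<open>P\<^sup>*\<close> the error after one disturbed step is at most half the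
  sum of the old error and the disturbance (\<open>local_contraction\<close>). From \<open>L0\<close> the undisturbed
  iteration enters this neighbourhood after finitely many steps, each of which is continuous in
  the disturbance (\<open>finitely_many_steps\<close>). So for small disturbances the disturbed iteration
  enters it too, and then stays there; the number of steps needed is the reason why \<open>\<delta>2\<close> depends
  on \<open>L0\<close> and \<open>\<epsilon>\<close>.
\<close>

section \<open>Quadratic forms and the Lyapunov operator\<close>

text \<open>The adjoint of the generator of second moments: along solutions of \<open>dX = A X ds + C X dW\<close>, the
  derivative of \<open>E (X \<bullet> P X)\<close> is \<open>E (X \<bullet> lyap A C P X)\<close>.\<close>

definition lyap :: "real^'n^'n \<Rightarrow> real^'n^'n \<Rightarrow> real^'n^'n \<Rightarrow> real^'n^'n" where
  "lyap A C P = transpose A ** P + P ** A + transpose C ** P ** C"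

lemma inner_transpose_mult: "x \<bullet> (transpose A *v y) = (A *v x) \<bullet> (y::real^'m)"
  by (metis dot_lmul_matrix inner_commute vector_transpose_matrix)

lemma lyap_quadratic:
  "x \<bullet> (lyap A C P *v x) = (A *v x) \<bullet> (P *v x) + x \<bullet> (P *v (A *v x)) + (C *v x) \<bullet> (P *v (C *v x))"
  unfolding lyap_def
  by (simp only: matrix_vector_mult_add_rdistrib inner_add_right inner_transpose_mult
      matrix_vector_mul_assoc[symmetric])

lemma sym_mat_inner: "sym_mat P \<Longrightarrow> (P *v x) \<bullet> y = x \<bullet> (P *v y)"
  unfolding sym_mat_def by (metis inner_transpose_mult)

lemma sym_matI:
  assumes "\<And>x y. (P *v x) \<bullet> y = x \<bullet> (P *v y)"
  shows "sym_mat P"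
proof -
  have "transpose P *v x = P *v x" for x
    by (rule vector_eq_ldot[THEN iffD1], rule allI) (simp only: inner_transpose_mult assms)
  then show ?thesis unfolding sym_mat_def by (simp add: matrix_eq)
qed

lemma sym_mat_add: "sym_mat P \<Longrightarrow> sym_mat Q \<Longrightarrow> sym_mat (P + Q)"
  and sym_mat_diff: "sym_mat P \<Longrightarrow> sym_mat Q \<Longrightarrow> sym_mat (P - Q)"
  and sym_mat_scaleR: "sym_mat P \<Longrightarrow> sym_mat (c *\<^sub>R P)"
  and sym_mat_uminus: "sym_mat P \<Longrightarrow> sym_mat (- P)"
  and sym_mat_0: "sym_mat 0"
  and sym_mat_mat1: "sym_mat (mat 1)"
  unfolding sym_mat_def by (auto simp: transpose_def vec_eq_iff mat_def)

lemma matrix_vector_mult_scaleR_left: "(c *\<^sub>R G) *v x = c *\<^sub>R (G *v (x::real^'n))"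
  by (simp add: scaleR_matrix_vector_assoc)

lemma lyap_quadratic_add:
  "x \<bullet> (lyap A C (P + Q) *v x) = x \<bullet> (lyap A C P *v x) + x \<bullet> (lyap A C Q *v x)"
  by (simp add: lyap_quadratic matrix_vector_mult_add_rdistrib inner_add_right)

lemma lyap_quadratic_scaleR:
  "x \<bullet> (lyap A C (c *\<^sub>R P) *v x) = c * (x \<bullet> (lyap A C P *v x))"
  by (simp add: lyap_quadratic matrix_vector_mult_scaleR_left algebra_simps)

lemma sym_mat_lyap: 
  assumes "sym_mat P"
  shows "sym_mat (lyap A C P)"
proof (rule sym_matI)
  fix x y
  have "u \<bullet> (lyap A C P *v v) = (A *v u) \<bullet> (P *v v) + (P *v u) \<bullet> (A *v v)
      + (C *v u) \<bullet> (P *v (C *v v))" for u v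
    unfolding lyap_def sym_mat_inner[OF assms]
    by (simp only: matrix_vector_mult_add_rdistrib inner_add_right inner_transpose_mult
      matrix_vector_mul_assoc[symmetric])
  note e = this
  show "(lyap A C P *v x) \<bullet> y = x \<bullet> (lyap A C P *v y)"
    unfolding e inner_commute[of "lyap A C P *v x"]
    by (simp add: inner_commute sym_mat_inner[OF assms, of "C *v x" "C *v y", symmetric])
qed

text \<open>Polarization.\<close>

lemma sym_mat_eq_0:
  assumes s: "sym_mat P" and z: "\<And>x. x \<bullet> (P *v x) = 0"
  shows "P = 0"
proof -
  have "y \<bullet> (P *v x) = 0" for x y
    using z[of "x + y"] z[of x] z[of y] sym_mat_inner[OF s, of x y]
    by (simp add: matrix_vector_right_distrib inner_add_left inner_add_right inner_commute)
  then have "P *v x = 0" for x by (metis inner_eq_zero_iff)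
  then show ?thesis by (simp add: matrix_eq)
qed

text \<open>The constant is the minimum of the form on the unit sphere.\<close>

lemma positive_form_lower_bound:
  fixes N :: "real^'n^'n"
  assumes "\<And>x. x \<noteq> 0 \<Longrightarrow> 0 < x \<bullet> (N *v x)"
  shows "\<exists>\<mu>>0. \<forall>x. \<mu> * (norm x)\<^sup>2 \<le> x \<bullet> (N *v x)"
proof -
  have "continuous_on (sphere 0 1) (\<lambda>x. x \<bullet> (N *v x))"
    by (intro continuous_intros linear_continuous_on matrix_vector_mul_bounded_linear)
  moreover have "sphere (0::real^'n) 1 \<noteq> {}" by simp
  ultimately obtain u where u: "norm u = 1" and min: "\<And>x. norm x = 1 \<Longrightarrow> u \<bullet> (N *v u) \<le> x \<bullet> (N *v x)"
    using continuous_attains_inf[OF compact_sphere, of "0" 1] by fastforce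
  let ?\<mu> = "u \<bullet> (N *v u)"
  have "?\<mu> * (norm x)\<^sup>2 \<le> x \<bullet> (N *v x)" for x
  proof (cases "x = 0")
    case False
    have "?\<mu> \<le> (x /\<^sub>R norm x) \<bullet> (N *v (x /\<^sub>R norm x))" using False by (intro min) simp
    also have "\<dots> = (x \<bullet> (N *v x)) / (norm x)\<^sup>2"
      by (simp add: matrix_vector_mult_scaleR power2_eq_square divide_inverse algebra_simps)
    finally show ?thesis using False by (simp add: pos_le_divide_eq)
  qed simp
  moreover have "0 < ?\<mu>" using u by (intro assms) auto
  ultimately show ?thesis by blast
qed

lemma abs_inner_matrix_le: "\<bar>x \<bullet> ((P::real^'n^'n) *v y)\<bar> \<le> onorm ((*v) P) * (norm x * norm y)"
proof -
  have "\<bar>x \<bullet> (P *v y)\<bar> \<le> norm x * norm (P *v y)" by (rule Cauchy_Schwarz_ineq2)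
  also have "\<dots> \<le> norm x * (onorm ((*v) P) * norm y)"
    by (intro mult_left_mono onorm matrix_vector_mul_bounded_linear) auto
  finally show ?thesis by (simp add: mult_ac)
qed

lemma form_upper_bound: "\<bar>x \<bullet> (N *v x)\<bar> \<le> onorm ((*v) N) * (norm (x::real^'n))\<^sup>2"
  using abs_inner_matrix_le[of x N x] by (simp add: power2_eq_square)

text \<open>A zero of a semidefinite form is a minimum, so the gradient \<open>2 P x\<close> vanishes there: otherwise a
  small step from \<open>x\<close> along \<open>- P x\<close> would make the form negative.\<close>

lemma semidefinite_kernel:
  assumes s: "sym_mat P" and pos: "\<And>x. 0 \<le> x \<bullet> (P *v x)" and z: "x \<bullet> (P *v x) = 0"
  shows "P *v x = 0"
proof (rule ccontr)
  let ?y = "P *v x" let ?a = "?y \<bullet> ?y" and ?q = "?y \<bullet> (P *v ?y)"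
  assume "P *v x \<noteq> 0"
  then have a: "0 < ?a" by simp
  \<comment> \<open>a step for which the linear decrease \<open>2 t ?a\<close> outweighs the quadratic term \<open>t\<^sup>2 ?q\<close>\<close>
  define t where "t = ?a / (?q + 1)"
  have q: "0 \<le> ?q" by (rule pos)
  then have t: "0 < t" using a by (simp add: t_def)
  have "0 \<le> (x - t *\<^sub>R ?y) \<bullet> (P *v (x - t *\<^sub>R ?y))" by (rule pos)
  also have "\<dots> = t * (t * ?q - 2 * ?a)"
    using z sym_mat_inner[OF s, of x ?y]
    by (simp add: matrix_vector_mult_diff_distrib matrix_vector_mult_scaleR inner_diff_left
        inner_diff_right
        inner_commute algebra_simps)
  finally have "2 * ?a \<le> t * ?q" using t by (simp add: zero_le_mult_iff)
  also have "t * ?q \<le> ?a" using a q by (simp add: t_def field_simps)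
  finally show False using a by simp
qed

text \<open>Mean-square stability of \<open>dX = A X ds + C X dW\<close>, expressed by a quadratic Lyapunov function.\<close>

definition lyapunov_stable :: "real^'n^'n \<Rightarrow> real^'n^'n \<Rightarrow> bool" where
  "lyapunov_stable A C \<longleftrightarrow> (\<exists>P. pos_def P \<and> (\<forall>x. x \<noteq> 0 \<longrightarrow> x \<bullet> (lyap A C P *v x) < 0))"

text \<open>At a zero of a semidefinite form the two drift terms of \<open>lyap\<close> vanish, and the diffusion term is
  a value of the form.\<close>

lemma lyap_at_kernel:
  assumes "sym_mat P" "\<And>y. 0 \<le> y \<bullet> (P *v y)" "x \<bullet> (P *v x) = 0"
  shows "0 \<le> x \<bullet> (lyap A C P *v x)"
  using semidefinite_kernel[OF assms] assms(2)[of "C *v x"] sym_mat_inner[OF assms(1), of x "A *v x"]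
  by (simp add: lyap_quadratic)

text \<open>Take a Lyapunov matrix \<open>P0\<close> and let \<open>\<kappa>\<close> be the least number for which \<open>P + \<kappa> P0\<close> is
  semidefinite. If \<open>P\<close> were not semidefinite, then \<open>\<kappa> > 0\<close> and the form of \<open>P + \<kappa> P0\<close> would vanish
  at some \<open>u \<noteq> 0\<close>. There its image under \<open>lyap\<close> would be nonnegative by \<open>lyap_at_kernel\<close>, and
  negative because \<open>\<kappa> > 0\<close>.\<close>

lemma semidefinite_if_lyap_nonpos:
  assumes st: "lyapunov_stable A C" and s: "sym_mat P" and le: "\<And>x. x \<bullet> (lyap A C P *v x) \<le> 0"
  shows "0 \<le> x \<bullet> (P *v x)"
proof (rule ccontr)
  assume neg: "\<not> 0 \<le> x \<bullet> (P *v x)"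
  then have x: "x \<noteq> 0" by auto
  obtain P0 where P0: "sym_mat P0" "\<And>x. x \<noteq> 0 \<Longrightarrow> 0 < x \<bullet> (P0 *v x)"
    and lP0: "\<And>x. x \<noteq> 0 \<Longrightarrow> x \<bullet> (lyap A C P0 *v x) < 0"
    using st unfolding lyapunov_stable_def pos_def_def by blast
  let ?r = "\<lambda>x. (x \<bullet> (P *v x)) / (x \<bullet> (P0 *v x))"
  have "continuous_on (sphere 0 1) ?r"
  proof (intro continuous_intros linear_continuous_on matrix_vector_mul_bounded_linear ballI)
    fix x :: "real^'a" assume "x \<in> sphere 0 1"
    then have "x \<noteq> 0" by auto
    then show "x \<bullet> (P0 *v x) \<noteq> 0" using P0(2)[of x] by simp
  qed
  moreover have "sphere (0::real^'a) 1 \<noteq> {}" by simp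
  ultimately have "\<exists>u\<in>sphere 0 1. \<forall>y\<in>sphere 0 1. ?r u \<le> ?r y"
    by (intro continuous_attains_inf[OF compact_sphere])
  then obtain u where u: "norm u = 1" and min: "\<And>x. norm x = 1 \<Longrightarrow> ?r u \<le> ?r x"
    unfolding Ball_def Bex_def mem_sphere_0 by blast
  have u0: "u \<noteq> 0" using u by auto
  have minr: "?r u \<le> ?r y" if "y \<noteq> 0" for y
  proof -
    have "?r u \<le> ?r (y /\<^sub>R norm y)" using that by (intro min) simp
    also have "\<dots> = ?r y" using that by (simp add: matrix_vector_mult_scaleR)
    finally show ?thesis .
  qed
  define \<kappa> where "\<kappa> = - ?r u"
  have "?r x < 0" using neg P0(2)[OF x] by (simp add: divide_neg_pos)
  then have \<kappa>: "0 < \<kappa>" using minr[OF x] by (simp add: \<kappa>_def)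
  let ?Q = "P + \<kappa> *\<^sub>R P0"
  have Qx: "y \<bullet> (?Q *v y) = y \<bullet> (P *v y) + \<kappa> * (y \<bullet> (P0 *v y))" for y
    by (simp add: matrix_vector_mult_add_rdistrib matrix_vector_mult_scaleR_left inner_add_right)
  have Q: "sym_mat ?Q" by (intro sym_mat_add sym_mat_scaleR s P0)
  have "0 \<le> y \<bullet> (?Q *v y)" for y
  proof (cases "y = 0")
    case False
    then show ?thesis
      unfolding Qx using minr[OF False] P0(2)[OF False] by (simp add: \<kappa>_def pos_le_divide_eq)
  qed simp
  moreover have "u \<bullet> (?Q *v u) = 0"
    unfolding Qx using P0(2)[OF u0] by (simp add: \<kappa>_def)
  ultimately have "0 \<le> u \<bullet> (lyap A C ?Q *v u)" by (intro lyap_at_kernel[OF Q])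
  moreover have "u \<bullet> (lyap A C ?Q *v u) < 0"
    using le[of u] lP0[OF u0] \<kappa> by (simp add: lyap_quadratic_add lyap_quadratic_scaleR
        add_nonpos_neg mult_pos_neg)
  ultimately show False by simp
qed

lemma positive_definite_if_lyap_negative:
  assumes s: "sym_mat P" and pos: "\<And>x. 0 \<le> x \<bullet> (P *v x)"
    and neg: "\<And>x. x \<noteq> 0 \<Longrightarrow> x \<bullet> (lyap A C P *v x) < 0"
  shows "pos_def P"
  unfolding pos_def_def
proof (intro conjI allI impI s)
  fix x :: "real^'a" assume "x \<noteq> 0"
  show "0 < x \<bullet> (P *v x)"
    using lyap_at_kernel[OF s pos, of x A C] neg[OF \<open>x \<noteq> 0\<close>] pos[of x] by fastforce
qed

lemma lyap_mult_vec:
  "lyap A C P *v x = transpose A *v (P *v x) + P *v (A *v x) + transpose C *v (P *v (C *v x))"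
  unfolding lyap_def by (simp only: matrix_vector_mult_add_rdistrib matrix_vector_mul_assoc[symmetric])

lemma lyap_linear: "lyap A C (P + Q) = lyap A C P + lyap A C Q" "lyap A C (c *\<^sub>R P) = c *\<^sub>R lyap A C P"
  by (simp_all add: matrix_eq lyap_mult_vec matrix_vector_mult_add_rdistrib
      matrix_vector_mult_scaleR_left
      matrix_vector_mult_scaleR matrix_vector_right_distrib scaleR_right_distrib)

text \<open>Injectivity gives surjectivity in finite dimension. To work on the space of all matrices instead
  of the subspace of symmetric ones, \<open>lyap\<close> is extended by the identity on skew-symmetric
  matrices.\<close>

lemma lyap_solvable:
  fixes A C :: "real^'n^'n"
  assumes inj: "\<And>P. sym_mat P \<Longrightarrow> lyap A C P = 0 \<Longrightarrow> P = 0" and N: "sym_mat N"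
  shows "\<exists>P. sym_mat P \<and> lyap A C P = N"
proof -
  define S where "S P = (1/2) *\<^sub>R (P + transpose P)" for P :: "real^'n^'n"
  define K where "K P = (1/2) *\<^sub>R (P - transpose P)" for P :: "real^'n^'n"
  define \<Psi> where "\<Psi> P = lyap A C (S P) + K P" for P
  have SK: "S P + K P = P" for P by (simp add: S_def K_def vec_eq_iff field_simps)
  have symS: "sym_mat (S P)" for P by (simp add: S_def sym_mat_def transpose_def vec_eq_iff)
  have skew: "transpose (K P) = - K P" for P by (simp add: K_def transpose_def vec_eq_iff field_simps)
  have transpose_add: "transpose (U + V) = transpose U + transpose V" for U V :: "real^'n^'n"
    by (simp add: transpose_def vec_eq_iff)
  have split: "lyap A C (S P) = N' \<and> K P = 0" if "\<Psi> P = N'" "sym_mat N'" for P N'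
  proof -
    have "transpose (\<Psi> P) = \<Psi> P" using that by (simp add: sym_mat_def)
    moreover have "transpose (\<Psi> P) = lyap A C (S P) - K P"
      using sym_mat_lyap[OF symS, of A C P] skew[of P] transpose_add
      by (simp add: \<Psi>_def sym_mat_def)
    ultimately have "K P + K P = 0" by (simp add: \<Psi>_def algebra_simps)
    then have "K P = 0" by (simp add: vec_eq_iff)
    then show ?thesis using that by (simp add: \<Psi>_def)
  qed
  have S: "S (P + Q) = S P + S Q" "S (c *\<^sub>R P) = c *\<^sub>R S P" for P Q c
    by (simp_all add: S_def vec_eq_iff transpose_def algebra_simps)
  have K: "K (P + Q) = K P + K Q" "K (c *\<^sub>R P) = c *\<^sub>R K P" for P Q c
    by (simp_all add: K_def vec_eq_iff transpose_def algebra_simps)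
  have lin: "linear \<Psi>"
    by (rule linearI) (simp_all add: \<Psi>_def S K lyap_linear scaleR_right_distrib)
  have "inj \<Psi>"
    unfolding linear_injective_0[OF lin]
  proof (intro allI impI)
    fix P assume "\<Psi> P = 0"
    from split[OF this sym_mat_0] have "S P = 0" "K P = 0" using inj[OF symS] by auto
    then show "P = 0" using SK[of P] by simp
  qed
  then have "surj \<Psi>" by (rule linear_inj_imp_surj[OF lin])
  then obtain P where "\<Psi> P = N" by (metis surjD)
  from split[OF this N] show ?thesis using symS by blast
qed

lemma lyapunov_stable_unique:
  assumes st: "lyapunov_stable A C" and s: "sym_mat P" and z: "lyap A C P = 0"
  shows "P = 0"
proof (rule sym_mat_eq_0[OF s])
  fix x
  have "0 \<le> x \<bullet> (P *v x)" using semidefinite_if_lyap_nonpos[OF st s] z by simp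
  moreover have "lyap A C (- P) = 0" using lyap_linear(2)[of A C "-1" P] z by simp
  then have "0 \<le> x \<bullet> ((- P) *v x)"
    using semidefinite_if_lyap_nonpos[OF st sym_mat_uminus[OF s]] by simp
  then have "x \<bullet> (P *v x) \<le> 0"
    using matrix_vector_mult_scaleR_left[of "-1" P x] by simp
  ultimately show "x \<bullet> (P *v x) = 0" by simp
qed

section \<open>Increments of Brownian motion\<close>

lemma integrable_inner_square_integrable:
  fixes f g :: "'a \<Rightarrow> 'b::euclidean_space"
  assumes [measurable]: "f \<in> borel_measurable N" "g \<in> borel_measurable N"
    and "integrable N (\<lambda>x. (norm (f x))\<^sup>2)" "integrable N (\<lambda>x. (norm (g x))\<^sup>2)"
  shows "integrable N (\<lambda>x. f x \<bullet> g x)"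
proof (rule Bochner_Integration.integrable_bound)
  show "integrable N (\<lambda>x. (norm (f x))\<^sup>2 + (norm (g x))\<^sup>2)"
    using assms by simp
  have "\<bar>u \<bullet> v\<bar> \<le> (norm u)\<^sup>2 + (norm v)\<^sup>2" for u v :: 'b
    using Cauchy_Schwarz_ineq2[of u v] sum_squares_bound[of "norm u" "norm v"]
      mult_nonneg_nonneg[OF norm_ge_zero[of u] norm_ge_zero[of v]] by linarith
  then show "AE x in N. norm (f x \<bullet> g x) \<le> norm ((norm (f x))\<^sup>2 + (norm (g x))\<^sup>2)"
    by (auto intro!: AE_I2 order_trans[OF _ abs_ge_self])
qed measurable

lemma norm_sum_power2:
  fixes f :: "'i \<Rightarrow> 'b::real_inner"
  shows "(norm (\<Sum>k\<in>K. f k))\<^sup>2 = (\<Sum>k\<in>K. \<Sum>l\<in>K. f k \<bullet> f l)"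
  unfolding power2_norm_eq_inner inner_sum_left unfolding inner_sum_right ..

locale brownian_setting =
  fixes M :: "'w measure" and F :: "real \<Rightarrow> 'w measure" and W :: "real \<Rightarrow> 'w \<Rightarrow> real"
  assumes filtered: "filtered_space M F" and brownian: "brownian_motion M F W"

sublocale brownian_setting \<subseteq> prob_space M
  using filtered unfolding filtered_space_def by auto

context brownian_setting
begin

abbreviation sq_mean :: "('w \<Rightarrow> 'b::euclidean_space) \<Rightarrow> real" where
  "sq_mean Z \<equiv> expectation (\<lambda>\<omega>. (norm (Z \<omega>))\<^sup>2)"

abbreviation quad_mean :: "real^'n^'n \<Rightarrow> ('w \<Rightarrow> real^'n) \<Rightarrow> real" where
  "quad_mean P Z \<equiv> expectation (\<lambda>\<omega>. Z \<omega> \<bullet> (P *v Z \<omega>))"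

lemma subalgebra_F: "0 \<le> t \<Longrightarrow> subalgebra M (F t)"
  using filtered unfolding filtered_space_def by auto

lemma measurable_F: "0 \<le> t \<Longrightarrow> f \<in> measurable (F t) N \<Longrightarrow> f \<in> measurable M N"
  by (rule measurable_from_subalg[OF subalgebra_F])

lemma measurable_F_mono:
  assumes "0 \<le> s" "s \<le> t" "f \<in> measurable (F s) N"
  shows "f \<in> measurable (F t) N"
proof (rule measurable_from_subalg[OF _ assms(3)])
  show "subalgebra (F t) (F s)"
    using filtered assms unfolding filtered_space_def subalgebra_def by auto
qed

lemma W_measurable_F: "0 \<le> s \<Longrightarrow> s \<le> t \<Longrightarrow> W s \<in> borel_measurable (F t)"
  using brownian measurable_F_mono[of s t "W s"] unfolding brownian_motion_def by auto

lemma W_measurable: "0 \<le> s \<Longrightarrow> W s \<in> borel_measurable M"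
  using W_measurable_F measurable_F by blast

lemma increment_distributed:
  "0 \<le> s \<Longrightarrow> s < t \<Longrightarrow>
     distributed M lborel (\<lambda>\<omega>. W t \<omega> - W s \<omega>) (\<lambda>x. ennreal (normal_density 0 (sqrt (t - s)) x))"
  using brownian unfolding brownian_motion_def by auto

lemma increment_indep:
  assumes "0 \<le> s" "s < t" and Z: "Z \<in> borel_measurable (F s)"
  shows "indep_var borel Z borel (\<lambda>\<omega>. W t \<omega> - W s \<omega>)"
proof -
  let ?D = "\<lambda>\<omega>. W t \<omega> - W s \<omega>"
  have spF: "space (F s) = space M"
    using subalgebra_F[OF assms(1)] by (simp add: subalgebra_def)
  have ind: "indep_set (sets (F s)) {?D -` B \<inter> space M | B. B \<in> sets borel}"
    using brownian assms unfolding brownian_motion_def by auto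
  have "indep_set (sigma_sets (space M) (sets (F s)))
     (sigma_sets (space M) {?D -` B \<inter> space M | B. B \<in> sets borel})"
  proof (rule indep_set_sigma_sets[OF ind])
    show "Int_stable (sets (F s))"
      by (auto simp: Int_stable_def)
    show "Int_stable {?D -` B \<inter> space M |B. B \<in> sets borel}"
    proof (rule Int_stableI, safe)
      fix B C :: "real set" assume "B \<in> sets borel" "C \<in> sets borel"
      then show "\<exists>G. ?D -` B \<inter> space M \<inter> (?D -` C \<inter> space M) = ?D -` G \<inter> space M \<and> G \<in> sets borel"
        by (intro exI[of _ "B \<inter> C"]) auto
    qed
  qed
  moreover have "{Z -` A \<inter> space M | A. A \<in> sets borel} \<subseteq> sets (F s)"
    using Z spF by (auto dest: measurable_sets)
  then have "sigma_sets (space M) {Z -` A \<inter> space M | A. A \<in> sets borel}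
      \<subseteq> sigma_sets (space M) (sets (F s))"
    by (rule sigma_sets_mono')
  ultimately have "indep_set (sigma_sets (space M) {Z -` A \<inter> space M | A. A \<in> sets borel})
     (sigma_sets (space M) {?D -` B \<inter> space M | B. B \<in> sets borel})"
    unfolding indep_sets2_eq by blast
  then show ?thesis
    unfolding indep_var_eq
    using Z W_measurable measurable_F assms by auto
qed

lemma increment_moments:
  assumes "0 \<le> s" "s < t"
  shows "has_bochner_integral M (\<lambda>\<omega>. W t \<omega> - W s \<omega>) 0"
    and "has_bochner_integral M (\<lambda>\<omega>. (W t \<omega> - W s \<omega>)\<^sup>2) (t - s)"
proof -
  let ?\<sigma> = "sqrt (t - s)"
  have \<sigma>: "?\<sigma> > 0" "?\<sigma>\<^sup>2 = t - s" using assms by auto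
  note D = increment_distributed[OF assms]
  have moment: "integrable M (\<lambda>\<omega>. (W t \<omega> - W s \<omega>) ^ k)" for k
  proof -
    have "integrable lborel (\<lambda>x. normal_density 0 ?\<sigma> x * x ^ k)"
      using integrable_normal_moment[OF \<sigma>(1), of 0 k] by simp
    then show ?thesis
      by (subst (asm) distributed_integrable[OF D]) auto
  qed
  have E: "expectation (\<lambda>\<omega>. W t \<omega> - W s \<omega>) = 0"
    by (rule normal_distributed_expectation[OF \<sigma>(1) D])
  then show "has_bochner_integral M (\<lambda>\<omega>. W t \<omega> - W s \<omega>) 0"
    using moment[of 1] by (simp add: has_bochner_integral_iff)
  have "variance (\<lambda>\<omega>. W t \<omega> - W s \<omega>) = t - s"
    using normal_distributed_variance[OF \<sigma>(1) D] \<sigma>(2) by simp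
  then show "has_bochner_integral M (\<lambda>\<omega>. (W t \<omega> - W s \<omega>)\<^sup>2) (t - s)"
    using moment[of 2] E by (simp add: has_bochner_integral_iff)
qed

text \<open>The increment after time \<open>s\<close> is independent of what is known at time \<open>s\<close>.\<close>

lemma mult_increment:
  assumes "0 \<le> s" "s \<le> t" "Z \<in> borel_measurable (F s)" "integrable M Z"
  shows "has_bochner_integral M (\<lambda>\<omega>. Z \<omega> * (W t \<omega> - W s \<omega>)) 0"
    and "has_bochner_integral M (\<lambda>\<omega>. Z \<omega> * (W t \<omega> - W s \<omega>)\<^sup>2) ((t - s) * expectation Z)"
proof -
  consider "s = t" | "s < t" using assms by linarith
  then have "has_bochner_integral M (\<lambda>\<omega>. Z \<omega> * (W t \<omega> - W s \<omega>)) 0 \<and>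
    has_bochner_integral M (\<lambda>\<omega>. Z \<omega> * (W t \<omega> - W s \<omega>)\<^sup>2) ((t - s) * expectation Z)"
  proof cases
    case 1
    then show ?thesis by (simp add: has_bochner_integral_iff)
  next
    case 2
    note ind = increment_indep[OF assms(1) 2 assms(3)]
    have ind2: "indep_var borel Z borel (\<lambda>\<omega>. (W t \<omega> - W s \<omega>)\<^sup>2)"
      using indep_var_compose[OF ind, of "\<lambda>x. x" borel "\<lambda>x. x\<^sup>2" borel] by (simp add: comp_def)
    note mom = increment_moments[OF assms(1) 2, unfolded has_bochner_integral_iff]
    from indep_var_integrable[OF ind assms(4)] indep_var_lebesgue_integral[OF ind assms(4)]
      indep_var_integrable[OF ind2 assms(4)] indep_var_lebesgue_integral[OF ind2 assms(4)] mom
    show ?thesis by (simp add: has_bochner_integral_iff)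
  qed
  then show "has_bochner_integral M (\<lambda>\<omega>. Z \<omega> * (W t \<omega> - W s \<omega>)) 0"
    "has_bochner_integral M (\<lambda>\<omega>. Z \<omega> * (W t \<omega> - W s \<omega>)\<^sup>2) ((t - s) * expectation Z)"
    by auto
qed

definition L2_at :: "real \<Rightarrow> ('w \<Rightarrow> 'b::euclidean_space) \<Rightarrow> bool" where
  "L2_at a \<xi> \<longleftrightarrow> \<xi> \<in> borel_measurable (F a) \<and> integrable M (\<lambda>\<omega>. (norm (\<xi> \<omega>))\<^sup>2)"

lemma L2_at_mono: "0 \<le> a \<Longrightarrow> a \<le> b \<Longrightarrow> L2_at a \<xi> \<Longrightarrow> L2_at b \<xi>"
  unfolding L2_at_def using measurable_F_mono by blast

lemma L2_at_inner:
  fixes \<xi> \<eta> :: "'w \<Rightarrow> 'b::euclidean_space"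
  assumes "0 \<le> a" "L2_at a \<xi>" "L2_at a \<eta>"
  shows "(\<lambda>\<omega>. \<xi> \<omega> \<bullet> \<eta> \<omega>) \<in> borel_measurable (F a)" "integrable M (\<lambda>\<omega>. \<xi> \<omega> \<bullet> \<eta> \<omega>)"
  using assms measurable_F[OF assms(1)] unfolding L2_at_def
  by (auto intro!: integrable_inner_square_integrable)

lemma L2_at_increment_scaleR:
  fixes \<xi> :: "'w \<Rightarrow> 'b::euclidean_space"
  assumes "0 \<le> a" "a \<le> b" "L2_at a \<xi>"
  shows "L2_at b (\<lambda>\<omega>. (W b \<omega> - W a \<omega>) *\<^sub>R \<xi> \<omega>)"
proof -
  have "has_bochner_integral M (\<lambda>\<omega>. (norm (\<xi> \<omega>))\<^sup>2 * (W b \<omega> - W a \<omega>)\<^sup>2)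
      ((b - a) * sq_mean \<xi>)"
    using assms by (intro mult_increment) (auto simp: L2_at_def)
  then have "integrable M (\<lambda>\<omega>. (norm ((W b \<omega> - W a \<omega>) *\<^sub>R \<xi> \<omega>))\<^sup>2)"
    by (simp add: has_bochner_integral_iff power_mult_distrib mult.commute)
  moreover have "(\<lambda>\<omega>. (W b \<omega> - W a \<omega>) *\<^sub>R \<xi> \<omega>) \<in> borel_measurable (F b)"
    using assms measurable_F_mono[of a b] W_measurable_F[of a b] W_measurable_F[of b b]
    unfolding L2_at_def by (intro borel_measurable_scaleR borel_measurable_diff) auto
  ultimately show ?thesis by (simp add: L2_at_def)
qed

text \<open>Both increments are split at \<open>c\<close> and at \<open>e\<close>, the ends of the overlap of the two intervals. In
  the product of the two sums only the squared increment over the overlap has a nonzero mean: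
  every other term contains an increment that is independent of its remaining factors.\<close>

lemma increments_pairing_ordered:
  fixes \<xi> \<eta> :: "'w \<Rightarrow> 'b::euclidean_space"
  assumes "0 \<le> a" "a \<le> b" "a \<le> c" "c \<le> d" and \<xi>: "L2_at a \<xi>" and \<eta>: "L2_at c \<eta>"
  shows "has_bochner_integral M (\<lambda>\<omega>. ((W b \<omega> - W a \<omega>) *\<^sub>R \<xi> \<omega>) \<bullet> ((W d \<omega> - W c \<omega>) *\<^sub>R \<eta> \<omega>))
     (measure lborel ({a..<b} \<inter> {c..<d}) * expectation (\<lambda>\<omega>. \<xi> \<omega> \<bullet> \<eta> \<omega>))"
proof (cases "b \<le> c")
  case True
  have "L2_at c (\<lambda>\<omega>. (W b \<omega> - W a \<omega>) *\<^sub>R \<xi> \<omega>)"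
    using L2_at_increment_scaleR[OF assms(1,2) \<xi>] True L2_at_mono[of b c] assms by auto
  note I = L2_at_inner[OF _ this \<eta>]
  have "has_bochner_integral M (\<lambda>\<omega>. ((W b \<omega> - W a \<omega>) *\<^sub>R \<xi> \<omega>) \<bullet> \<eta> \<omega> * (W d \<omega> - W c \<omega>)) 0"
    using assms I by (intro mult_increment) auto
  moreover have eq: "{a..<b} \<inter> {c..<d} = {}" using True by auto
  ultimately show ?thesis unfolding eq by (simp add: mult_ac)
next
  case False
  define e where "e = min b d"
  define Z where "Z = (\<lambda>\<omega>. \<xi> \<omega> \<bullet> \<eta> \<omega>)"
  have e: "c \<le> e" "e \<le> b" "e \<le> d" "0 \<le> c" "0 \<le> e" using assms False by (auto simp: e_def)
  have \<xi>c: "L2_at c \<xi>" using \<xi> assms L2_at_mono by blast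
  note Z = L2_at_inner[OF e(4) \<xi>c \<eta>, folded Z_def]
  have "L2_at c (\<lambda>\<omega>. (W c \<omega> - W a \<omega>) *\<^sub>R \<xi> \<omega>)"
    using L2_at_increment_scaleR[OF assms(1) assms(3) \<xi>] .
  note Zca = L2_at_inner[OF e(4) this \<eta>]
  have 1: "has_bochner_integral M (\<lambda>\<omega>. ((W c \<omega> - W a \<omega>) *\<^sub>R \<xi> \<omega>) \<bullet> \<eta> \<omega> * (W d \<omega> - W c \<omega>)) 0"
    using assms e Zca by (intro mult_increment) auto
  have 2: "has_bochner_integral M (\<lambda>\<omega>. Z \<omega> * (W e \<omega> - W c \<omega>)\<^sup>2) ((e - c) * expectation Z)"
    using e Z by (intro mult_increment)
  have Zec: "integrable M (\<lambda>\<omega>. Z \<omega> * (W e \<omega> - W c \<omega>))"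
    using mult_increment(1)[OF e(4,1) Z] by (simp add: has_bochner_integral_iff)
  have Zec': "(\<lambda>\<omega>. Z \<omega> * (W e \<omega> - W c \<omega>)) \<in> borel_measurable (F e)"
    using e measurable_F_mono[OF e(4,1) Z(1)] W_measurable_F[of c e] W_measurable_F[of e e]
    by (intro borel_measurable_times borel_measurable_diff) auto
  have 3: "has_bochner_integral M (\<lambda>\<omega>. Z \<omega> * (W e \<omega> - W c \<omega>) * (W d \<omega> - W e \<omega>)) 0"
    using e Zec Zec' by (intro mult_increment)
  have 4: "has_bochner_integral M (\<lambda>\<omega>. Z \<omega> * (W e \<omega> - W c \<omega>) * (W b \<omega> - W e \<omega>)) 0"
    using e Zec Zec' by (intro mult_increment)
  have "has_bochner_integral M (\<lambda>\<omega>. ((W c \<omega> - W a \<omega>) *\<^sub>R \<xi> \<omega>) \<bullet> \<eta> \<omega> * (W d \<omega> - W c \<omega>)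
      + Z \<omega> * (W e \<omega> - W c \<omega>)\<^sup>2 + Z \<omega> * (W e \<omega> - W c \<omega>) * (W d \<omega> - W e \<omega>)
      + Z \<omega> * (W e \<omega> - W c \<omega>) * (W b \<omega> - W e \<omega>)) (0 + (e - c) * expectation Z + 0 + 0)"
    by (intro has_bochner_integral_add 1 2 3 4)
  moreover have eq: "{a..<b} \<inter> {c..<d} = {c..<e}" using assms by (auto simp: e_def)
  moreover have "((W b \<omega> - W a \<omega>) *\<^sub>R \<xi> \<omega>) \<bullet> ((W d \<omega> - W c \<omega>) *\<^sub>R \<eta> \<omega>)
     = ((W c \<omega> - W a \<omega>) *\<^sub>R \<xi> \<omega>) \<bullet> \<eta> \<omega> * (W d \<omega> - W c \<omega>)
      + Z \<omega> * (W e \<omega> - W c \<omega>)\<^sup>2 + Z \<omega> * (W e \<omega> - W c \<omega>) * (W d \<omega> - W e \<omega>)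
      + Z \<omega> * (W e \<omega> - W c \<omega>) * (W b \<omega> - W e \<omega>)" for \<omega>
    unfolding Z_def e_def min_def by (auto simp: power2_eq_square algebra_simps)
  ultimately show ?thesis unfolding eq using e by (simp add: Z_def)
qed

lemma increments_pairing:
  fixes \<xi> \<eta> :: "'w \<Rightarrow> 'b::euclidean_space"
  assumes "0 \<le> a" "a \<le> b" "0 \<le> c" "c \<le> d" and \<xi>: "L2_at a \<xi>" and \<eta>: "L2_at c \<eta>"
  shows "has_bochner_integral M (\<lambda>\<omega>. ((W b \<omega> - W a \<omega>) *\<^sub>R \<xi> \<omega>) \<bullet> ((W d \<omega> - W c \<omega>) *\<^sub>R \<eta> \<omega>))
     (measure lborel ({a..<b} \<inter> {c..<d}) * expectation (\<lambda>\<omega>. \<xi> \<omega> \<bullet> \<eta> \<omega>))"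
proof (cases "a \<le> c")
  case True
  then show ?thesis using assms by (intro increments_pairing_ordered)
next
  case False
  then show ?thesis
    using increments_pairing_ordered[of c d a b \<eta> \<xi>] assms
    by (simp add: inner_commute Int_commute)
qed

text \<open>The Ito isometry for finite sums of increments. The intervals may overlap, so that the
  difference of two step integrals over unrelated partitions is an instance.\<close>

lemma increments_isometry:
  fixes \<xi> :: "'i \<Rightarrow> 'w \<Rightarrow> 'b::euclidean_space"
  assumes "finite K" and K: "\<And>k. k \<in> K \<Longrightarrow> 0 \<le> a k \<and> a k \<le> b k \<and> b k \<le> T \<and> L2_at (a k) (\<xi> k)"
  shows "(\<integral>\<^sup>+\<omega>. ennreal ((norm (\<Sum>k\<in>K. (W (b k) \<omega> - W (a k) \<omega>) *\<^sub>R \<xi> k \<omega>))\<^sup>2) \<partial>M)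
    = (\<integral>\<^sup>+\<omega>. (\<integral>\<^sup>+s\<in>{0..T}. ennreal ((norm (\<Sum>k\<in>K. indicator {a k..<b k} s *\<^sub>R \<xi> k \<omega>))\<^sup>2) \<partial>lborel) \<partial>M)"
proof -
  define m where "m k l = measure lborel ({a k..<b k} \<inter> {a l..<b l})" for k l
  have "has_bochner_integral M
      (\<lambda>\<omega>. \<Sum>k\<in>K. \<Sum>l\<in>K. ((W (b k) \<omega> - W (a k) \<omega>) *\<^sub>R \<xi> k \<omega>) \<bullet> ((W (b l) \<omega> - W (a l) \<omega>) *\<^sub>R \<xi> l \<omega>))
      (\<Sum>k\<in>K. \<Sum>l\<in>K. m k l * expectation (\<lambda>\<omega>. \<xi> k \<omega> \<bullet> \<xi> l \<omega>))"
    unfolding m_def using K by (intro has_bochner_integral_sum increments_pairing) auto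
  then have L: "has_bochner_integral M
      (\<lambda>\<omega>. (norm (\<Sum>k\<in>K. (W (b k) \<omega> - W (a k) \<omega>) *\<^sub>R \<xi> k \<omega>))\<^sup>2)
      (\<Sum>k\<in>K. \<Sum>l\<in>K. m k l * expectation (\<lambda>\<omega>. \<xi> k \<omega> \<bullet> \<xi> l \<omega>))"
    by (simp only: norm_sum_power2)
  have inner: "(\<integral>\<^sup>+s\<in>{0..T}. ennreal ((norm (\<Sum>k\<in>K. indicator {a k..<b k} s *\<^sub>R \<xi> k \<omega>))\<^sup>2) \<partial>lborel)
      = ennreal (\<Sum>k\<in>K. \<Sum>l\<in>K. m k l * (\<xi> k \<omega> \<bullet> \<xi> l \<omega>))" 
     "0 \<le> (\<Sum>k\<in>K. \<Sum>l\<in>K. m k l * (\<xi> k \<omega> \<bullet> \<xi> l \<omega>))" for \<omega>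
  proof -
    have "has_bochner_integral lborel
       (\<lambda>s. \<Sum>k\<in>K. \<Sum>l\<in>K. indicator ({a k..<b k} \<inter> {a l..<b l}) s * (\<xi> k \<omega> \<bullet> \<xi> l \<omega>))
       (\<Sum>k\<in>K. \<Sum>l\<in>K. m k l * (\<xi> k \<omega> \<bullet> \<xi> l \<omega>))"
      unfolding m_def
    proof (intro has_bochner_integral_sum has_bochner_integral_mult_left)
      fix k l
      have "emeasure lborel ({a k..<b k} \<inter> {a l..<b l}) \<le> emeasure lborel {a k..<b k}"
        by (rule emeasure_mono) auto
      also have "\<dots> < \<infinity>" by (cases "a k \<le> b k") auto
      finally show "has_bochner_integral lborel (indicat_real ({a k..<b k} \<inter> {a l..<b l}))
          (Sigma_Algebra.measure lborel ({a k..<b k} \<inter> {a l..<b l}))"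
        by (intro has_bochner_integral_real_indicator) auto
    qed
    moreover have "(\<Sum>k\<in>K. \<Sum>l\<in>K. indicator ({a k..<b k} \<inter> {a l..<b l}) s * (\<xi> k \<omega> \<bullet> \<xi> l \<omega>))
       = (norm (\<Sum>k\<in>K. indicator {a k..<b k} s *\<^sub>R \<xi> k \<omega>))\<^sup>2" for s
      unfolding norm_sum_power2 indicator_inter_arith by (simp add: mult_ac)
    ultimately have H: "has_bochner_integral lborel
        (\<lambda>s. (norm (\<Sum>k\<in>K. indicator {a k..<b k} s *\<^sub>R \<xi> k \<omega>))\<^sup>2)
        (\<Sum>k\<in>K. \<Sum>l\<in>K. m k l * (\<xi> k \<omega> \<bullet> \<xi> l \<omega>))" by simp
    have "(\<integral>\<^sup>+s\<in>{0..T}. ennreal ((norm (\<Sum>k\<in>K. indicator {a k..<b k} s *\<^sub>R \<xi> k \<omega>))\<^sup>2) \<partial>lborel)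
       = (\<integral>\<^sup>+s. ennreal ((norm (\<Sum>k\<in>K. indicator {a k..<b k} s *\<^sub>R \<xi> k \<omega>))\<^sup>2) \<partial>lborel)"
    proof (rule nn_integral_cong)
      fix s
      have "(\<Sum>k\<in>K. indicator {a k..<b k} s *\<^sub>R \<xi> k \<omega>) = 0" if "s \<notin> {0..T}"
        using K that by (intro sum.neutral) (fastforce simp: indicator_def)
      then show "ennreal ((norm (\<Sum>k\<in>K. indicator {a k..<b k} s *\<^sub>R \<xi> k \<omega>))\<^sup>2) * indicator {0..T} s
          = ennreal ((norm (\<Sum>k\<in>K. indicator {a k..<b k} s *\<^sub>R \<xi> k \<omega>))\<^sup>2)"
        by (cases "s \<in> {0..T}") auto
    qed
    also have "\<dots> = ennreal (\<integral>s. (norm (\<Sum>k\<in>K. indicator {a k..<b k} s *\<^sub>R \<xi> k \<omega>))\<^sup>2 \<partial>lborel)"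
      using H by (intro nn_integral_eq_integral) (auto simp: has_bochner_integral_iff)
    finally show "(\<integral>\<^sup>+s\<in>{0..T}. ennreal ((norm (\<Sum>k\<in>K. indicator {a k..<b k} s *\<^sub>R \<xi> k \<omega>))\<^sup>2) \<partial>lborel)
      = ennreal (\<Sum>k\<in>K. \<Sum>l\<in>K. m k l * (\<xi> k \<omega> \<bullet> \<xi> l \<omega>))"
      using H by (simp add: has_bochner_integral_iff)
    have "(\<Sum>k\<in>K. \<Sum>l\<in>K. m k l * (\<xi> k \<omega> \<bullet> \<xi> l \<omega>))
        = (\<integral>s. (norm (\<Sum>k\<in>K. indicator {a k..<b k} s *\<^sub>R \<xi> k \<omega>))\<^sup>2 \<partial>lborel)"
      using H by (simp add: has_bochner_integral_iff)
    then show "0 \<le> (\<Sum>k\<in>K. \<Sum>l\<in>K. m k l * (\<xi> k \<omega> \<bullet> \<xi> l \<omega>))" by simp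
  qed
  have "integrable M (\<lambda>\<omega>. \<xi> k \<omega> \<bullet> \<xi> l \<omega>)" if "k \<in> K" "l \<in> K" for k l
    using that K measurable_F unfolding L2_at_def
    by (intro integrable_inner_square_integrable) blast+
  then have R: "has_bochner_integral M (\<lambda>\<omega>. \<Sum>k\<in>K. \<Sum>l\<in>K. m k l * (\<xi> k \<omega> \<bullet> \<xi> l \<omega>))
      (\<Sum>k\<in>K. \<Sum>l\<in>K. m k l * expectation (\<lambda>\<omega>. \<xi> k \<omega> \<bullet> \<xi> l \<omega>))"
    by (intro has_bochner_integral_sum has_bochner_integral_mult_right)
       (auto simp: has_bochner_integral_iff)
  show ?thesis
    unfolding inner(1)
    using L R inner(2) by (subst (1 2) nn_integral_eq_integral) (auto simp: has_bochner_integral_iff)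
qed

end

section \<open>Mean-square norms of processes\<close>

lemma norm_add_power2_le:
  fixes u v :: "'b::real_normed_vector"
  shows "(norm (u + v))\<^sup>2 \<le> 2 * (norm u)\<^sup>2 + 2 * (norm v)\<^sup>2"
proof -
  have "(norm (u + v))\<^sup>2 \<le> (norm u + norm v)\<^sup>2"
    by (intro power_mono norm_triangle_ineq) auto
  also have "\<dots> \<le> 2 * (norm u)\<^sup>2 + 2 * (norm v)\<^sup>2"
    using sum_squares_bound[of "norm u" "norm v"] by (simp add: power2_sum)
  finally show ?thesis .
qed

lemma norm_add3_power2_le:
  fixes u v w :: "'b::real_normed_vector"
  shows "(norm (u + v + w))\<^sup>2 \<le> 3 * ((norm u)\<^sup>2 + (norm v)\<^sup>2 + (norm w)\<^sup>2)"
proof -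
  have "(norm (u + v + w))\<^sup>2 \<le> (norm u + norm v + norm w)\<^sup>2"
    by (intro power_mono norm_triangle_mono norm_triangle_ineq order_refl) auto
  also have "\<dots> \<le> 3 * ((norm u)\<^sup>2 + (norm v)\<^sup>2 + (norm w)\<^sup>2)"
    using sum_squares_bound[of "norm u" "norm v"] sum_squares_bound[of "norm u" "norm w"]
      sum_squares_bound[of "norm v" "norm w"] by (simp add: power2_eq_square algebra_simps)
  finally show ?thesis .
qed

lemma norm_le_one_plus_power2:
  fixes u :: "'b::real_normed_vector"
  shows "norm u \<le> 1 + (norm u)\<^sup>2"
proof -
  have "2 * norm u \<le> 1 + (norm u)\<^sup>2" using sum_squares_bound[of 1 "norm u"] by simp
  then show ?thesis using norm_ge_zero[of u] by linarith
qed

text \<open>The interval has finite length, and \<open>|g| \<le> 1 + |g|\<^sup>2\<close>.\<close>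

lemma integrable_if_square_integrable:
  fixes g :: "real \<Rightarrow> 'b::euclidean_space"
  assumes m: "(\<lambda>s. indicator {0..t} s *\<^sub>R g s) \<in> borel_measurable lborel" and t: "0 \<le> t"
    and fin: "(\<integral>\<^sup>+s\<in>{0..t}. ennreal ((norm (g s))\<^sup>2) \<partial>lborel) \<noteq> \<infinity>"
  shows "integrable lborel (\<lambda>s. (norm (indicator {0..t} s *\<^sub>R g s))\<^sup>2)"
    and "integrable lborel (\<lambda>s. indicator {0..t} s *\<^sub>R g s)"
proof -
  define h where "h s = indicator {0..t} s *\<^sub>R g s" for s
  have [measurable]: "h \<in> borel_measurable lborel" unfolding h_def by (rule m)
  have "(\<integral>\<^sup>+s\<in>{0..t}. ennreal ((norm (g s))\<^sup>2) \<partial>lborel) = (\<integral>\<^sup>+s. ennreal ((norm (h s))\<^sup>2) \<partial>lborel)"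
    by (intro nn_integral_cong) (auto simp: h_def indicator_def)
  then have i2: "integrable lborel (\<lambda>s. (norm (h s))\<^sup>2)"
    using fin by (intro integrableI_nonneg) (auto simp: less_top)
  then show "integrable lborel (\<lambda>s. (norm (indicator {0..t} s *\<^sub>R g s))\<^sup>2)" by (simp only: h_def)
  have hb: "norm (h s) \<le> indicator {0..t} s + (norm (h s))\<^sup>2" for s
  proof (cases "s \<in> {0..t}")
    case True
    then show ?thesis using norm_le_one_plus_power2[of "h s"] by simp
  qed (simp add: h_def)
  have "integrable lborel h"
    by (rule Bochner_Integration.integrable_bound[of _ "\<lambda>s. indicat_real {0..t} s + (norm (h s))\<^sup>2"])
       (use i2 t in \<open>auto intro!: AE_I2 order_trans[OF hb]\<close>)
  then show "integrable lborel (\<lambda>s. indicator {0..t} s *\<^sub>R g s)" by (simp add: h_def[abs_def])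
qed

text \<open>The Cauchy-Schwarz inequality, which follows from integrating \<open>(|g| - I / t)\<^sup>2 \<ge> 0\<close> for \<open>I\<close> the
  integral of \<open>|g|\<close>. With values in \<open>ennreal\<close> it also covers functions that are not square
  integrable.\<close>

lemma norm_set_integral_power2_le:
  fixes g :: "real \<Rightarrow> 'b::euclidean_space"
  assumes [measurable]: "(\<lambda>s. indicator {0..t} s *\<^sub>R g s) \<in> borel_measurable lborel" and "0 \<le> t"
  shows "ennreal ((norm (LINT s:{0..t}|lborel. g s))\<^sup>2)
    \<le> ennreal t * (\<integral>\<^sup>+s\<in>{0..t}. ennreal ((norm (g s))\<^sup>2) \<partial>lborel)"
proof (cases "t = 0 \<or> (\<integral>\<^sup>+s\<in>{0..t}. ennreal ((norm (g s))\<^sup>2) \<partial>lborel) = \<infinity>")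
  case True
  moreover have "(LINT s:{0..t}|lborel. g s) = 0" if "t = 0"
  proof -
    have "AE s in lborel. indicator {0..t} s *\<^sub>R g s = 0"
      using AE_lborel_singleton[of 0] that by (auto elim!: eventually_mono)
    then show ?thesis
      unfolding set_lebesgue_integral_def by (rule integral_eq_zero_AE)
  qed
  ultimately show ?thesis using \<open>0 \<le> t\<close> by (auto simp: ennreal_mult_top)
next
  case False
  then have t: "0 < t" using assms by auto
  define h where "h s = indicator {0..t} s *\<^sub>R g s" for s
  have h2: "(\<integral>\<^sup>+s\<in>{0..t}. ennreal ((norm (g s))\<^sup>2) \<partial>lborel) = (\<integral>\<^sup>+s. ennreal ((norm (h s))\<^sup>2) \<partial>lborel)"
    by (intro nn_integral_cong) (auto simp: h_def indicator_def)
  have fin: "integrable lborel (\<lambda>s. (norm (h s))\<^sup>2)" and "integrable lborel h"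
    unfolding h_def using integrable_if_square_integrable[OF assms] False by auto
  then have int_n: "integrable lborel (\<lambda>s. norm (h s))" by simp
  have ind: "integrable lborel (indicat_real {0..t})"
    using t by (intro integrable_real_indicator) auto
  define I where "I = (\<integral>s. norm (h s) \<partial>lborel)"
  have I0: "0 \<le> I" unfolding I_def by simp
  have pt: "2 * (I/t) * norm (h s) \<le> (norm (h s))\<^sup>2 + (I/t)\<^sup>2 * indicator {0..t} s" for s
  proof (cases "s \<in> {0..t}")
    case True
    then show ?thesis using sum_squares_bound[of "I/t" "norm (h s)"] by simp
  qed (simp add: h_def)
  have "(\<integral>s. 2 * (I/t) * norm (h s) \<partial>lborel) \<le> (\<integral>s. (norm (h s))\<^sup>2
      + (I/t)\<^sup>2 * indicator {0..t} s \<partial>lborel)"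
    using pt by (intro integral_mono Bochner_Integration.integrable_add fin integrable_mult_right
        int_n ind)
  also have "\<dots> = (\<integral>s. (norm (h s))\<^sup>2 \<partial>lborel) + (I/t)\<^sup>2 * t"
    using fin ind t by simp
  finally have "I\<^sup>2 \<le> t * (\<integral>s. (norm (h s))\<^sup>2 \<partial>lborel)"
    using t by (simp add: I_def[symmetric] field_simps power2_eq_square)
  moreover have "norm (LINT s:{0..t}|lborel. g s) \<le> I"
    unfolding set_lebesgue_integral_def I_def h_def by (rule integral_norm_bound)
  then have "(norm (LINT s:{0..t}|lborel. g s))\<^sup>2 \<le> I\<^sup>2" by (intro power_mono) auto
  ultimately have "(norm (LINT s:{0..t}|lborel. g s))\<^sup>2 \<le> t * (\<integral>s. (norm (h s))\<^sup>2 \<partial>lborel)" by simp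
  then have "ennreal ((norm (LINT s:{0..t}|lborel. g s))\<^sup>2)
      \<le> ennreal (t * (\<integral>s. (norm (h s))\<^sup>2 \<partial>lborel))"
    by (rule ennreal_leI)
  also have "\<dots> = ennreal t * (\<integral>\<^sup>+s. ennreal ((norm (h s))\<^sup>2) \<partial>lborel)"
    using fin t by (simp add: ennreal_mult nn_integral_eq_integral)
  finally show ?thesis by (simp add: h2)
qed

context brownian_setting
begin

definition mean_sq :: "('w \<Rightarrow> 'b::euclidean_space) \<Rightarrow> ennreal" where
  "mean_sq Z = (\<integral>\<^sup>+\<omega>. ennreal ((norm (Z \<omega>))\<^sup>2) \<partial>M)"

definition mean_sq_upto :: "real \<Rightarrow> (real \<Rightarrow> 'w \<Rightarrow> 'b::euclidean_space) \<Rightarrow> ennreal" where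
  "mean_sq_upto T X = (\<integral>\<^sup>+\<omega>. (\<integral>\<^sup>+s\<in>{0..T}. ennreal ((norm (X s \<omega>))\<^sup>2) \<partial>lborel) \<partial>M)"

text \<open>The form in which Tonelli's theorem uses a process on \<open>[0, T]\<close>: extended by zero to all times.\<close>

definition jointly_measurable :: "real \<Rightarrow> (real \<Rightarrow> 'w \<Rightarrow> 'b::euclidean_space) \<Rightarrow> bool" where
  "jointly_measurable T X \<longleftrightarrow> (\<lambda>(s, \<omega>). indicator {0..T} s *\<^sub>R X s \<omega>) \<in> borel_measurable (lborel \<Otimes>\<^sub>M M)"

lemma mean_sq_add:
  fixes Y Z :: "'w \<Rightarrow> 'b::euclidean_space"
  assumes [measurable]: "Y \<in> borel_measurable M" "Z \<in> borel_measurable M"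
  shows "mean_sq (\<lambda>\<omega>. Y \<omega> + Z \<omega>) \<le> 2 * mean_sq Y + 2 * mean_sq Z"
proof -
  have "mean_sq (\<lambda>\<omega>. Y \<omega> + Z \<omega>)
      \<le> (\<integral>\<^sup>+\<omega>. 2 * ennreal ((norm (Y \<omega>))\<^sup>2) + 2 * ennreal ((norm (Z \<omega>))\<^sup>2) \<partial>M)"
    unfolding mean_sq_def
  proof (rule nn_integral_mono)
    fix \<omega>
    have "ennreal ((norm (Y \<omega> + Z \<omega>))\<^sup>2) \<le> ennreal (2 * (norm (Y \<omega>))\<^sup>2 + 2 * (norm (Z \<omega>))\<^sup>2)"
      by (intro ennreal_leI norm_add_power2_le)
    then show "ennreal ((norm (Y \<omega> + Z \<omega>))\<^sup>2) \<le> 2 * ennreal ((norm (Y \<omega>))\<^sup>2)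
        + 2 * ennreal ((norm (Z \<omega>))\<^sup>2)"
      by (simp add: ennreal_mult)
  qed
  also have "\<dots> = 2 * mean_sq Y + 2 * mean_sq Z"
    unfolding mean_sq_def by (simp add: nn_integral_add nn_integral_cmult)
  finally show ?thesis .
qed

lemma mean_sq_add3:
  fixes X Y Z :: "'w \<Rightarrow> 'b::euclidean_space"
  assumes [measurable]: "X \<in> borel_measurable M" "Y \<in> borel_measurable M" "Z \<in> borel_measurable M"
  shows "mean_sq (\<lambda>\<omega>. X \<omega> + Y \<omega> + Z \<omega>) \<le> 3 * (mean_sq X + mean_sq Y + mean_sq Z)"
proof -
  have "mean_sq (\<lambda>\<omega>. X \<omega> + Y \<omega> + Z \<omega>)
      \<le> (\<integral>\<^sup>+\<omega>. 3 * (ennreal ((norm (X \<omega>))\<^sup>2) + ennreal ((norm (Y \<omega>))\<^sup>2) + ennreal ((norm (Z \<omega>))\<^sup>2)) \<partial>M)"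
    unfolding mean_sq_def
  proof (rule nn_integral_mono)
    fix \<omega>
    have "ennreal ((norm (X \<omega> + Y \<omega> + Z \<omega>))\<^sup>2)
        \<le> ennreal (3 * ((norm (X \<omega>))\<^sup>2 + (norm (Y \<omega>))\<^sup>2 + (norm (Z \<omega>))\<^sup>2))"
      by (intro ennreal_leI norm_add3_power2_le)
    then show "ennreal ((norm (X \<omega> + Y \<omega> + Z \<omega>))\<^sup>2)
        \<le> 3 * (ennreal ((norm (X \<omega>))\<^sup>2) + ennreal ((norm (Y \<omega>))\<^sup>2) + ennreal ((norm (Z \<omega>))\<^sup>2))"
      by (simp add: ennreal_mult)
  qed
  also have "\<dots> = 3 * (mean_sq X + mean_sq Y + mean_sq Z)"
    unfolding mean_sq_def by (simp add: nn_integral_add nn_integral_cmult)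
  finally show ?thesis .
qed

lemma mean_sq_cong_AE: "AE \<omega> in M. Y \<omega> = Z \<omega> \<Longrightarrow> mean_sq Y = mean_sq Z"
  unfolding mean_sq_def by (intro nn_integral_cong_AE) auto

lemma jointly_measurable_power2:
  "jointly_measurable T X \<Longrightarrow>
    (\<lambda>(s, \<omega>). ennreal ((norm (X s \<omega>))\<^sup>2) * indicator {0..T} s) \<in> borel_measurable (lborel \<Otimes>\<^sub>M M)"
proof -
  assume "jointly_measurable T X"
  then have "(\<lambda>p. ennreal ((norm ((\<lambda>(s, \<omega>). indicator {0..T} s *\<^sub>R X s \<omega>) p))\<^sup>2)) \<in> borel_measurable
      (lborel \<Otimes>\<^sub>M M)"
    unfolding jointly_measurable_def by measurable
  moreover have "ennreal ((norm (indicator {0..T} s *\<^sub>R X s \<omega>))\<^sup>2)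
      = ennreal ((norm (X s \<omega>))\<^sup>2) * indicator {0..T} s" for s \<omega>
    by (auto simp: indicator_def)
  ultimately show ?thesis by (simp only: split_beta')
qed

lemma mean_sq_upto_eq:
  assumes "jointly_measurable T X"
  shows "mean_sq_upto T X = (\<integral>\<^sup>+s\<in>{0..T}. mean_sq (X s) \<partial>lborel)"
    and "(\<lambda>s. mean_sq (X s) * indicator {0..T} s) \<in> borel_measurable lborel"
    and "(\<lambda>\<omega>. \<integral>\<^sup>+s\<in>{0..T}. ennreal ((norm (X s \<omega>))\<^sup>2) \<partial>lborel) \<in> borel_measurable M"
proof -
  interpret P: pair_sigma_finite lborel M ..
  note m = jointly_measurable_power2[OF assms]
  have eq: "(\<integral>\<^sup>+\<omega>. ennreal ((norm (X s \<omega>))\<^sup>2) * indicator {0..T} s \<partial>M)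
      = mean_sq (X s) * indicator {0..T} s" for s
    unfolding mean_sq_def by (cases "s \<in> {0..T}") auto
  show "mean_sq_upto T X = (\<integral>\<^sup>+s\<in>{0..T}. mean_sq (X s) \<partial>lborel)"
    unfolding mean_sq_upto_def using P.Fubini'[OF m] by (simp add: eq)
  show "(\<lambda>s. mean_sq (X s) * indicator {0..T} s) \<in> borel_measurable lborel"
    using borel_measurable_nn_integral_fst[OF m] by (simp add: eq)
  show "(\<lambda>\<omega>. \<integral>\<^sup>+s\<in>{0..T}. ennreal ((norm (X s \<omega>))\<^sup>2) \<partial>lborel) \<in> borel_measurable M"
    using lborel.borel_measurable_nn_integral[OF measurable_pair_swap[OF m]] by (simp add: split_beta')
qed

lemma jointly_measurable_section:
  assumes "jointly_measurable T X" "\<omega> \<in> space M"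
  shows "(\<lambda>s. indicator {0..T} s *\<^sub>R X s \<omega>) \<in> borel_measurable lborel"
  using measurable_compose[OF measurable_Pair2'[OF assms(2)] assms(1)[unfolded jointly_measurable_def]]
  by simp

lemma jointly_measurable_at:
  assumes "jointly_measurable T X" "s \<in> {0..T}"
  shows "X s \<in> borel_measurable M"
  using measurable_compose[OF measurable_Pair1'[of s lborel M] assms(1)[unfolded
      jointly_measurable_def]] assms(2)
  by simp

lemma jointly_measurable_add:
  "jointly_measurable T X \<Longrightarrow> jointly_measurable T Y \<Longrightarrow> jointly_measurable T (\<lambda>s \<omega>. X s \<omega> + Y s \<omega>)"
  unfolding jointly_measurable_def
  by (drule (1) borel_measurable_add) (simp add: split_beta' scaleR_add_right)

lemma jointly_measurable_diff:
  "jointly_measurable T X \<Longrightarrow> jointly_measurable T Y \<Longrightarrow> jointly_measurable T (\<lambda>s \<omega>. X s \<omega> - Y s \<omega>)"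
  unfolding jointly_measurable_def
  by (drule (1) borel_measurable_diff) (simp add: split_beta' scaleR_diff_right)

lemma jointly_measurable_linear:
  fixes X :: "real \<Rightarrow> 'w \<Rightarrow> 'b::euclidean_space" and f :: "'b \<Rightarrow> 'c::euclidean_space"
  assumes "bounded_linear f" "jointly_measurable T X"
  shows "jointly_measurable T (\<lambda>s \<omega>. f (X s \<omega>))"
proof -
  interpret f: bounded_linear f by fact
  have "f \<in> borel_measurable borel"
    by (intro borel_measurable_continuous_onI linear_continuous_on assms(1))
  from measurable_compose[OF assms(2)[unfolded jointly_measurable_def] this]
  show ?thesis unfolding jointly_measurable_def by (simp add: split_beta' f.scaleR)
qed

lemma progressive_jointly_measurable:
  fixes X :: "real \<Rightarrow> 'w \<Rightarrow> 'b::euclidean_space"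
  assumes "progressive F X" "0 \<le> T"
  shows "jointly_measurable T X"
proof -
  let ?R = "restrict_space (lborel \<Otimes>\<^sub>M M) ({0..T} \<times> space M)"
  have X: "(\<lambda>(s, \<omega>). X s \<omega>) \<in> borel_measurable (restrict_space borel {0..T} \<Otimes>\<^sub>M F T)"
    using assms unfolding progressive_def by auto
  have id: "(\<lambda>x. x) \<in> measurable M (F T)"
    using subalgebra_F[OF assms(2)] unfolding subalgebra_def measurable_def
    by (auto dest: sets.sets_into_space)
  have "fst \<in> measurable ?R (restrict_space borel {0..T})"
    by (intro measurable_restrict_space2 measurable_restrict_space1)
       (auto simp: space_restrict_space)
  moreover have "snd \<in> measurable ?R (F T)"
    by (rule measurable_compose[OF measurable_restrict_space1[OF measurable_snd] id])
  ultimately have "(\<lambda>p. (fst p, snd p)) \<in> measurable ?R (restrict_space borel {0..T} \<Otimes>\<^sub>M F T)"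
    by (rule measurable_Pair)
  from measurable_compose[OF this X]
  have "(\<lambda>(s, \<omega>). X s \<omega>) \<in> borel_measurable ?R" by (simp add: split_beta')
  then have "(\<lambda>p. indicat_real ({0..T} \<times> space M) p *\<^sub>R (case p of (s, \<omega>) \<Rightarrow> X s \<omega>)) \<in>
      borel_measurable (lborel \<Otimes>\<^sub>M M)"
    by (subst (asm) borel_measurable_restrict_space_iff) auto
  then show ?thesis
    unfolding jointly_measurable_def
    by (rule measurable_cong[THEN iffD1, rotated]) (auto simp: space_pair_measure indicator_def)
qed

lemma mean_sq_upto_add3:
  fixes X Y Z :: "real \<Rightarrow> 'w \<Rightarrow> 'b::euclidean_space"
  assumes J: "jointly_measurable T X" "jointly_measurable T Y" "jointly_measurable T Z"
  shows "mean_sq_upto T (\<lambda>s \<omega>. X s \<omega> + Y s \<omega> + Z s \<omega>)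
     \<le> 3 * (mean_sq_upto T X + mean_sq_upto T Y + mean_sq_upto T Z)"
proof -
  note JS = jointly_measurable_add[OF jointly_measurable_add[OF J(1,2)] J(3)]
  note [measurable] = mean_sq_upto_eq(2)[OF J(1)] mean_sq_upto_eq(2)[OF J(2)] mean_sq_upto_eq(2)[OF
      J(3)]
  have "mean_sq_upto T (\<lambda>s \<omega>. X s \<omega> + Y s \<omega> + Z s \<omega>)
     \<le> (\<integral>\<^sup>+s. 3 * (mean_sq (X s) * indicator {0..T} s + mean_sq (Y s) * indicator {0..T} s
           + mean_sq (Z s) * indicator {0..T} s) \<partial>lborel)"
    unfolding mean_sq_upto_eq(1)[OF JS]
    using J by (intro nn_integral_mono) (auto simp: indicator_def distrib_left intro!:
        mean_sq_add3[unfolded distrib_left] jointly_measurable_at)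
  also have "\<dots> = 3 * (mean_sq_upto T X + mean_sq_upto T Y + mean_sq_upto T Z)"
    unfolding J[THEN mean_sq_upto_eq(1)] by (simp add: nn_integral_cmult nn_integral_add)
  finally show ?thesis .
qed

lemma mean_sq_linear:
  fixes Z :: "'w \<Rightarrow> 'b::euclidean_space" and f :: "'b \<Rightarrow> 'c::euclidean_space"
  assumes "bounded_linear f" and [measurable]: "Z \<in> borel_measurable M"
  shows "mean_sq (\<lambda>\<omega>. f (Z \<omega>)) \<le> ennreal ((onorm f)\<^sup>2) * mean_sq Z"
proof -
  have "mean_sq (\<lambda>\<omega>. f (Z \<omega>)) \<le> (\<integral>\<^sup>+\<omega>. ennreal ((onorm f)\<^sup>2) * ennreal ((norm (Z \<omega>))\<^sup>2) \<partial>M)"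
    unfolding mean_sq_def
  proof (rule nn_integral_mono)
    fix \<omega>
    have "(norm (f (Z \<omega>)))\<^sup>2 \<le> (onorm f * norm (Z \<omega>))\<^sup>2"
      by (intro power_mono onorm assms) auto
    then show "ennreal ((norm (f (Z \<omega>)))\<^sup>2) \<le> ennreal ((onorm f)\<^sup>2) * ennreal ((norm (Z \<omega>))\<^sup>2)"
      by (subst ennreal_mult[symmetric]) (auto simp: power_mult_distrib intro!: ennreal_leI)
  qed
  also have "\<dots> = ennreal ((onorm f)\<^sup>2) * mean_sq Z"
    unfolding mean_sq_def by (simp add: nn_integral_cmult)
  finally show ?thesis .
qed

lemma mean_sq_upto_linear:
  fixes X :: "real \<Rightarrow> 'w \<Rightarrow> 'b::euclidean_space" and f :: "'b \<Rightarrow> 'c::euclidean_space"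
  assumes f: "bounded_linear f" and J: "jointly_measurable T X"
  shows "mean_sq_upto T (\<lambda>s \<omega>. f (X s \<omega>)) \<le> ennreal ((onorm f)\<^sup>2) * mean_sq_upto T X"
proof -
  note [measurable] = mean_sq_upto_eq(2)[OF J]
  have "mean_sq_upto T (\<lambda>s \<omega>. f (X s \<omega>))
      \<le> (\<integral>\<^sup>+s. ennreal ((onorm f)\<^sup>2) * (mean_sq (X s) * indicator {0..T} s) \<partial>lborel)"
    unfolding mean_sq_upto_eq(1)[OF jointly_measurable_linear[OF f J]]
    using J by (intro nn_integral_mono) (auto simp: indicator_def intro!: mean_sq_linear f
        jointly_measurable_at)
  also have "\<dots> = ennreal ((onorm f)\<^sup>2) * mean_sq_upto T X"
    unfolding J[THEN mean_sq_upto_eq(1)] by (simp add: nn_integral_cmult)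
  finally show ?thesis .
qed

lemma L2_process_linear:
  fixes X :: "real \<Rightarrow> 'w \<Rightarrow> 'b::euclidean_space" and f :: "'b \<Rightarrow> 'c::euclidean_space"
  assumes f: "bounded_linear f" and X: "L2_process M F X"
  shows "L2_process M F (\<lambda>s \<omega>. f (X s \<omega>))"
proof -
  have fm: "f \<in> borel_measurable borel"
    by (intro borel_measurable_continuous_onI linear_continuous_on f)
  have "progressive F (\<lambda>s \<omega>. f (X s \<omega>))"
    unfolding progressive_def
  proof (intro allI impI)
    fix t :: real assume "0 \<le> t"
    then have "(\<lambda>(s, \<omega>). X s \<omega>) \<in> borel_measurable (restrict_space borel {0..t} \<Otimes>\<^sub>M F t)"
      using X unfolding L2_process_def progressive_def by auto
    from measurable_compose[OF this fm]
    show "(\<lambda>(s, \<omega>). f (X s \<omega>)) \<in> borel_measurable (restrict_space borel {0..t} \<Otimes>\<^sub>M F t)"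
      by (simp add: split_beta')
  qed
  moreover have "mean_sq_upto T (\<lambda>s \<omega>. f (X s \<omega>)) < \<infinity>" if "0 \<le> T" for T
  proof -
    have J: "jointly_measurable T X"
      using progressive_jointly_measurable X that unfolding L2_process_def by blast
    have "mean_sq_upto T X < \<infinity>"
      using X that unfolding L2_process_def mean_sq_upto_def by auto
    then have "ennreal ((onorm f)\<^sup>2) * mean_sq_upto T X < \<infinity>"
      by (simp add: ennreal_mult_less_top)
    then show ?thesis using mean_sq_upto_linear[OF f J] by (rule le_less_trans[rotated])
  qed
  ultimately show ?thesis unfolding L2_process_def mean_sq_upto_def by auto
qed

lemma L2_process_jointly_measurable: "L2_process M F X \<Longrightarrow> 0 \<le> T \<Longrightarrow> jointly_measurable T X"
  unfolding L2_process_def using progressive_jointly_measurable by blast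

lemma L2_process_mean_sq_upto: "L2_process M F X \<Longrightarrow> 0 \<le> T \<Longrightarrow> mean_sq_upto T X < \<infinity>"
  unfolding L2_process_def mean_sq_upto_def by auto

lemma L2_process_set_integrable_AE:
  fixes X :: "real \<Rightarrow> 'w \<Rightarrow> 'b::euclidean_space"
  assumes X: "L2_process M F X" and "0 \<le> t"
  shows "AE \<omega> in M. set_integrable lborel {0..t} (\<lambda>s. X s \<omega>)"
proof -
  have J: "jointly_measurable t X" using L2_process_jointly_measurable assms by blast
  have "AE \<omega> in M. (\<integral>\<^sup>+s\<in>{0..t}. ennreal ((norm (X s \<omega>))\<^sup>2) \<partial>lborel) \<noteq> \<infinity>"
    using L2_process_mean_sq_upto[OF assms] mean_sq_upto_eq(3)[OF J]
    unfolding mean_sq_upto_def by (intro nn_integral_noteq_infinite) (auto simp: less_top)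
  then show ?thesis
  proof (rule AE_mp, intro AE_I2 impI)
    fix \<omega> assume \<omega>: "\<omega> \<in> space M" and fin: "(\<integral>\<^sup>+s\<in>{0..t}. ennreal ((norm (X s \<omega>))\<^sup>2) \<partial>lborel) \<noteq> \<infinity>"
    show "set_integrable lborel {0..t} (\<lambda>s. X s \<omega>)"
      unfolding set_integrable_def
      by (rule integrable_if_square_integrable(2)[OF jointly_measurable_section[OF J \<omega>] assms(2) fin])
  qed
qed

lemma time_integral_measurable:
  fixes X :: "real \<Rightarrow> 'w \<Rightarrow> 'b::euclidean_space"
  assumes "jointly_measurable t X"
  shows "(\<lambda>\<omega>. LINT s:{0..t}|lborel. X s \<omega>) \<in> borel_measurable M"
proof -
  have "(\<lambda>p. case (case p of (\<omega>, s) \<Rightarrow> (s, \<omega>)) of (s, \<omega>) \<Rightarrow> indicator {0..t} s *\<^sub>R X s \<omega>) \<in>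
      borel_measurable (M \<Otimes>\<^sub>M lborel)"
    using assms unfolding jointly_measurable_def by measurable
  then have "(\<lambda>(\<omega>, s). indicator {0..t} s *\<^sub>R X s \<omega>) \<in> borel_measurable (M \<Otimes>\<^sub>M lborel)"
    by (simp add: split_beta')
  then show ?thesis
    unfolding set_lebesgue_integral_def by (rule lborel.borel_measurable_lebesgue_integral)
qed

lemma drift_estimate:
  fixes X Y :: "real \<Rightarrow> 'w \<Rightarrow> real^'n"
  assumes X: "L2_process M F X" and Y: "L2_process M F Y" and t: "0 \<le> t"
  shows "mean_sq (\<lambda>\<omega>. (LINT s:{0..t}|lborel. A *v X s \<omega>) - (LINT s:{0..t}|lborel. A *v Y s \<omega>))
    \<le> ennreal (t * (onorm ((*v) A))\<^sup>2) * mean_sq_upto t (\<lambda>s \<omega>. X s \<omega> - Y s \<omega>)"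
proof -
  let ?D = "\<lambda>s \<omega>. X s \<omega> - Y s \<omega>"
  have bl: "bounded_linear ((*v) A)" by (rule matrix_vector_mul_bounded_linear)
  have J: "jointly_measurable t ?D"
    using assms by (intro jointly_measurable_diff L2_process_jointly_measurable)
  have JA: "jointly_measurable t (\<lambda>s \<omega>. A *v ?D s \<omega>)" by (rule jointly_measurable_linear[OF bl J])
  have "mean_sq (\<lambda>\<omega>. (LINT s:{0..t}|lborel. A *v X s \<omega>) - (LINT s:{0..t}|lborel. A *v Y s \<omega>))
     = mean_sq (\<lambda>\<omega>. LINT s:{0..t}|lborel. A *v ?D s \<omega>)"
    by (rule mean_sq_cong_AE)
       (use L2_process_set_integrable_AE[OF L2_process_linear[OF bl X] t]
            L2_process_set_integrable_AE[OF L2_process_linear[OF bl Y] t] in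
         \<open>eventually_elim, simp add: matrix_vector_mult_diff_distrib set_integral_diff\<close>)
  also have "\<dots> \<le> (\<integral>\<^sup>+\<omega>. ennreal t * (\<integral>\<^sup>+s\<in>{0..t}. ennreal ((norm (A *v ?D s \<omega>))\<^sup>2) \<partial>lborel) \<partial>M)"
    unfolding mean_sq_def
    by (intro nn_integral_mono norm_set_integral_power2_le jointly_measurable_section[OF JA] t)
  also have "\<dots> = ennreal t * mean_sq_upto t (\<lambda>s \<omega>. A *v ?D s \<omega>)"
    unfolding mean_sq_upto_def by (intro nn_integral_cmult mean_sq_upto_eq(3) JA)
  also have "\<dots> \<le> ennreal t * (ennreal ((onorm ((*v) A))\<^sup>2) * mean_sq_upto t ?D)"
    by (intro mult_left_mono mean_sq_upto_linear bl J) auto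
  also have "\<dots> = ennreal (t * (onorm ((*v) A))\<^sup>2) * mean_sq_upto t ?D"
    using t by (simp add: ennreal_mult mult.assoc)
  finally show ?thesis .
qed

section \<open>The mean-square distance of two Ito integrals\<close>

lemma step_data_partition:
  assumes "step_data M F T m \<tau> \<xi>" "k < m"
  shows "0 \<le> \<tau> k" "\<tau> k \<le> \<tau> (Suc k)" "\<tau> (Suc k) \<le> T" "L2_at (\<tau> k) (\<xi> k)"
proof -
  have mono: "\<tau> i \<le> \<tau> j" if "i \<le> j" "j \<le> m" for i j
    using that
  proof (induction j)
    case (Suc j)
    then show ?case
      using assms(1) unfolding step_data_def
      by (metis Suc_le_lessD le_SucE order.refl order.strict_implies_order order.trans)
  qed simp
  show "0 \<le> \<tau> k" "\<tau> k \<le> \<tau> (Suc k)" "\<tau> (Suc k) \<le> T" "L2_at (\<tau> k) (\<xi> k)"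
    using mono[of 0 k] mono[of k "Suc k"] mono[of "Suc k" m] assms
    unfolding step_data_def L2_at_def by auto
qed

lemma step_process_jointly_measurable:
  fixes \<xi> :: "nat \<Rightarrow> 'w \<Rightarrow> 'b::euclidean_space"
  assumes "step_data M F T m \<tau> \<xi>"
  shows "jointly_measurable T (step_process m \<tau> \<xi>)"
proof -
  have [measurable]: "\<xi> k \<in> borel_measurable M" if "k < m" for k
    using step_data_partition[OF assms that] measurable_F unfolding L2_at_def by blast
  show ?thesis
    unfolding jointly_measurable_def step_process_def split_beta'
    by (intro borel_measurable_scaleR borel_measurable_sum) measurable
qed

lemma step_integral_measurable:
  fixes \<xi> :: "nat \<Rightarrow> 'w \<Rightarrow> 'b::euclidean_space"
  assumes "step_data M F T m \<tau> \<xi>"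
  shows "step_integral W m \<tau> \<xi> \<in> borel_measurable M"
proof -
  have "(\<lambda>\<omega>. (W (\<tau> (Suc k)) \<omega> - W (\<tau> k) \<omega>) *\<^sub>R \<xi> k \<omega>) \<in> borel_measurable M" if "k < m" for k
    using step_data_partition[OF assms that] measurable_F W_measurable unfolding L2_at_def
    by (intro borel_measurable_scaleR borel_measurable_diff) (auto intro: order_trans)
  then show ?thesis unfolding step_integral_def[abs_def] by (intro borel_measurable_sum) auto
qed

text \<open>The two partitions are combined into one family of intervals, indexed by a sum type, with the
  second integrand negated.\<close>

lemma step_integral_isometry:
  fixes \<xi> \<eta> :: "nat \<Rightarrow> 'w \<Rightarrow> 'b::euclidean_space"
  assumes 1: "step_data M F T m \<tau> \<xi>" and 2: "step_data M F T n \<sigma> \<eta>"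
  shows "mean_sq (\<lambda>\<omega>. step_integral W m \<tau> \<xi> \<omega> - step_integral W n \<sigma> \<eta> \<omega>)
    = mean_sq_upto T (\<lambda>s \<omega>. step_process m \<tau> \<xi> s \<omega> - step_process n \<sigma> \<eta> s \<omega>)"
proof -
  define a where "a = case_sum \<tau> \<sigma>"
  define b where "b = case_sum (\<tau> \<circ> Suc) (\<sigma> \<circ> Suc)"
  define \<zeta> where "\<zeta> = case_sum \<xi> (\<lambda>k \<omega>. - \<eta> k \<omega>)"
  let ?K = "{..<m} <+> {..<n}"
  have integral: "step_integral W m \<tau> \<xi> \<omega> - step_integral W n \<sigma> \<eta> \<omega>
      = (\<Sum>k\<in>?K. (W (b k) \<omega> - W (a k) \<omega>) *\<^sub>R \<zeta> k \<omega>)" for \<omega>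
    unfolding step_integral_def a_def b_def \<zeta>_def sum.Plus[OF finite_lessThan finite_lessThan]
    by (simp only: sum.case comp_def scaleR_minus_right sum_negf diff_conv_add_uminus)
  have process: "step_process m \<tau> \<xi> s \<omega> - step_process n \<sigma> \<eta> s \<omega>
      = (\<Sum>k\<in>?K. indicator {a k..<b k} s *\<^sub>R \<zeta> k \<omega>)" for s \<omega>
    unfolding step_process_def a_def b_def \<zeta>_def sum.Plus[OF finite_lessThan finite_lessThan]
    by (simp only: sum.case comp_def scaleR_minus_right sum_negf diff_conv_add_uminus)
  have pieces: "0 \<le> a k \<and> a k \<le> b k \<and> b k \<le> T \<and> L2_at (a k) (\<zeta> k)" if "k \<in> ?K" for k
    using that step_data_partition[OF 1] step_data_partition[OF 2]
    by (auto simp: a_def b_def \<zeta>_def L2_at_def)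
  show ?thesis
    unfolding mean_sq_def mean_sq_upto_def integral process
    using pieces by (intro increments_isometry) auto
qed

text \<open>Both integrals are limits of step integrals, for which the isometry holds. The constant is \<open>9\<close>
  because the three-term triangle inequality is applied twice.\<close>

lemma ito_integral_distance:
  fixes \<Phi> \<Psi> :: "real \<Rightarrow> 'w \<Rightarrow> 'b::euclidean_space"
  assumes Y: "has_ito_integral M F W \<Phi> T Y" and Z: "has_ito_integral M F W \<Psi> T Z" and T: "0 \<le> T"
  shows "mean_sq (\<lambda>\<omega>. Y \<omega> - Z \<omega>) \<le> 9 * mean_sq_upto T (\<lambda>s \<omega>. \<Phi> s \<omega> - \<Psi> s \<omega>)"
proof -
  obtain m \<tau> \<xi> where 1: "\<And>i. step_data M F T (m i) (\<tau> i) (\<xi> i)"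
    and p1: "(\<lambda>i. mean_sq_upto T (\<lambda>s \<omega>. step_process (m i) (\<tau> i) (\<xi> i) s \<omega> - \<Phi> s \<omega>)) \<longlonglongrightarrow> 0"
    and i1: "(\<lambda>i. mean_sq (\<lambda>\<omega>. step_integral W (m i) (\<tau> i) (\<xi> i) \<omega> - Y \<omega>)) \<longlonglongrightarrow> 0"
    using Y unfolding has_ito_integral_def mean_sq_def mean_sq_upto_def by blast
  obtain n \<sigma> \<eta> where 2: "\<And>i. step_data M F T (n i) (\<sigma> i) (\<eta> i)"
    and p2: "(\<lambda>i. mean_sq_upto T (\<lambda>s \<omega>. step_process (n i) (\<sigma> i) (\<eta> i) s \<omega> - \<Psi> s \<omega>)) \<longlonglongrightarrow> 0"
    and i2: "(\<lambda>i. mean_sq (\<lambda>\<omega>. step_integral W (n i) (\<sigma> i) (\<eta> i) \<omega> - Z \<omega>)) \<longlonglongrightarrow> 0"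
    using Z unfolding has_ito_integral_def mean_sq_def mean_sq_upto_def by blast
  let ?U = "\<lambda>i. step_integral W (m i) (\<tau> i) (\<xi> i)" and ?V = "\<lambda>i. step_integral W (n i) (\<sigma> i) (\<eta> i)"
  let ?u = "\<lambda>i. step_process (m i) (\<tau> i) (\<xi> i)" and ?v = "\<lambda>i. step_process (n i) (\<sigma> i) (\<eta> i)"
  have [measurable]: "Y \<in> borel_measurable M" "Z \<in> borel_measurable M"
    using Y Z unfolding has_ito_integral_def by auto
  have [measurable]: "?U i \<in> borel_measurable M" "?V i \<in> borel_measurable M" for i
    using step_integral_measurable[OF 1] step_integral_measurable[OF 2] by auto
  have J\<Phi>: "jointly_measurable T \<Phi>" "jointly_measurable T \<Psi>"
    using Y Z T L2_process_jointly_measurable unfolding has_ito_integral_def by auto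
  have Ju: "jointly_measurable T (?u i)" "jointly_measurable T (?v i)" for i
    using step_process_jointly_measurable[OF 1] step_process_jointly_measurable[OF 2] by auto
  have sym1: "mean_sq (\<lambda>\<omega>. Y \<omega> - ?U i \<omega>) = mean_sq (\<lambda>\<omega>. ?U i \<omega> - Y \<omega>)" for i
    unfolding mean_sq_def by (simp add: norm_minus_commute)
  have sym2: "mean_sq_upto T (\<lambda>s \<omega>. \<Psi> s \<omega> - ?v i s \<omega>) = mean_sq_upto T (\<lambda>s \<omega>. ?v i s \<omega> - \<Psi> s \<omega>)" for i
    unfolding mean_sq_upto_def by (simp add: norm_minus_commute)
  let ?R = "\<lambda>i. 3 * (mean_sq (\<lambda>\<omega>. ?U i \<omega> - Y \<omega>)
      + 3 * (mean_sq_upto T (\<lambda>s \<omega>. ?u i s \<omega> - \<Phi> s \<omega>) + mean_sq_upto T (\<lambda>s \<omega>. \<Phi> s \<omega> - \<Psi> s \<omega>)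
          + mean_sq_upto T (\<lambda>s \<omega>. ?v i s \<omega> - \<Psi> s \<omega>))
      + mean_sq (\<lambda>\<omega>. ?V i \<omega> - Z \<omega>))"
  have le: "mean_sq (\<lambda>\<omega>. Y \<omega> - Z \<omega>) \<le> ?R i" for i
  proof -
    have "mean_sq (\<lambda>\<omega>. Y \<omega> - Z \<omega>)
       = mean_sq (\<lambda>\<omega>. (Y \<omega> - ?U i \<omega>) + (?U i \<omega> - ?V i \<omega>) + (?V i \<omega> - Z \<omega>))" by simp
    also have "\<dots> \<le> 3 * (mean_sq (\<lambda>\<omega>. Y \<omega> - ?U i \<omega>) + mean_sq (\<lambda>\<omega>. ?U i \<omega> - ?V i \<omega>)
        + mean_sq (\<lambda>\<omega>. ?V i \<omega> - Z \<omega>))"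
      by (intro mean_sq_add3) measurable
    also have "mean_sq (\<lambda>\<omega>. ?U i \<omega> - ?V i \<omega>) = mean_sq_upto T (\<lambda>s \<omega>. ?u i s \<omega> - ?v i s \<omega>)"
      by (rule step_integral_isometry[OF 1 2])
    also have "\<dots> = mean_sq_upto T (\<lambda>s \<omega>. (?u i s \<omega> - \<Phi> s \<omega>) + (\<Phi> s \<omega> - \<Psi> s \<omega>) + (\<Psi> s \<omega> - ?v i s \<omega>))"
      by simp
    also have "\<dots> \<le> 3 * (mean_sq_upto T (\<lambda>s \<omega>. ?u i s \<omega> - \<Phi> s \<omega>) + mean_sq_upto T (\<lambda>s \<omega>. \<Phi> s \<omega> - \<Psi> s \<omega>)
          + mean_sq_upto T (\<lambda>s \<omega>. \<Psi> s \<omega> - ?v i s \<omega>))"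
      by (intro mean_sq_upto_add3 jointly_measurable_diff J\<Phi> Ju)
    finally show ?thesis
      by (simp add: sym1 sym2 add_mono mult_left_mono)
  qed
  have "?R \<longlonglongrightarrow> 3 * (0 + 3 * (0 + mean_sq_upto T (\<lambda>s \<omega>. \<Phi> s \<omega> - \<Psi> s \<omega>) + 0) + 0)"
    by (intro tendsto_add ennreal_tendsto_cmult tendsto_const p1 p2 i1 i2) auto
  then have "mean_sq (\<lambda>\<omega>. Y \<omega> - Z \<omega>) \<le> 3 * (0 + 3 * (0 + mean_sq_upto T (\<lambda>s \<omega>. \<Phi> s \<omega> - \<Psi> s \<omega>) + 0) + 0)"
    by (rule LIMSEQ_le_const) (use le in blast)
  then show ?thesis by (simp add: mult.assoc[symmetric])
qed

end

section \<open>Approximate solutions of a linear equation\<close>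

text \<open>For \<open>m\<close> the supremum of \<open>e t * exp (- 2 b t)\<close>, the integral inequality gives \<open>m \<le> a + m / 2\<close>;
  since \<open>m\<close> is finite, \<open>m \<le> 2 a\<close>.\<close>

lemma gronwall_nn_integral:
  fixes e :: "real \<Rightarrow> ennreal" and a b T :: real
  assumes b: "0 < b" and a: "0 \<le> a" and T: "0 \<le> T"
    and m: "(\<lambda>s. e s * indicator {0..T} s) \<in> borel_measurable lborel"
    and fin: "(\<integral>\<^sup>+s\<in>{0..T}. e s \<partial>lborel) < \<infinity>"
    and le: "\<And>t. t \<in> {0..T} \<Longrightarrow> e t \<le> ennreal a + ennreal b * (\<integral>\<^sup>+s\<in>{0..t}. e s \<partial>lborel)"
    and t: "t \<in> {0..T}"
  shows "e t \<le> ennreal (2 * a * exp (2 * b * T))"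
proof -
  define m where "m = (SUP t\<in>{0..T}. e t * ennreal (exp (- 2 * b * t)))"
  let ?I = "\<integral>\<^sup>+s\<in>{0..T}. e s \<partial>lborel"
  have sub: "(\<integral>\<^sup>+s\<in>{0..t}. e s \<partial>lborel) \<le> ?I" if "t \<in> {0..T}" for t
    using that by (intro nn_integral_mono) (auto simp: indicator_def)
  have "m \<le> ennreal a + ennreal b * ?I"
    unfolding m_def
  proof (rule SUP_least)
    fix t assume t: "t \<in> {0..T}"
    have "e t * ennreal (exp (- 2 * b * t)) \<le> e t * 1"
      using b t by (intro mult_left_mono) auto
    also have "\<dots> \<le> ennreal a + ennreal b * ?I"
      using order_trans[OF le[OF t] add_left_mono[OF mult_left_mono[OF sub[OF t]]]] by simp
    finally show "e t * ennreal (exp (- 2 * b * t)) \<le> ennreal a + ennreal b * ?I" .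
  qed
  also have "\<dots> < \<infinity>" using fin by (simp add: ennreal_mult_less_top)
  finally obtain r where r: "m = ennreal r" "0 \<le> r" by (cases m) auto
  have em: "e t \<le> ennreal (r * exp (2 * b * t))" if t: "t \<in> {0..T}" for t
  proof -
    have "e t = e t * ennreal (exp (- 2 * b * t)) * ennreal (exp (2 * b * t))"
      by (simp add: mult.assoc ennreal_mult[symmetric] exp_minus_inverse[symmetric] exp_add[symmetric])
    also have "\<dots> \<le> ennreal r * ennreal (exp (2 * b * t))"
      unfolding r(1)[symmetric] m_def using t by (intro mult_right_mono SUP_upper) auto
    finally show ?thesis using r by (simp add: ennreal_mult)
  qed
  have int: "ennreal b * (\<integral>\<^sup>+s\<in>{0..t}. e s \<partial>lborel) \<le> ennreal (r / 2 * exp (2 * b * t))" if t: "t \<in>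
      {0..T}" for t
  proof -
    have "(\<integral>\<^sup>+s\<in>{0..t}. e s \<partial>lborel) \<le> (\<integral>\<^sup>+s. ennreal (r * exp (2 * b * s)) * indicator {0..t} s
        \<partial>lborel)"
      using em t by (intro nn_integral_mono) (auto simp: indicator_def)
    also have "\<dots> = ennreal (r / (2 * b) * exp (2 * b * t) - r / (2 * b) * exp (2 * b * 0))"
      using t b r by (intro nn_integral_FTC_Icc)
        (auto intro!: derivative_eq_intros simp: field_simps)
    also have "\<dots> \<le> ennreal (r / (2 * b) * exp (2 * b * t))"
      using r b by (intro ennreal_leI) auto
    finally have "ennreal b * (\<integral>\<^sup>+s\<in>{0..t}. e s \<partial>lborel)
        \<le> ennreal b * ennreal (r / (2 * b) * exp (2 * b * t))"
      by (intro mult_left_mono) auto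
    also have "\<dots> = ennreal (r / 2 * exp (2 * b * t))"
      using b r by (subst ennreal_mult[symmetric]) auto
    finally show ?thesis .
  qed
  have "m \<le> ennreal (a + r / 2)"
    unfolding m_def
  proof (rule SUP_least)
    fix t assume t: "t \<in> {0..T}"
    have "e t \<le> ennreal (a + r / 2 * exp (2 * b * t))"
      using order_trans[OF le[OF t] add_left_mono[OF int[OF t]]] a r by simp
    then have "e t * ennreal (exp (- 2 * b * t)) \<le> ennreal (a
        + r / 2 * exp (2 * b * t)) * ennreal (exp (- 2 * b * t))"
      by (intro mult_right_mono) auto
    also have "\<dots> = ennreal (a * exp (- 2 * b * t) + r / 2)"
      using a r by (subst ennreal_mult[symmetric]) (auto simp: algebra_simps exp_add[symmetric])
    also have "\<dots> \<le> ennreal (a + r / 2)"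
      using a b t by (intro ennreal_leI) (auto simp: mult_left_le)
    finally show "e t * ennreal (exp (- 2 * b * t)) \<le> ennreal (a + r / 2)" .
  qed
  then have "r \<le> a + r / 2" using r a by (simp add: ennreal_le_iff del: ennreal_plus)
  then have "r \<le> 2 * a" by simp
  have "e t \<le> ennreal (r * exp (2 * b * t))" using em t by simp
  also have "\<dots> \<le> ennreal (2 * a * exp (2 * b * T))"
    using \<open>r \<le> 2 * a\<close> t a b r by (intro ennreal_leI mult_mono) auto
  finally show ?thesis .
qed

locale linear_sde = brownian_setting M F W
  for M :: "'w measure" and F :: "real \<Rightarrow> 'w measure" and W :: "real \<Rightarrow> 'w \<Rightarrow> real" +
  fixes A C :: "real^'n^'n" and x0 :: "real^'n"
begin

text \<open>The integrals are taken along \<open>Zs\<close>, and \<open>Z\<close> is their sum. An exact solution is the case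
  \<open>Z = Zs\<close>; for the Euler scheme, \<open>Zs\<close> is the step process and \<open>Z\<close> its interpolation. Thus one
  comparison lemma serves both for the convergence of the scheme and for its distance from a given
  solution.\<close>

definition approximate_solution ::
  "real \<Rightarrow> (real \<Rightarrow> 'w \<Rightarrow> real^'n) \<Rightarrow> (real \<Rightarrow> 'w \<Rightarrow> real^'n) \<Rightarrow> bool" where
  "approximate_solution T Zs Z \<longleftrightarrow> L2_process M F Zs \<and>
     (\<forall>t\<in>{0..T}. Z t \<in> borel_measurable M \<and>
        (\<exists>Y. has_ito_integral M F W (\<lambda>s \<omega>. C *v Zs s \<omega>) t Y \<and>
           (AE \<omega> in M. Z t \<omega> = x0 + (LINT s:{0..t}|lborel. A *v Zs s \<omega>) + Y \<omega>)))"

definition step_const :: "real \<Rightarrow> real" where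
  "step_const T = 2 * T * (onorm ((*v) A))\<^sup>2 + 18 * (onorm ((*v) C))\<^sup>2"

definition gronwall_const :: "real \<Rightarrow> real" where
  "gronwall_const T = 6 * exp (2 * (3 * step_const T + 1) * T)"

lemma approximate_solutions_distance:
  assumes Z: "approximate_solution T Zs Z" and Z': "approximate_solution T Zs' Z'"
    and t: "t \<in> {0..T}"
  shows "mean_sq (\<lambda>\<omega>. Z t \<omega> - Z' t \<omega>)
    \<le> ennreal (step_const T) * mean_sq_upto t (\<lambda>s \<omega>. Zs s \<omega> - Zs' s \<omega>)"
proof -
  let ?D = "mean_sq_upto t (\<lambda>s \<omega>. Zs s \<omega> - Zs' s \<omega>)"
  have t0: "0 \<le> t" using t by simp
  have L: "L2_process M F Zs" "L2_process M F Zs'"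
    using Z Z' unfolding approximate_solution_def by auto
  obtain Y where Y: "has_ito_integral M F W (\<lambda>s \<omega>. C *v Zs s \<omega>) t Y"
    "AE \<omega> in M. Z t \<omega> = x0 + (LINT s:{0..t}|lborel. A *v Zs s \<omega>) + Y \<omega>"
    using Z t unfolding approximate_solution_def by blast
  obtain Y' where Y': "has_ito_integral M F W (\<lambda>s \<omega>. C *v Zs' s \<omega>) t Y'"
    "AE \<omega> in M. Z' t \<omega> = x0 + (LINT s:{0..t}|lborel. A *v Zs' s \<omega>) + Y' \<omega>"
    using Z' t unfolding approximate_solution_def by blast
  have bl: "bounded_linear ((*v) A)" "bounded_linear ((*v) C)"
    by (rule matrix_vector_mul_bounded_linear)+
  have J: "jointly_measurable t (\<lambda>s \<omega>. Zs s \<omega> - Zs' s \<omega>)"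
    using L t0 by (intro jointly_measurable_diff L2_process_jointly_measurable)
  let ?I = "\<lambda>\<omega>. (LINT s:{0..t}|lborel. A *v Zs s \<omega>) - (LINT s:{0..t}|lborel. A *v Zs' s \<omega>)"
  have meas: "?I \<in> borel_measurable M" "(\<lambda>\<omega>. Y \<omega> - Y' \<omega>) \<in> borel_measurable M"
    using Y(1) Y'(1) unfolding has_ito_integral_def
    by (intro borel_measurable_diff time_integral_measurable jointly_measurable_linear[OF bl(1)]
          L2_process_jointly_measurable[OF L(1) t0] L2_process_jointly_measurable[OF L(2) t0]; simp)+
  have "mean_sq (\<lambda>\<omega>. Z t \<omega> - Z' t \<omega>) = mean_sq (\<lambda>\<omega>. ?I \<omega> + (Y \<omega> - Y' \<omega>))"
    by (rule mean_sq_cong_AE) (use Y(2) Y'(2) in \<open>eventually_elim, simp add: algebra_simps\<close>)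
  also have "\<dots> \<le> 2 * mean_sq ?I + 2 * mean_sq (\<lambda>\<omega>. Y \<omega> - Y' \<omega>)"
    by (rule mean_sq_add[OF meas])
  also have "\<dots> \<le> 2 * (ennreal (t * (onorm ((*v) A))\<^sup>2) * ?D)
      + 2 * (9 * (ennreal ((onorm ((*v) C))\<^sup>2) * ?D))"
  proof (intro add_mono mult_left_mono)
    show "mean_sq ?I \<le> ennreal (t * (onorm ((*v) A))\<^sup>2) * ?D"
      by (rule drift_estimate[OF L t0])
    have "mean_sq (\<lambda>\<omega>. Y \<omega> - Y' \<omega>) \<le> 9 * mean_sq_upto t (\<lambda>s \<omega>. C *v Zs s \<omega> - C *v Zs' s \<omega>)"
      by (rule ito_integral_distance[OF Y(1) Y'(1) t0])
    also have "\<dots> \<le> 9 * (ennreal ((onorm ((*v) C))\<^sup>2) * ?D)"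
      using mean_sq_upto_linear[OF bl(2) J]
      by (intro mult_left_mono) (simp_all add: matrix_vector_mult_diff_distrib)
    finally show "mean_sq (\<lambda>\<omega>. Y \<omega> - Y' \<omega>) \<le> 9 * (ennreal ((onorm ((*v) C))\<^sup>2) * ?D)" .
  qed auto
  also have "\<dots> = ennreal (2 * t * (onorm ((*v) A))\<^sup>2 + 18 * (onorm ((*v) C))\<^sup>2) * ?D"
    using t0 by (simp add: ennreal_mult ennreal_plus distrib_right mult.assoc[symmetric])
  also have "\<dots> \<le> ennreal (step_const T) * ?D"
    unfolding step_const_def using t by (intro mult_right_mono ennreal_leI add_mono) auto
  finally show ?thesis .
qed

text \<open>The distance of \<open>Zs\<close> and \<open>Zs'\<close> at time \<open>t\<close> is at most that of \<open>Z\<close> and \<open>Z'\<close> plus the two defects,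
  and the distance of \<open>Z\<close> and \<open>Z'\<close> is bounded by the integral of the distance of \<open>Zs\<close> and \<open>Zs'\<close>;
  Gronwall's inequality closes the loop.\<close>

lemma approximate_solutions_close:
  assumes Z: "approximate_solution T Zs Z" and Z': "approximate_solution T Zs' Z'"
    and \<delta>: "\<And>t. t \<in> {0..T} \<Longrightarrow> mean_sq (\<lambda>\<omega>. Z t \<omega> - Zs t \<omega>) \<le> ennreal \<delta>" "0 \<le> \<delta>"
    and \<delta>': "\<And>t. t \<in> {0..T} \<Longrightarrow> mean_sq (\<lambda>\<omega>. Z' t \<omega> - Zs' t \<omega>) \<le> ennreal \<delta>'" "0 \<le> \<delta>'"
    and t: "t \<in> {0..T}"
  shows "mean_sq (\<lambda>\<omega>. Zs t \<omega> - Zs' t \<omega>) \<le> ennreal (gronwall_const T * (\<delta> + \<delta>'))"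
proof -
  have T: "0 \<le> T" using t by simp
  let ?e = "\<lambda>s. mean_sq (\<lambda>\<omega>. Zs s \<omega> - Zs' s \<omega>)"
  have L: "L2_process M F Zs" "L2_process M F Zs'"
    using Z Z' unfolding approximate_solution_def by auto
  have J: "jointly_measurable t (\<lambda>s \<omega>. Zs s \<omega> - Zs' s \<omega>)" if "t \<in> {0..T}" for t
    using L that by (intro jointly_measurable_diff L2_process_jointly_measurable) auto
  note JT = J[of T]
  have K0: "0 \<le> step_const T" unfolding step_const_def using T by simp
  have "?e t \<le> ennreal (2 * (3 * (\<delta> + \<delta>')) * exp (2 * (3 * step_const T + 1) * T))"
  proof (rule gronwall_nn_integral[OF _ _ T _ _ _ t])
    show "(\<lambda>s. ?e s * indicator {0..T} s) \<in> borel_measurable lborel"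
      using mean_sq_upto_eq(2)[OF JT] T by simp
    have "mean_sq_upto T (\<lambda>s \<omega>. Zs s \<omega> - Zs' s \<omega>) = mean_sq_upto T (\<lambda>s \<omega>. Zs s \<omega> + (- Zs' s \<omega>) + 0)"
      by simp
    also have "\<dots> \<le> 3 * (mean_sq_upto T Zs + mean_sq_upto T (\<lambda>s \<omega>. - Zs' s \<omega>)
        + mean_sq_upto T (\<lambda>_ _. 0::real^'n))"
      by (intro mean_sq_upto_add3 L2_process_jointly_measurable[OF L(1) T]
          jointly_measurable_linear[OF bounded_linear_minus[OF bounded_linear_ident]]
          L2_process_jointly_measurable[OF L(2) T]) (simp add: jointly_measurable_def)
    also have "\<dots> < \<infinity>"
      using L2_process_mean_sq_upto[OF L(1) T] L2_process_mean_sq_upto[OF L(2) T]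
      by (simp add: mean_sq_upto_def ennreal_mult_less_top)
    finally show "(\<integral>\<^sup>+s\<in>{0..T}. ?e s \<partial>lborel) < \<infinity>"
      using mean_sq_upto_eq(1)[OF JT] T by simp
  next
    fix u assume u: "u \<in> {0..T}"
    have meas: "Z u \<in> borel_measurable M" "Z' u \<in> borel_measurable M"
      "Zs u \<in> borel_measurable M" "Zs' u \<in> borel_measurable M"
      using Z Z' u jointly_measurable_at[OF L2_process_jointly_measurable[OF L(1) T] u]
        jointly_measurable_at[OF L2_process_jointly_measurable[OF L(2) T] u]
      unfolding approximate_solution_def by auto
    have sym: "mean_sq (\<lambda>\<omega>. Zs u \<omega> - Z u \<omega>) = mean_sq (\<lambda>\<omega>. Z u \<omega> - Zs u \<omega>)"
      unfolding mean_sq_def by (simp add: norm_minus_commute)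
    have "?e u = mean_sq (\<lambda>\<omega>. (Zs u \<omega> - Z u \<omega>) + (Z u \<omega> - Z' u \<omega>) + (Z' u \<omega> - Zs' u \<omega>))" by simp
    also have "\<dots> \<le> 3 * (mean_sq (\<lambda>\<omega>. Zs u \<omega> - Z u \<omega>) + mean_sq (\<lambda>\<omega>. Z u \<omega> - Z' u \<omega>)
        + mean_sq (\<lambda>\<omega>. Z' u \<omega> - Zs' u \<omega>))"
      by (intro mean_sq_add3 borel_measurable_diff meas)
    also have "\<dots> \<le> 3 * (ennreal \<delta> + ennreal (step_const T) * (\<integral>\<^sup>+s\<in>{0..u}. ?e s \<partial>lborel) + ennreal \<delta>')"
      using approximate_solutions_distance[OF Z Z' u] \<delta>(1)[OF u] \<delta>'(1)[OF u]
      by (intro mult_left_mono add_mono) (auto simp: sym mean_sq_upto_eq(1)[OF J[OF u]])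
    also have "\<dots> = ennreal (3 * (\<delta> + \<delta>')) + ennreal (3 * step_const T) * (\<integral>\<^sup>+s\<in>{0..u}. ?e s \<partial>lborel)"
      using \<delta> \<delta>' K0 by (simp add: ennreal_mult ennreal_plus distrib_left mult.assoc ac_simps)
    also have "\<dots> \<le> ennreal (3 * (\<delta> + \<delta>')) + ennreal (3 * step_const T
        + 1) * (\<integral>\<^sup>+s\<in>{0..u}. ?e s \<partial>lborel)"
      by (intro add_left_mono mult_right_mono ennreal_leI) auto
    finally show "?e u \<le> ennreal (3 * (\<delta> + \<delta>')) + ennreal (3 * step_const T
        + 1) * (\<integral>\<^sup>+s\<in>{0..u}. ?e s \<partial>lborel)" .
  qed (use K0 \<delta> \<delta>' in auto)
  also have "2 * (3 * (\<delta> + \<delta>')) * exp (2 * (3 * step_const T + 1) * T) = gronwall_const T * (\<delta> + \<delta>')"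
    by (simp add: gronwall_const_def algebra_simps)
  finally show ?thesis .
qed

end

section \<open>The Euler scheme\<close>

context brownian_setting
begin

lemma L2_at_mean_sq:
  "L2_at a \<xi> \<Longrightarrow> mean_sq \<xi> = ennreal (sq_mean \<xi>)"
  unfolding L2_at_def mean_sq_def by (intro nn_integral_eq_integral) auto

lemma L2_at_const: "0 \<le> a \<Longrightarrow> L2_at a (\<lambda>_. c)"
  unfolding L2_at_def by simp

lemma L2_at_add:
  assumes "0 \<le> a" "L2_at a \<xi>" "L2_at a \<eta>"
  shows "L2_at a (\<lambda>\<omega>. \<xi> \<omega> + \<eta> \<omega>)"
proof -
  have m: "(\<lambda>\<omega>. \<xi> \<omega> + \<eta> \<omega>) \<in> borel_measurable (F a)"
    using assms unfolding L2_at_def by auto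
  have "integrable M (\<lambda>\<omega>. (norm (\<xi> \<omega> + \<eta> \<omega>))\<^sup>2)"
  proof (rule Bochner_Integration.integrable_bound)
    show "integrable M (\<lambda>\<omega>. 2 * (norm (\<xi> \<omega>))\<^sup>2 + 2 * (norm (\<eta> \<omega>))\<^sup>2)"
      using assms unfolding L2_at_def by auto
    show "(\<lambda>\<omega>. (norm (\<xi> \<omega> + \<eta> \<omega>))\<^sup>2) \<in> borel_measurable M"
      using measurable_F[OF assms(1) m] by simp
  qed (use norm_add_power2_le in \<open>auto intro!: AE_I2\<close>)
  then show ?thesis using m unfolding L2_at_def by simp
qed

lemma L2_at_linear:
  fixes f :: "'b::euclidean_space \<Rightarrow> 'c::euclidean_space"
  assumes "0 \<le> a" "L2_at a \<xi>" "bounded_linear f"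
  shows "L2_at a (\<lambda>\<omega>. f (\<xi> \<omega>))"
proof -
  have "f \<in> borel_measurable borel"
    by (intro borel_measurable_continuous_onI linear_continuous_on assms)
  then have m: "(\<lambda>\<omega>. f (\<xi> \<omega>)) \<in> borel_measurable (F a)"
    using assms(2) unfolding L2_at_def by (auto intro: measurable_compose)
  have "integrable M (\<lambda>\<omega>. (norm (f (\<xi> \<omega>)))\<^sup>2)"
  proof (rule Bochner_Integration.integrable_bound)
    show "integrable M (\<lambda>\<omega>. (onorm f)\<^sup>2 * (norm (\<xi> \<omega>))\<^sup>2)"
      using assms unfolding L2_at_def by auto
    show "(\<lambda>\<omega>. (norm (f (\<xi> \<omega>)))\<^sup>2) \<in> borel_measurable M"
      using measurable_F[OF assms(1) m] by simp
    have "(norm (f x))\<^sup>2 \<le> (onorm f)\<^sup>2 * (norm x)\<^sup>2" for x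
      unfolding power_mult_distrib[symmetric] by (intro power_mono onorm assms) auto
    then show "AE \<omega> in M. norm ((norm (f (\<xi> \<omega>)))\<^sup>2) \<le> norm ((onorm f)\<^sup>2 * (norm (\<xi> \<omega>))\<^sup>2)"
      by (auto intro!: AE_I2)
  qed
  then show ?thesis using m unfolding L2_at_def by simp
qed

lemma L2_at_matrix: "0 \<le> a \<Longrightarrow> L2_at a \<xi> \<Longrightarrow> L2_at a (\<lambda>\<omega>. (A::real^'n^'m) *v \<xi> \<omega>)"
  by (rule L2_at_linear) (auto intro: matrix_vector_mul_bounded_linear)

lemma L2_at_scaleR: "0 \<le> a \<Longrightarrow> L2_at a \<xi> \<Longrightarrow> L2_at a (\<lambda>\<omega>. c *\<^sub>R \<xi> \<omega>)"
  by (rule L2_at_linear) (auto intro: bounded_linear_scaleR_right)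

end

context linear_sde
begin

primrec euler :: "real \<Rightarrow> nat \<Rightarrow> 'w \<Rightarrow> real^'n" where
  "euler h 0 \<omega> = x0"
| "euler h (Suc k) \<omega> = euler h k \<omega> + h *\<^sub>R (A *v euler h k \<omega>)
     + (W (real (Suc k) * h) \<omega> - W (real k * h) \<omega>) *\<^sub>R (C *v euler h k \<omega>)"

lemma euler_L2_at:
  assumes h: "0 \<le> h"
  shows "L2_at (real k * h) (euler h k)"
proof (induction k)
  case 0
  then show ?case using L2_at_const[of 0 x0] by (simp add: euler.simps(1)[abs_def])
next
  case (Suc k)
  have 0: "0 \<le> real k * h" "real k * h \<le> real (Suc k) * h" "0 \<le> real (Suc k) * h"
    using h by (auto intro: mult_right_mono)
  have "L2_at (real k * h) (\<lambda>\<omega>. euler h k \<omega> + h *\<^sub>R (A *v euler h k \<omega>))"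
    using 0 Suc by (intro L2_at_add L2_at_scaleR L2_at_matrix)
  then have "L2_at (real (Suc k) * h) (\<lambda>\<omega>. euler h k \<omega> + h *\<^sub>R (A *v euler h k \<omega>))"
    using L2_at_mono 0 by blast
  moreover have "L2_at (real (Suc k) * h)
     (\<lambda>\<omega>. (W (real (Suc k) * h) \<omega> - W (real k * h) \<omega>) *\<^sub>R (C *v euler h k \<omega>))"
    using 0 Suc by (intro L2_at_increment_scaleR L2_at_matrix)
  ultimately show ?case
    using L2_at_add[OF 0(3)] by (simp add: euler.simps(2)[abs_def])
qed

lemma euler_integrable_inner:
  assumes "0 \<le> h"
  shows "integrable M (\<lambda>\<omega>. ((G::real^'n^'m) *v euler h k \<omega>) \<bullet> (H *v euler h k \<omega>))"
  using assms by (intro L2_at_inner(2)[of "real k * h"] L2_at_matrix euler_L2_at) auto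

text \<open>A discrete Ito formula: given the past, the new increment has mean \<open>0\<close> and variance \<open>h\<close>.\<close>

lemma euler_quadratic_recursion:
  fixes P :: "real^'n^'n"
  assumes h: "0 \<le> h"
  shows "quad_mean P (euler h (Suc k))
    = quad_mean P (euler h k)
      + h * quad_mean (lyap A C P) (euler h k)
      + h\<^sup>2 * expectation (\<lambda>\<omega>. (A *v euler h k \<omega>) \<bullet> (P *v (A *v euler h k \<omega>)))"
proof -
  let ?z = "euler h k"
  define u where "u \<omega> = ?z \<omega> + h *\<^sub>R (A *v ?z \<omega>)" for \<omega>
  define v where "v \<omega> = C *v ?z \<omega>" for \<omega>
  define w where "w \<omega> = W (real (Suc k) * h) \<omega> - W (real k * h) \<omega>" for \<omega>
  have 0: "0 \<le> real k * h" "real k * h \<le> real (Suc k) * h"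
    using h by (auto intro: mult_right_mono)
  have u: "L2_at (real k * h) u" and v: "L2_at (real k * h) v"
    unfolding u_def v_def using 0 h by (auto intro!: L2_at_add L2_at_scaleR L2_at_matrix euler_L2_at)
  note Pu = L2_at_matrix[OF 0(1) u, of P] and Pv = L2_at_matrix[OF 0(1) v, of P]
  note uPv = L2_at_inner[OF 0(1) u Pv] and vPu = L2_at_inner[OF 0(1) v Pu]
    and vPv = L2_at_inner[OF 0(1) v Pv] and uPu = L2_at_inner[OF 0(1) u Pu]
  have "has_bochner_integral M (\<lambda>\<omega>. u \<omega> \<bullet> (P *v u \<omega>)
       + (u \<omega> \<bullet> (P *v v \<omega>) * w \<omega> + v \<omega> \<bullet> (P *v u \<omega>) * w \<omega> + v \<omega> \<bullet> (P *v v \<omega>) * (w \<omega>)\<^sup>2))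
     (quad_mean P u
       + (0 + 0 + (real (Suc k) * h - real k * h) * quad_mean P v))"
    unfolding w_def
    by (intro has_bochner_integral_add mult_increment 0 uPv vPu vPv has_bochner_integral_integrable uPu)
  moreover have "euler h (Suc k) \<omega> \<bullet> (P *v euler h (Suc k) \<omega>) = u \<omega> \<bullet> (P *v u \<omega>)
       + (u \<omega> \<bullet> (P *v v \<omega>) * w \<omega> + v \<omega> \<bullet> (P *v u \<omega>) * w \<omega> + v \<omega> \<bullet> (P *v v \<omega>) * (w \<omega>)\<^sup>2)" for \<omega>
  proof -
    have "euler h (Suc k) \<omega> = u \<omega> + w \<omega> *\<^sub>R v \<omega>" by (simp add: u_def v_def w_def)
    then show ?thesis
      by (simp add: matrix_vector_right_distrib inner_add_left inner_add_right
          matrix_vector_mult_scaleR power2_eq_square algebra_simps)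
  qed
  ultimately have 1: "quad_mean P (euler h (Suc k))
     = quad_mean P u + h * quad_mean P v"
    by (simp add: has_bochner_integral_iff algebra_simps)
  have uu: "u \<omega> \<bullet> (P *v u \<omega>) = ?z \<omega> \<bullet> (P *v ?z \<omega>)
      + h * ((A *v ?z \<omega>) \<bullet> (P *v ?z \<omega>) + ?z \<omega> \<bullet> ((P ** A) *v ?z \<omega>))
      + h\<^sup>2 * ((A *v ?z \<omega>) \<bullet> ((P ** A) *v ?z \<omega>))" for \<omega>
    by (simp add: u_def matrix_vector_right_distrib inner_add_left inner_add_right
        matrix_vector_mult_scaleR power2_eq_square algebra_simps matrix_vector_mul_assoc)
  note I = euler_integrable_inner[OF h, where k=k]
  have i1: "integrable M (\<lambda>\<omega>. ?z \<omega> \<bullet> (P *v ?z \<omega>))" "integrable M (\<lambda>\<omega>. ?z \<omega> \<bullet> ((P ** A) *v ?z \<omega>))"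
    using I[of "mat 1" P] I[of "mat 1" "P ** A"] by simp_all
  have 2: "quad_mean P u = quad_mean P ?z
     + h * (expectation (\<lambda>\<omega>. (A *v ?z \<omega>) \<bullet> (P *v ?z \<omega>)) + quad_mean (P ** A) ?z)
     + h\<^sup>2 * expectation (\<lambda>\<omega>. (A *v ?z \<omega>) \<bullet> ((P ** A) *v ?z \<omega>))"
    unfolding uu by (simp add: I i1)
  have 3: "quad_mean (lyap A C P) ?z
     = expectation (\<lambda>\<omega>. (A *v ?z \<omega>) \<bullet> (P *v ?z \<omega>)) + quad_mean (P ** A) ?z
       + quad_mean P v"
    unfolding lyap_quadratic v_def matrix_vector_mul_assoc by (simp add: I i1)
  show ?thesis
    unfolding 1 2 3 by (simp add: matrix_vector_mul_assoc algebra_simps)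
qed

text \<open>A bound for the rate at which the second moment of the Euler scheme grows when the step is at
  most \<open>1\<close>.\<close>

definition growth :: real where
  "growth = 2 * onorm ((*v) A) + (onorm ((*v) C))\<^sup>2 + (onorm ((*v) A))\<^sup>2"

lemma growth_nonneg: "0 \<le> growth"
  unfolding growth_def by (simp add: onorm_pos_le matrix_vector_mul_bounded_linear)

text \<open>The quadratic recursion for the identity matrix, with the \<open>h\<^sup>2\<close> term absorbed into the rate by
  \<open>h \<le> 1\<close>.\<close>

lemma euler_second_moment:
  assumes h: "0 \<le> h" "h \<le> 1"
  shows "sq_mean (euler h k) \<le> exp (growth * (real k * h)) * (norm x0)\<^sup>2"
proof (induction k)
  case 0
  then show ?case by (simp add: prob_space)
next
  case (Suc k)
  let ?a = "onorm ((*v) A)" and ?c = "onorm ((*v) C)" and ?z = "euler h k"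
  let ?m = "sq_mean ?z"
  have na: "norm (A *v x) \<le> ?a * norm x" "norm (C *v x) \<le> ?c * norm x" for x
    by (rule onorm, rule matrix_vector_mul_bounded_linear)+
  have i: "integrable M (\<lambda>\<omega>. (norm (?z \<omega>))\<^sup>2)"
    using euler_L2_at[OF h(1)] unfolding L2_at_def by blast
  have q1: "x \<bullet> (lyap A C (mat 1) *v x) \<le> (2 * ?a + ?c\<^sup>2) * (norm x)\<^sup>2" for x
  proof -
    have "(A *v x) \<bullet> x \<le> norm (A *v x) * norm x" by (rule norm_cauchy_schwarz)
    also have "\<dots> \<le> ?a * norm x * norm x" by (intro mult_right_mono na) auto
    finally have "(A *v x) \<bullet> x \<le> ?a * (norm x)\<^sup>2" by (simp add: power2_eq_square)
    moreover have "(C *v x) \<bullet> (C *v x) \<le> (?c * norm x)\<^sup>2"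
      unfolding power2_norm_eq_inner[symmetric] by (intro power_mono na) auto
    ultimately show ?thesis
      by (simp add: lyap_quadratic inner_commute algebra_simps power_mult_distrib)
  qed
  have q2: "(A *v x) \<bullet> (A *v x) \<le> ?a\<^sup>2 * (norm x)\<^sup>2" for x
    unfolding power2_norm_eq_inner[symmetric] power_mult_distrib[symmetric]
      by (intro power_mono na) auto
  have I: "integrable M (\<lambda>\<omega>. ?z \<omega> \<bullet> (lyap A C (mat 1) *v ?z \<omega>))"
     "integrable M (\<lambda>\<omega>. (A *v ?z \<omega>) \<bullet> (A *v ?z \<omega>))"
    using euler_integrable_inner[OF h(1), of "mat 1" k] euler_integrable_inner[OF h(1), of A k A]
      by simp_all
  have "quad_mean (lyap A C (mat 1)) ?z \<le> expectation (\<lambda>\<omega>. (2 * ?a + ?c\<^sup>2) * (norm (?z \<omega>))\<^sup>2)"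
    by (intro integral_mono I integrable_mult_right i q1)
  then have e1: "quad_mean (lyap A C (mat 1)) ?z \<le> (2 * ?a + ?c\<^sup>2) * ?m" by simp
  have "expectation (\<lambda>\<omega>. (A *v ?z \<omega>) \<bullet> (A *v ?z \<omega>)) \<le> expectation (\<lambda>\<omega>. ?a\<^sup>2 * (norm (?z \<omega>))\<^sup>2)"
    by (intro integral_mono I integrable_mult_right i q2)
  then have e2: "expectation (\<lambda>\<omega>. (A *v ?z \<omega>) \<bullet> (A *v ?z \<omega>)) \<le> ?a\<^sup>2 * ?m" by simp
  have m0: "0 \<le> ?m" by simp
  have "sq_mean (euler h (Suc k))
     = ?m + h * quad_mean (lyap A C (mat 1)) ?z
       + h\<^sup>2 * expectation (\<lambda>\<omega>. (A *v ?z \<omega>) \<bullet> (A *v ?z \<omega>))"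
    using euler_quadratic_recursion[OF h(1), of k "mat 1"] 
    by (simp only: power2_norm_eq_inner matrix_vector_mul_lid)
  also have "\<dots> \<le> ?m + h * ((2 * ?a + ?c\<^sup>2) * ?m) + h * (?a\<^sup>2 * ?m)"
  proof (intro add_mono order_refl mult_left_mono e1 h)
    have "h\<^sup>2 * expectation (\<lambda>\<omega>. (A *v ?z \<omega>) \<bullet> (A *v ?z \<omega>)) \<le> h\<^sup>2 * (?a\<^sup>2 * ?m)"
      by (intro mult_left_mono e2) auto
    also have "\<dots> \<le> h * (?a\<^sup>2 * ?m)"
      using h m0 by (intro mult_right_mono) (auto simp: power2_eq_square mult_left_le_one_le)
    finally show "h\<^sup>2 * expectation (\<lambda>\<omega>. (A *v ?z \<omega>) \<bullet> (A *v ?z \<omega>)) \<le> h * (?a\<^sup>2 * ?m)" .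
  qed
  also have "\<dots> = (1 + growth * h) * ?m" by (simp add: growth_def algebra_simps)
  also have "\<dots> \<le> exp (growth * h) * (exp (growth * (real k * h)) * (norm x0)\<^sup>2)"
    using Suc m0 by (intro mult_mono) (auto simp: exp_ge_add_one_self)
  also have "\<dots> = exp (growth * (real (Suc k) * h)) * (norm x0)\<^sup>2"
    unfolding mult.assoc[symmetric] mult_exp_exp by (simp add: algebra_simps)
  finally show ?case .
qed

definition euler_step :: "real \<Rightarrow> real \<Rightarrow> 'w \<Rightarrow> real^'n" where
  "euler_step h s = euler h (nat \<lfloor>s / h\<rfloor>)"

definition euler_interp :: "real \<Rightarrow> real \<Rightarrow> 'w \<Rightarrow> real^'n" where
  "euler_interp h s \<omega> = (let k = nat \<lfloor>s / h\<rfloor> in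
     euler h k \<omega> + (s - real k * h) *\<^sub>R (A *v euler h k \<omega>)
       + (W s \<omega> - W (real k * h) \<omega>) *\<^sub>R (C *v euler h k \<omega>))"

lemma nat_floor_divide:
  assumes "0 < h" "0 \<le> (s::real)"
  shows "real (nat \<lfloor>s / h\<rfloor>) * h \<le> s" "s < real (Suc (nat \<lfloor>s / h\<rfloor>)) * h"
proof -
  have "0 \<le> \<lfloor>s / h\<rfloor>" using assms by simp
  then have e: "real (nat \<lfloor>s / h\<rfloor>) = of_int \<lfloor>s / h\<rfloor>" by simp
  show "real (nat \<lfloor>s / h\<rfloor>) * h \<le> s"
    unfolding e using assms by (simp add: pos_le_divide_eq[symmetric])
  have "s / h < of_int \<lfloor>s / h\<rfloor> + 1" by linarith
  then show "s < real (Suc (nat \<lfloor>s / h\<rfloor>)) * h"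
    using assms e by (simp add: pos_divide_less_eq add.commute)
qed

lemma nat_floor_divide_unique:
  assumes "0 < h" "real k * h \<le> s" "s < real (Suc k) * h"
  shows "nat \<lfloor>s / h\<rfloor> = k"
proof -
  have "\<lfloor>s / h\<rfloor> = int k"
    using assms by (intro floor_unique) (auto simp: pos_le_divide_eq pos_divide_less_eq add.commute)
  then show ?thesis by simp
qed

lemma euler_step_mean_sq:
  assumes h: "0 < h" "h \<le> 1" and s: "s \<in> {0..T}"
  shows "mean_sq (euler_step h s) \<le> ennreal (exp (growth * T) * (norm x0)\<^sup>2)"
proof -
  let ?k = "nat \<lfloor>s / h\<rfloor>"
  have "mean_sq (euler_step h s) = ennreal (sq_mean (euler h ?k))"
    unfolding euler_step_def using h by (intro L2_at_mean_sq[OF euler_L2_at]) auto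
  also have "\<dots> \<le> ennreal (exp (growth * (real ?k * h)) * (norm x0)\<^sup>2)"
    using h by (intro ennreal_leI euler_second_moment) auto
  also have "\<dots> \<le> ennreal (exp (growth * T) * (norm x0)\<^sup>2)"
    using nat_floor_divide(1)[of h s] h s growth_nonneg
    by (intro ennreal_leI mult_right_mono) (auto intro!: mult_left_mono)
  finally show ?thesis .
qed

lemma euler_step_L2_process:
  assumes h: "0 < h" "h \<le> 1"
  shows "L2_process M F (euler_step h)"
proof -
  have prog: "progressive F (euler_step h)"
    unfolding progressive_def
  proof (intro allI impI)
    fix t :: real assume t: "0 \<le> t"
    let ?N = "restrict_space borel {0..t} \<Otimes>\<^sub>M F t"
    \<comment> \<open>values of the scheme after time \<open>t\<close> are not measurable at \<open>t\<close>, but do not occur on \<open>[0, t]\<close>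
        either\<close>
    define g where "g k \<omega> = (if real k * h \<le> t then euler h k \<omega> else 0)" for k \<omega>
    have g: "g k \<in> borel_measurable (F t)" for k
    proof (cases "real k * h \<le> t")
      case True
      then have "g k = euler h k" by (simp add: g_def fun_eq_iff)
      moreover have "euler h k \<in> borel_measurable (F (real k * h))"
        using euler_L2_at[of h k] h unfolding L2_at_def by simp
      ultimately show ?thesis using measurable_F_mono[OF _ True] h by simp
    next
      case False
      then have "g k = (\<lambda>_. 0)" by (simp add: g_def fun_eq_iff)
      then show ?thesis by simp
    qed
    have "(\<lambda>p. g (nat \<lfloor>fst p / h\<rfloor>) (snd p)) \<in> borel_measurable ?N"
    proof (rule measurable_compose_countable)
      show "(\<lambda>p. g i (snd p)) \<in> borel_measurable ?N" for i
        by (rule measurable_compose[OF measurable_snd g])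
      have "(\<lambda>s::real. nat \<lfloor>s / h\<rfloor>) \<in> measurable borel (count_space UNIV)" by measurable
      then have "(\<lambda>s::real. nat \<lfloor>s / h\<rfloor>) \<in> measurable (restrict_space borel {0..t}) (count_space UNIV)"
        by (rule measurable_restrict_space1)
      from measurable_compose[OF measurable_fst this]
      show "(\<lambda>p. nat \<lfloor>fst p / h\<rfloor>) \<in> measurable ?N (count_space UNIV)" .
    qed
    then show "(\<lambda>(s, \<omega>). euler_step h s \<omega>) \<in> borel_measurable ?N"
    proof (rule measurable_cong[THEN iffD1, rotated])
      fix p assume "p \<in> space ?N"
      then have "fst p \<in> {0..t}" by (auto simp: space_pair_measure space_restrict_space)
      then show "g (nat \<lfloor>fst p / h\<rfloor>) (snd p) = (case p of (s, \<omega>) \<Rightarrow> euler_step h s \<omega>)"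
        using nat_floor_divide(1)[of h "fst p"] h by (auto simp: g_def euler_step_def split_beta')
    qed
  qed
  have "mean_sq_upto T (euler_step h) < \<infinity>" if T: "0 \<le> T" for T
  proof -
    have "mean_sq_upto T (euler_step h) = (\<integral>\<^sup>+s\<in>{0..T}. mean_sq (euler_step h s) \<partial>lborel)"
      by (rule mean_sq_upto_eq(1)[OF progressive_jointly_measurable[OF prog T]])
    also have "\<dots> \<le> (\<integral>\<^sup>+s. ennreal (exp (growth * T) * (norm x0)\<^sup>2) * indicator {0..T} s \<partial>lborel)"
      using h by (intro nn_integral_mono) (auto simp: indicator_def intro: euler_step_mean_sq)
    also have "\<dots> < \<infinity>"
      using T by (simp add: nn_integral_cmult_indicator ennreal_mult_less_top)
    finally show ?thesis .
  qed
  then show ?thesis using prog unfolding L2_process_def mean_sq_upto_def by auto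
qed

end

lemma ennreal_geometric_tendsto_0:
  fixes f :: "nat \<Rightarrow> ennreal"
  assumes "\<And>i. f i \<le> ennreal (K * (1 / 4) ^ i)"
  shows "f \<longlonglongrightarrow> 0"
proof (rule tendsto_sandwich[of "\<lambda>_. 0" f _ "\<lambda>i. ennreal (K * (1 / 4) ^ i)"])
  have "(\<lambda>i. K * (1 / 4) ^ i) \<longlonglongrightarrow> K * 0"
    by (intro tendsto_mult tendsto_const LIMSEQ_power_zero) simp
  then show "(\<lambda>i. ennreal (K * (1 / 4) ^ i)) \<longlonglongrightarrow> 0"
    using tendsto_ennrealI by fastforce
qed (use assms in auto)

context brownian_setting
begin

lemma mean_sq_scaleR:
  fixes Z :: "'w \<Rightarrow> 'b::euclidean_space"
  assumes [measurable]: "Z \<in> borel_measurable M"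
  shows "mean_sq (\<lambda>\<omega>. c *\<^sub>R Z \<omega>) = ennreal (c\<^sup>2) * mean_sq Z"
  unfolding mean_sq_def
  by (subst nn_integral_cmult[symmetric]) (auto simp: ennreal_mult[symmetric] power_mult_distrib)

lemma mean_sq_increment_scaleR:
  fixes \<xi> :: "'w \<Rightarrow> 'b::euclidean_space"
  assumes "0 \<le> a" "a \<le> b" and \<xi>: "L2_at a \<xi>"
  shows "mean_sq (\<lambda>\<omega>. (W b \<omega> - W a \<omega>) *\<^sub>R \<xi> \<omega>) = ennreal (b - a) * mean_sq \<xi>"
proof -
  have "has_bochner_integral M (\<lambda>\<omega>. (norm (\<xi> \<omega>))\<^sup>2 * (W b \<omega> - W a \<omega>)\<^sup>2)
      ((b - a) * sq_mean \<xi>)"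
    using assms by (intro mult_increment) (auto simp: L2_at_def)
  then have "expectation (\<lambda>\<omega>. (norm ((W b \<omega> - W a \<omega>) *\<^sub>R \<xi> \<omega>))\<^sup>2) = (b - a) * sq_mean \<xi>"
    by (simp add: has_bochner_integral_iff power_mult_distrib mult.commute)
  then show ?thesis
    using L2_at_mean_sq[OF L2_at_increment_scaleR[OF assms]] L2_at_mean_sq[OF \<xi>] assms(2)
    by (simp add: ennreal_mult)
qed

end

context linear_sde
begin

definition grid :: "real \<Rightarrow> real \<Rightarrow> nat \<Rightarrow> real" where
  "grid h t k = min (real k * h) t"

definition cells :: "real \<Rightarrow> real \<Rightarrow> nat" where
  "cells h t = Suc (nat \<lfloor>t / h\<rfloor>)"

lemma grid_0: "0 \<le> t \<Longrightarrow> grid h t 0 = 0"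
  by (simp add: grid_def)

lemma grid_cells: "0 < h \<Longrightarrow> 0 \<le> t \<Longrightarrow> grid h t (cells h t) = t"
  using nat_floor_divide(2)[of h t] by (simp add: grid_def cells_def)

lemma grid_less: 
  assumes "0 < h" "0 \<le> t" "k < cells h t"
  shows "grid h t k = real k * h"
proof -
  have "real k * h \<le> real (nat \<lfloor>t / h\<rfloor>) * h"
    using assms(1,3) by (intro mult_right_mono) (simp_all only: cells_def of_nat_le_iff
        less_Suc_eq_le less_imp_le)
  then show ?thesis using nat_floor_divide(1)[OF assms(1,2)] by (simp add: grid_def)
qed

lemma grid_mono: "0 < h \<Longrightarrow> grid h t k \<le> grid h t (Suc k)"
  by (auto simp: grid_def min_def algebra_simps)

lemma grid_bounds: "0 < h \<Longrightarrow> 0 \<le> t \<Longrightarrow> 0 \<le> grid h t k \<and> grid h t k \<le> t"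
  by (auto simp: grid_def)

lemma grid_step_sum:
  fixes f :: "nat \<Rightarrow> 'b::real_vector"
  assumes h: "0 < h" and s: "0 \<le> s" "s < t"
  shows "(\<Sum>k<cells h t. indicator {grid h t k..<grid h t (Suc k)} s *\<^sub>R f k) = f (nat \<lfloor>s / h\<rfloor>)"
proof -
  let ?k = "nat \<lfloor>s / h\<rfloor>"
  have "\<lfloor>s / h\<rfloor> \<le> \<lfloor>t / h\<rfloor>" using assms by (intro floor_mono divide_right_mono) auto
  then have km: "?k < cells h t" by (simp add: cells_def)
  have "indicator {grid h t k..<grid h t (Suc k)} s *\<^sub>R f k = (if k = ?k then f k else 0)"
    if "k < cells h t" for k
  proof (cases "k = ?k")
    case True
    have "s \<in> {grid h t k..<grid h t (Suc k)}"
      using nat_floor_divide[OF h s(1)] s unfolding True by (auto simp: grid_def)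
    then show ?thesis using True by simp
  next
    case False
    have "s \<notin> {grid h t k..<grid h t (Suc k)}"
    proof
      assume "s \<in> {grid h t k..<grid h t (Suc k)}"
      then have "real k * h \<le> s" "s < real (Suc k) * h"
        using grid_less[OF h _ that] s by (auto simp: grid_def)
      then show False using nat_floor_divide_unique[OF h] False by auto
    qed
    then show ?thesis using False by simp
  qed
  then have "(\<Sum>k<cells h t. indicator {grid h t k..<grid h t (Suc k)} s *\<^sub>R f k)
      = (\<Sum>k<cells h t. if k = ?k then f k else 0)" by (intro sum.cong) auto
  also have "\<dots> = f ?k" using km by simp
  finally show ?thesis .
qed

lemma euler_sum:
  "euler h n \<omega> = x0 + (\<Sum>k<n. h *\<^sub>R (A *v euler h k \<omega>))
     + (\<Sum>k<n. (W (real (Suc k) * h) \<omega> - W (real k * h) \<omega>) *\<^sub>R (C *v euler h k \<omega>))"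
  by (induction n) (simp_all add: algebra_simps)

lemma euler_interp_sum:
  assumes h: "0 < h" and t: "0 \<le> t"
  shows "euler_interp h t \<omega> = x0
     + (\<Sum>k<cells h t. (grid h t (Suc k) - grid h t k) *\<^sub>R (A *v euler h k \<omega>))
     + step_integral W (cells h t) (grid h t) (\<lambda>k \<omega>. C *v euler h k \<omega>) \<omega>"
proof -
  define n where "n = nat \<lfloor>t / h\<rfloor>"
  have c: "cells h t = Suc n" by (simp add: cells_def n_def)
  have g: "grid h t k = real k * h" if "k \<le> n" for k
    using grid_less[OF h t, of k] that c by simp
  have gt: "grid h t (Suc n) = t" using grid_cells[OF h t] c by simp
  have g': "grid h t (Suc k) - grid h t k = h" if "k < n" for k
    using g[of k] g[of "Suc k"] that by (simp add: algebra_simps)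
  have "(\<Sum>k<cells h t. (grid h t (Suc k) - grid h t k) *\<^sub>R (A *v euler h k \<omega>))
     = (\<Sum>k<n. h *\<^sub>R (A *v euler h k \<omega>)) + (t - real n * h) *\<^sub>R (A *v euler h n \<omega>)"
    unfolding c using gt g[of n] by (simp add: g')
  moreover have "step_integral W (cells h t) (grid h t) (\<lambda>k \<omega>. C *v euler h k \<omega>) \<omega>
     = (\<Sum>k<n. (W (real (Suc k) * h) \<omega> - W (real k * h) \<omega>) *\<^sub>R (C *v euler h k \<omega>))
       + (W t \<omega> - W (real n * h) \<omega>) *\<^sub>R (C *v euler h n \<omega>)"
    unfolding step_integral_def c using gt g[of n]
    by (simp add: g[OF less_imp_le] g[OF Suc_leI] del: of_nat_Suc)
  ultimately show ?thesis
    unfolding euler_interp_def Let_def n_def[symmetric] using euler_sum[of h n \<omega>] by simp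
qed

lemma euler_time_integral:
  assumes h: "0 < h" and t: "0 \<le> t"
  shows "(LINT s:{0..t}|lborel. A *v euler_step h s \<omega>)
    = (\<Sum>k<cells h t. (grid h t (Suc k) - grid h t k) *\<^sub>R (A *v euler h k \<omega>))"
proof -
  let ?f = "\<lambda>s. \<Sum>k<cells h t. indicator {grid h t k..<grid h t (Suc k)} s *\<^sub>R (A *v euler h k \<omega>)"
  have "has_bochner_integral lborel ?f
     (\<Sum>k<cells h t. measure lborel {grid h t k..<grid h t (Suc k)} *\<^sub>R (A *v euler h k \<omega>))"
    using grid_mono[OF h]
    by (intro has_bochner_integral_sum has_bochner_integral_scaleR_left
        has_bochner_integral_real_indicator) auto
  then have "integral\<^sup>L lborel ?f = (\<Sum>k<cells h t. (grid h t (Suc k) - grid h t k) *\<^sub>R (A *v euler h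
      k \<omega>))"
    using grid_mono[OF h] by (simp add: has_bochner_integral_iff)
  moreover have "(LINT s:{0..t}|lborel. A *v euler_step h s \<omega>) = integral\<^sup>L lborel ?f"
    unfolding set_lebesgue_integral_def
  proof (rule integral_cong_AE)
    show "(\<lambda>s. indicat_real {0..t} s *\<^sub>R (A *v euler_step h s \<omega>)) \<in> borel_measurable lborel"
    proof -
      have "(\<lambda>s. A *v euler h (nat \<lfloor>s / h\<rfloor>) \<omega>) \<in> borel_measurable lborel"
        by (rule measurable_compose_countable[of "\<lambda>k s. A *v euler h k \<omega>"]) measurable
      then show ?thesis unfolding euler_step_def by measurable
    qed
    show "?f \<in> borel_measurable lborel" by measurable
    have "indicat_real {0..t} s *\<^sub>R (A *v euler_step h s \<omega>) = ?f s" if "s \<noteq> t" for s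
    proof (cases "0 \<le> s \<and> s < t")
      case True
      then have ind: "indicat_real {0..t} s = 1" by simp
      show ?thesis
        unfolding ind euler_step_def scaleR_one
        using True by (intro grid_step_sum[OF h, symmetric]) auto
    next
      case False
      then have "s \<notin> {grid h t k..<grid h t (Suc k)}" for k
        using grid_bounds[OF h t, of k] grid_bounds[OF h t, of "Suc k"] that by auto
      then have "?f s = 0"
        by (intro sum.neutral ballI) (simp only: indicator_simps(2) scaleR_zero_left not_False_eq_True)
      moreover have "indicat_real {0..t} s = 0" using False that by auto
      ultimately show ?thesis by (simp only: scaleR_zero_left)
    qed
    then show "AE s in lborel. indicat_real {0..t} s *\<^sub>R (A *v euler_step h s \<omega>) = ?f s"
      using AE_lborel_singleton[of t] by (auto elim!: eventually_mono)
  qed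
  ultimately show ?thesis by simp
qed

lemma euler_interp_integral:
  assumes "0 < h" "0 \<le> t"
  shows "euler_interp h t \<omega> = x0 + (LINT s:{0..t}|lborel. A *v euler_step h s \<omega>)
     + step_integral W (cells h t) (grid h t) (\<lambda>k \<omega>. C *v euler h k \<omega>) \<omega>"
  using euler_interp_sum[OF assms] euler_time_integral[OF assms] by simp

lemma euler_step_data:
  assumes h: "0 < h" and t: "0 \<le> t"
  shows "step_data M F t (cells h t) (grid h t) (\<lambda>k \<omega>. C *v euler h k \<omega>)"
proof -
  have "L2_at (real k * h) (\<lambda>\<omega>. C *v euler h k \<omega>)" for k
    using h by (intro L2_at_matrix euler_L2_at) auto
  then show ?thesis
    unfolding step_data_def L2_at_def
    by (intro conjI allI impI grid_0[OF t] grid_cells[OF h t] grid_mono[OF h])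
       (simp_all add: grid_less[OF h t])
qed

text \<open>The two integrands differ at most at the single time \<open>t\<close>, where the step process vanishes.\<close>

lemma euler_step_process_eq:
  assumes h: "0 < h"
  shows "mean_sq_upto t (\<lambda>s \<omega>. step_process (cells h t) (grid h t) (\<lambda>k \<omega>. C *v euler h k \<omega>) s \<omega> - Y s \<omega>)
    = mean_sq_upto t (\<lambda>s \<omega>. C *v euler_step h s \<omega> - Y s \<omega>)"
proof -
  have eq: "step_process (cells h t) (grid h t) (\<lambda>k \<omega>. C *v euler h k \<omega>) s \<omega> = C *v euler_step h s \<omega>"
    if "0 \<le> s" "s < t" for s \<omega>
    unfolding step_process_def euler_step_def using grid_step_sum[OF h that] .
  show ?thesis
    unfolding mean_sq_upto_def
  proof (rule nn_integral_cong, rule nn_integral_cong_AE)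
    fix \<omega>
    show "AE s in lborel.
        ennreal ((norm (step_process (cells h t) (grid h t) (\<lambda>k \<omega>. C *v euler h k \<omega>) s \<omega> - Y s
            \<omega>))\<^sup>2) * indicator {0..t} s
        = ennreal ((norm (C *v euler_step h s \<omega> - Y s \<omega>))\<^sup>2) * indicator {0..t} s"
      using AE_lborel_singleton[of t]
    proof eventually_elim
      case (elim s)
      then show ?case using eq[of s \<omega>] by (cases "0 \<le> s \<and> s < t") (auto simp: indicator_def)
    qed
  qed
qed

text \<open>The integrand of the Ito integral is a step process, so that a constant sequence approximates
  it.\<close>

lemma euler_approximate_solution:
  assumes h: "0 < h" "h \<le> 1"
  shows "approximate_solution T (euler_step h) (euler_interp h)"
  unfolding approximate_solution_def
proof (intro conjI ballI)
  show L: "L2_process M F (euler_step h)" by (rule euler_step_L2_process[OF h])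
  fix t assume "t \<in> {0..T}"
  then have t: "0 \<le> t" by simp
  let ?Y = "step_integral W (cells h t) (grid h t) (\<lambda>k \<omega>. C *v euler h k \<omega>)"
  note data = euler_step_data[OF h(1) t]
  have Y: "?Y \<in> borel_measurable M" by (rule step_integral_measurable[OF data])
  note bl = matrix_vector_mul_bounded_linear
  have "(\<lambda>\<omega>. LINT s:{0..t}|lborel. A *v euler_step h s \<omega>) \<in> borel_measurable M"
    by (intro time_integral_measurable jointly_measurable_linear[OF bl]
        L2_process_jointly_measurable[OF L t])
  then show "euler_interp h t \<in> borel_measurable M"
    unfolding euler_interp_integral[OF h(1) t, abs_def] using Y by (intro borel_measurable_add) auto
  have "has_ito_integral M F W (\<lambda>s \<omega>. C *v euler_step h s \<omega>) t ?Y"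
    unfolding has_ito_integral_def
  proof (intro conjI exI[of _ "\<lambda>_. cells h t"] exI[of _ "\<lambda>_. grid h t"]
        exI[of _ "\<lambda>_ k \<omega>. C *v euler h k \<omega>"])
    show "L2_process M F (\<lambda>s \<omega>. C *v euler_step h s \<omega>)" by (rule L2_process_linear[OF bl L])
    show "\<forall>i::nat. step_data M F t (cells h t) (grid h t) (\<lambda>k \<omega>. C *v euler h k \<omega>)" using data by simp
    show "(\<lambda>i::nat. \<integral>\<^sup>+ \<omega>. (\<integral>\<^sup>+ s\<in>{0..t}.
            ennreal ((norm (step_process (cells h t) (grid h t) (\<lambda>k \<omega>. C *v euler h k \<omega>) s \<omega>
                 - C *v euler_step h s \<omega>))\<^sup>2) \<partial>lborel) \<partial>M) \<longlonglongrightarrow> 0"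
      unfolding mean_sq_upto_def[symmetric] euler_step_process_eq[OF h(1)]
        by (simp add: mean_sq_upto_def)
    show "(\<lambda>i::nat. \<integral>\<^sup>+ \<omega>. ennreal ((norm (?Y \<omega> - ?Y \<omega>))\<^sup>2) \<partial>M) \<longlonglongrightarrow> 0" by simp
  qed (rule Y)
  then show "\<exists>Y. has_ito_integral M F W (\<lambda>s \<omega>. C *v euler_step h s \<omega>) t Y \<and>
           (AE \<omega> in M. euler_interp h t \<omega> = x0 + (LINT s:{0..t}|lborel. A *v euler_step h s \<omega>) + Y \<omega>)"
    using euler_interp_integral[OF h(1) t] by auto
qed

definition interp_const :: "real \<Rightarrow> real" where
  "interp_const T = 2 * ((onorm ((*v) A))\<^sup>2 + (onorm ((*v) C))\<^sup>2) * (exp (growth * T) * (norm x0)\<^sup>2)"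

lemma interp_const_nonneg: "0 \<le> interp_const T"
  by (simp add: interp_const_def)

text \<open>Within one step the drift contributes a term of order \<open>h\<^sup>2\<close> to the mean square, and the noise
  one of order \<open>h\<close>.\<close>

lemma euler_interp_close:
  assumes h: "0 < h" "h \<le> 1" and s: "s \<in> {0..T}"
  shows "mean_sq (\<lambda>\<omega>. euler_interp h s \<omega> - euler_step h s \<omega>) \<le> ennreal (interp_const T * h)"
proof -
  define k where "k = nat \<lfloor>s / h\<rfloor>"
  define r where "r = s - real k * h"
  have k: "0 \<le> real k * h" "real k * h \<le> s" "s < real (Suc k) * h"
    using nat_floor_divide[of h s] h s by (auto simp: k_def)
  then have r: "0 \<le> r" "r \<le> h" "r\<^sup>2 \<le> h"
    using h mult_mono[of r h r 1] by (auto simp: r_def algebra_simps power2_eq_square)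
  let ?z = "euler h k"
  have z: "L2_at (real k * h) ?z" using h by (intro euler_L2_at) auto
  then have zm: "?z \<in> borel_measurable M" using measurable_F[OF k(1)] unfolding L2_at_def by auto
  have Az: "(\<lambda>\<omega>. A *v ?z \<omega>) \<in> borel_measurable M"
    using measurable_F[OF k(1)] L2_at_matrix[OF k(1) z] unfolding L2_at_def by auto
  have Wz: "(\<lambda>\<omega>. (W s \<omega> - W (real k * h) \<omega>) *\<^sub>R (C *v ?z \<omega>)) \<in> borel_measurable M"
    using L2_at_increment_scaleR[OF k(1,2) L2_at_matrix[OF k(1) z]] measurable_F[of s] s
    unfolding L2_at_def by auto
  have zs: "mean_sq ?z \<le> ennreal (exp (growth * T) * (norm x0)\<^sup>2)"
    using euler_step_mean_sq[OF h s] by (simp add: euler_step_def k_def)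
  let ?m = "exp (growth * T) * (norm x0)\<^sup>2"
  have lin: "mean_sq (\<lambda>\<omega>. G *v ?z \<omega>) \<le> ennreal ((onorm ((*v) G))\<^sup>2 * ?m)" for G :: "real^'n^'n"
    using order_trans[OF mean_sq_linear[OF matrix_vector_mul_bounded_linear zm] mult_left_mono[OF zs]]
    by (simp add: ennreal_mult)
  have "mean_sq (\<lambda>\<omega>. euler_interp h s \<omega> - euler_step h s \<omega>)
     = mean_sq (\<lambda>\<omega>. r *\<^sub>R (A *v ?z \<omega>) + (W s \<omega> - W (real k * h) \<omega>) *\<^sub>R (C *v ?z \<omega>))"
    by (simp add: euler_interp_def euler_step_def Let_def k_def[symmetric] r_def)
  also have "\<dots> \<le> 2 * mean_sq (\<lambda>\<omega>. r *\<^sub>R (A *v ?z \<omega>))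
      + 2 * mean_sq (\<lambda>\<omega>. (W s \<omega> - W (real k * h) \<omega>) *\<^sub>R (C *v ?z \<omega>))"
    using Az Wz by (intro mean_sq_add) auto
  also have "\<dots> = 2 * (ennreal (r\<^sup>2) * mean_sq (\<lambda>\<omega>. A *v ?z \<omega>))
      + 2 * (ennreal r * mean_sq (\<lambda>\<omega>. C *v ?z \<omega>))"
    unfolding mean_sq_scaleR[OF Az] mean_sq_increment_scaleR[OF k(1,2) L2_at_matrix[OF k(1) z]] r_def ..
  also have "\<dots> \<le> 2 * (ennreal h * ennreal ((onorm ((*v) A))\<^sup>2 * ?m))
      + 2 * (ennreal h * ennreal ((onorm ((*v) C))\<^sup>2 * ?m))"
    using r by (intro add_mono mult_left_mono mult_mono lin ennreal_leI) auto
  also have "\<dots> = ennreal (2 * (h * ((onorm ((*v) A))\<^sup>2 * ?m)) + 2 * (h * ((onorm ((*v) C))\<^sup>2 * ?m)))"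
    using h by (simp add: ennreal_mult ennreal_plus)
  also have "2 * (h * ((onorm ((*v) A))\<^sup>2 * ?m)) + 2 * (h * ((onorm ((*v) C))\<^sup>2 * ?m))
      = interp_const T * h"
    by (simp add: interp_const_def algebra_simps)
  finally show ?thesis .
qed

definition euler_const :: "real \<Rightarrow> real" where
  "euler_const T = gronwall_const T * interp_const T"

lemma euler_const_nonneg: "0 \<le> euler_const T"
  by (simp add: euler_const_def interp_const_nonneg gronwall_const_def)

lemma euler_step_distance:
  assumes "0 < h" "h \<le> 1" "0 < h'" "h' \<le> 1" "t \<in> {0..T}"
  shows "mean_sq (\<lambda>\<omega>. euler_step h t \<omega> - euler_step h' t \<omega>) \<le> ennreal (euler_const T * (h + h'))"
proof -
  have "mean_sq (\<lambda>\<omega>. euler_step h t \<omega> - euler_step h' t \<omega>)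
      \<le> ennreal (gronwall_const T * (interp_const T * h + interp_const T * h'))"
    using assms interp_const_nonneg[of T]
    by (intro approximate_solutions_close[OF euler_approximate_solution[OF assms(1,2)]
          euler_approximate_solution[OF assms(3,4)]] euler_interp_close) auto
  then show ?thesis by (simp add: euler_const_def algebra_simps)
qed

lemma solution_euler_step_distance:
  assumes X: "approximate_solution T X X" and h: "0 < h" "h \<le> 1" and t: "t \<in> {0..T}"
  shows "mean_sq (\<lambda>\<omega>. X t \<omega> - euler_step h t \<omega>) \<le> ennreal (euler_const T * h)"
proof -
  have "mean_sq (\<lambda>\<omega>. X t \<omega> - euler_step h t \<omega>) \<le> ennreal (gronwall_const T * (0 + interp_const T * h))"
    using h t interp_const_nonneg[of T]
    by (intro approximate_solutions_close[OF X euler_approximate_solution[OF h]] euler_interp_close)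
       (auto simp: mean_sq_def)
  then show ?thesis by (simp add: euler_const_def algebra_simps)
qed

end

section \<open>Existence of solutions\<close>

lemma (in brownian_setting) has_ito_integralI:
  fixes \<Phi> :: "real \<Rightarrow> 'w \<Rightarrow> 'b::euclidean_space"
  assumes "L2_process M F \<Phi>" "Y \<in> borel_measurable M"
    and "\<And>i. step_data M F T (m i) (\<tau> i) (\<xi> i)"
    and "(\<lambda>i. mean_sq_upto T (\<lambda>s \<omega>. step_process (m i) (\<tau> i) (\<xi> i) s \<omega> - \<Phi> s \<omega>)) \<longlonglongrightarrow> 0"
    and "(\<lambda>i. mean_sq (\<lambda>\<omega>. step_integral W (m i) (\<tau> i) (\<xi> i) \<omega> - Y \<omega>)) \<longlonglongrightarrow> 0"
  shows "has_ito_integral M F W \<Phi> T Y"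
  unfolding has_ito_integral_def
  using assms unfolding mean_sq_upto_def mean_sq_def by blast

context linear_sde
begin

text \<open>A pointwise limit, so that it is progressively measurable for any filtration. Where the limit
  fails to exist, \<open>lim\<close> has some fixed value.\<close>

definition sde_solution :: "real \<Rightarrow> 'w \<Rightarrow> real^'n" where
  "sde_solution s \<omega> = lim (\<lambda>n. euler_step ((1/4) ^ n) s \<omega>)"

lemma quarter_power: "0 < (1/4::real) ^ n" "(1/4::real) ^ n \<le> 1"
  by (auto intro: power_le_one)

lemma euler_step_measurable:
  assumes "0 < h" "h \<le> 1" "0 \<le> s"
  shows "euler_step h s \<in> borel_measurable M"
  using jointly_measurable_at[OF L2_process_jointly_measurable[OF euler_step_L2_process[OF
      assms(1,2)] assms(3)], of s] assms(3)
  by simp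

lemma sde_solution_progressive: "progressive F sde_solution"
  unfolding progressive_def
proof (intro allI impI)
  fix t :: real assume t: "0 \<le> t"
  have "(\<lambda>p. euler_step ((1/4) ^ n) (fst p) (snd p)) \<in> borel_measurable (restrict_space borel {0..t}
      \<Otimes>\<^sub>M F t)" for n
    using euler_step_L2_process[OF quarter_power(1,2), of n] t
    unfolding L2_process_def progressive_def by (simp add: split_beta')
  then show "(\<lambda>(s, \<omega>). sde_solution s \<omega>) \<in> borel_measurable (restrict_space borel {0..t} \<Otimes>\<^sub>M F t)"
    unfolding sde_solution_def split_beta' by (rule borel_measurable_lim_metric)
qed

text \<open>The mean square of the difference \<open>d n\<close> of two consecutive schemes is of order \<open>4\<^sup>-\<^sup>n\<close>. So the
  mean of \<open>\<Sum>n. 2\<^sup>n |d n|\<^sup>2\<close> is finite, and almost surely \<open>d n\<close> is summable because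
  \<open>|d n| \<le> 2\<^sup>-\<^sup>n + 2\<^sup>n |d n|\<^sup>2\<close>.\<close>

lemma euler_step_convergent_AE:
  assumes s: "0 \<le> s"
  shows "AE \<omega> in M. (\<lambda>n. euler_step ((1/4) ^ n) s \<omega>) \<longlonglongrightarrow> sde_solution s \<omega>"
proof -
  let ?Z = "\<lambda>n. euler_step ((1/4) ^ n) s"
  define d where "d n \<omega> = ?Z (Suc n) \<omega> - ?Z n \<omega>" for n \<omega>
  have [measurable]: "?Z n \<in> borel_measurable M" for n
    using euler_step_measurable[OF quarter_power s] .
  have [measurable]: "d n \<in> borel_measurable M" for n unfolding d_def by measurable
  let ?G = "euler_const s"
  have d: "mean_sq (d n) \<le> ennreal (2 * ?G * (1/4) ^ n)" for n
  proof -
    have "mean_sq (d n) \<le> ennreal (?G * ((1/4) ^ Suc n + (1/4) ^ n))"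
      unfolding d_def using s by (intro euler_step_distance quarter_power) auto
    also have "\<dots> \<le> ennreal (2 * ?G * (1/4) ^ n)"
      using euler_const_nonneg[of s] by (intro ennreal_leI) (simp add: algebra_simps mult_left_mono)
    finally show ?thesis .
  qed
  have "(\<integral>\<^sup>+\<omega>. (\<Sum>n. ennreal (2 ^ n * (norm (d n \<omega>))\<^sup>2)) \<partial>M)
      = (\<Sum>n. \<integral>\<^sup>+\<omega>. ennreal (2 ^ n * (norm (d n \<omega>))\<^sup>2) \<partial>M)"
    by (rule nn_integral_suminf) measurable
  also have "\<dots> \<le> (\<Sum>n. ennreal (2 * ?G * (1/2) ^ n))"
  proof (intro suminf_le summableI)
    fix n
    have "(\<integral>\<^sup>+\<omega>. ennreal (2 ^ n * (norm (d n \<omega>))\<^sup>2) \<partial>M) = ennreal (2 ^ n) * mean_sq (d n)"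
      unfolding mean_sq_def by (subst nn_integral_cmult[symmetric]) (auto simp: ennreal_mult)
    also have "\<dots> \<le> ennreal (2 ^ n) * ennreal (2 * ?G * (1/4) ^ n)"
      by (intro mult_left_mono d) auto
    also have "\<dots> = ennreal (2 * ?G * (1/2) ^ n)"
      using euler_const_nonneg[of s]
      by (subst ennreal_mult[symmetric]) (auto simp: power_divide power_mult_distrib[symmetric]
          field_simps
          simp flip: power_mult_distrib)
    finally show "(\<integral>\<^sup>+\<omega>. ennreal (2 ^ n * (norm (d n \<omega>))\<^sup>2) \<partial>M) \<le> ennreal (2 * ?G * (1/2) ^ n)" .
  qed
  also have "\<dots> = ennreal (\<Sum>n. 2 * ?G * (1/2) ^ n)"
    using euler_const_nonneg[of s] by (intro suminf_ennreal2 summable_mult summable_geometric) auto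
  also have "\<dots> < \<infinity>" by simp
  finally have "(\<integral>\<^sup>+\<omega>. (\<Sum>n. ennreal (2 ^ n * (norm (d n \<omega>))\<^sup>2)) \<partial>M) \<noteq> \<infinity>" by simp
  then have "AE \<omega> in M. (\<Sum>n. ennreal (2 ^ n * (norm (d n \<omega>))\<^sup>2)) \<noteq> \<infinity>"
    by (intro nn_integral_noteq_infinite) measurable
  then show ?thesis
  proof eventually_elim
    case (elim \<omega>)
    have s2: "summable (\<lambda>n. 2 ^ n * (norm (d n \<omega>))\<^sup>2)"
      using elim by (intro summable_suminf_not_top) (auto simp: top_ennreal_def)
    have "norm (d n \<omega>) \<le> (1/2) ^ n + 2 ^ n * (norm (d n \<omega>))\<^sup>2" for n
    proof -
      let ?x = "norm (d n \<omega>)" and ?p = "(2::real) ^ n"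
      have p: "0 < ?p" by simp
      have "?p * ?x \<le> 1 + (?p * ?x)\<^sup>2"
        using norm_le_one_plus_power2[of "?p * ?x"] by simp
      then have "?p * ?x \<le> ?p * ((1/2) ^ n + ?p * ?x\<^sup>2)"
        by (simp add: power2_eq_square algebra_simps power_mult_distrib[symmetric])
      then show ?thesis using p by (simp only: mult_le_cancel_left_pos)
    qed
    note bound = this
    have "summable (\<lambda>n. (1/2) ^ n + 2 ^ n * (norm (d n \<omega>))\<^sup>2)"
      by (intro summable_add s2 summable_geometric) simp
    then have "summable (\<lambda>n. d n \<omega>)"
      by (rule summable_comparison_test') (rule bound)
    then have "convergent (\<lambda>n. \<Sum>k<n. d k \<omega>)" by (simp add: summable_iff_convergent)
    then have "convergent (\<lambda>n. (\<Sum>k<n. d k \<omega>) + ?Z 0 \<omega>)"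
      by (intro convergent_add convergent_const)
    moreover have "(\<Sum>k<n. d k \<omega>) + ?Z 0 \<omega> = ?Z n \<omega>" for n
      unfolding d_def sum_lessThan_telescope[of "\<lambda>n. ?Z n \<omega>"] by simp
    ultimately have "convergent (\<lambda>n. ?Z n \<omega>)" by simp
    then show ?case unfolding sde_solution_def by (simp add: convergent_LIMSEQ_iff)
  qed
qed

lemma sde_solution_measurable: "0 \<le> s \<Longrightarrow> sde_solution s \<in> borel_measurable M"
  using jointly_measurable_at[OF progressive_jointly_measurable[OF sde_solution_progressive], of s
      s] by simp

text \<open>Fatou's lemma for the index of the finer scheme.\<close>

lemma sde_solution_euler_distance:
  assumes s: "s \<in> {0..T}"
  shows "mean_sq (\<lambda>\<omega>. euler_step ((1/4) ^ n) s \<omega> - sde_solution s \<omega>)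
      \<le> ennreal (2 * euler_const T * (1/4) ^ n)"
proof -
  let ?Z = "\<lambda>n. euler_step ((1/4) ^ n) s"
  have s0: "0 \<le> s" using s by simp
  have [measurable]: "?Z n \<in> borel_measurable M" for n
    using euler_step_measurable[OF quarter_power s0] .
  have "mean_sq (\<lambda>\<omega>. ?Z n \<omega> - sde_solution s \<omega>)
      = (\<integral>\<^sup>+\<omega>. liminf (\<lambda>m. ennreal ((norm (?Z n \<omega> - ?Z m \<omega>))\<^sup>2)) \<partial>M)"
    unfolding mean_sq_def
  proof (rule nn_integral_cong_AE)
    show "AE \<omega> in M. ennreal ((norm (?Z n \<omega> - sde_solution s \<omega>))\<^sup>2)
        = liminf (\<lambda>m. ennreal ((norm (?Z n \<omega> - ?Z m \<omega>))\<^sup>2))"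
      using euler_step_convergent_AE[OF s0]
    proof eventually_elim
      case (elim \<omega>)
      then have "(\<lambda>m. ennreal ((norm (?Z n \<omega> - ?Z m \<omega>))\<^sup>2))
          \<longlonglongrightarrow> ennreal ((norm (?Z n \<omega> - sde_solution s \<omega>))\<^sup>2)"
        by (intro tendsto_ennrealI tendsto_intros)
      then show ?case using lim_imp_Liminf[OF sequentially_bot] by metis
    qed
  qed
  also have "\<dots> \<le> liminf (\<lambda>m. \<integral>\<^sup>+\<omega>. ennreal ((norm (?Z n \<omega> - ?Z m \<omega>))\<^sup>2) \<partial>M)"
    by (rule nn_integral_liminf) measurable
  also have "\<dots> \<le> liminf (\<lambda>m. ennreal (2 * euler_const T * (1/4) ^ n))"
  proof (rule Liminf_mono, rule eventually_sequentiallyI)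
    fix m assume "n \<le> m"
    then have "(1/4::real) ^ m \<le> (1/4) ^ n" by (intro power_decreasing) auto
    then have "euler_const T * ((1/4) ^ n + (1/4) ^ m) \<le> 2 * euler_const T * (1/4) ^ n"
      using mult_left_mono[OF _ euler_const_nonneg[of T], of "(1/4) ^ m" "(1/4) ^ n"]
        by (simp add: algebra_simps)
    then show "(\<integral>\<^sup>+\<omega>. ennreal ((norm (?Z n \<omega> - ?Z m \<omega>))\<^sup>2) \<partial>M)
        \<le> ennreal (2 * euler_const T * (1/4) ^ n)"
      using euler_step_distance[OF quarter_power(1,2)[of n] quarter_power(1,2)[of m] s]
      unfolding mean_sq_def by (meson ennreal_leI order_trans)
  qed
  also have "\<dots> = ennreal (2 * euler_const T * (1/4) ^ n)" by (simp add: Liminf_const)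
  finally show ?thesis .
qed

lemma sde_solution_L2_process: "L2_process M F sde_solution"
proof -
  have "mean_sq_upto T sde_solution < \<infinity>" if T: "0 \<le> T" for T
  proof -
    let ?B = "2 * (2 * euler_const T) + 2 * (exp (growth * T) * (norm x0)\<^sup>2)"
    have B: "mean_sq (sde_solution s) \<le> ennreal ?B" if s: "s \<in> {0..T}" for s
    proof -
      have [measurable]: "sde_solution s \<in> borel_measurable M" "euler_step 1 s \<in> borel_measurable M"
        using s sde_solution_measurable euler_step_measurable[of 1 s] by auto
      have "mean_sq (sde_solution s) = mean_sq (\<lambda>\<omega>. (sde_solution s \<omega> - euler_step 1 s \<omega>)
          + euler_step 1 s \<omega>)"
        by simp
      also have "\<dots> \<le> 2 * mean_sq (\<lambda>\<omega>. sde_solution s \<omega> - euler_step 1 s \<omega>)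
          + 2 * mean_sq (euler_step 1 s)"
        by (intro mean_sq_add) measurable
      also have "\<dots> \<le> 2 * ennreal (2 * euler_const T) + 2 * ennreal (exp (growth * T) * (norm x0)\<^sup>2)"
      proof (intro add_mono mult_left_mono)
        have "mean_sq (\<lambda>\<omega>. sde_solution s \<omega> - euler_step 1 s \<omega>)
            = mean_sq (\<lambda>\<omega>. euler_step 1 s \<omega> - sde_solution s \<omega>)"
          unfolding mean_sq_def by (simp add: norm_minus_commute)
        then show "mean_sq (\<lambda>\<omega>. sde_solution s \<omega> - euler_step 1 s \<omega>) \<le> ennreal (2 * euler_const T)"
          using sde_solution_euler_distance[OF s, of 0] by simp
        show "mean_sq (euler_step 1 s) \<le> ennreal (exp (growth * T) * (norm x0)\<^sup>2)"
          using s by (intro euler_step_mean_sq) auto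
      qed auto
      also have "\<dots> = ennreal ?B"
        using euler_const_nonneg[of T] by (simp add: ennreal_plus ennreal_mult)
      finally show ?thesis .
    qed
    have "mean_sq_upto T sde_solution = (\<integral>\<^sup>+s\<in>{0..T}. mean_sq (sde_solution s) \<partial>lborel)"
      by (rule mean_sq_upto_eq(1)[OF progressive_jointly_measurable[OF sde_solution_progressive T]])
    also have "\<dots> \<le> (\<integral>\<^sup>+s. ennreal ?B * indicator {0..T} s \<partial>lborel)"
      using B by (intro nn_integral_mono) (auto simp: indicator_def)
    also have "\<dots> < \<infinity>"
      using T by (simp add: nn_integral_cmult_indicator ennreal_mult_less_top)
    finally show ?thesis .
  qed
  then show ?thesis using sde_solution_progressive unfolding L2_process_def mean_sq_upto_def by auto
qed

text \<open>The candidate for the Ito integral is what the initial state and the drift leave over. The step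
  integrals of the Euler schemes converge to it, and their integrands converge to \<open>C X\<close>.\<close>

lemma sde_solution_is_solution: "approximate_solution T sde_solution sde_solution"
  unfolding approximate_solution_def
proof (intro conjI ballI)
  show L: "L2_process M F sde_solution" by (rule sde_solution_L2_process)
  fix t assume "t \<in> {0..T}"
  then have t: "0 \<le> t" by simp
  show X: "sde_solution t \<in> borel_measurable M" by (rule sde_solution_measurable[OF t])
  let ?h = "\<lambda>n. (1/4::real) ^ n"
  let ?S = "\<lambda>n. step_integral W (cells (?h n) t) (grid (?h n) t) (\<lambda>k \<omega>. C *v euler (?h n) k \<omega>)"
  define Y where "Y \<omega> = sde_solution t \<omega> - x0 - (LINT s:{0..t}|lborel. A *v sde_solution s \<omega>)" for \<omega>
  note bl = matrix_vector_mul_bounded_linear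
  have Y: "Y \<in> borel_measurable M"
    unfolding Y_def
    by (intro borel_measurable_diff X time_integral_measurable jointly_measurable_linear[OF bl]
        L2_process_jointly_measurable[OF L t]) auto
  have LZ: "L2_process M F (euler_step (?h n))" for n
    by (rule euler_step_L2_process[OF quarter_power])
  have D: "jointly_measurable t (\<lambda>s \<omega>. euler_step (?h n) s \<omega> - sde_solution s \<omega>)" for n
    by (intro jointly_measurable_diff L2_process_jointly_measurable LZ L t)
  let ?G = "2 * euler_const t"
  have dist: "mean_sq_upto t (\<lambda>s \<omega>. euler_step (?h n) s \<omega> - sde_solution s \<omega>)
      \<le> ennreal (t * ?G * ?h n)" for n
  proof -
    have "mean_sq_upto t (\<lambda>s \<omega>. euler_step (?h n) s \<omega> - sde_solution s \<omega>)
        \<le> (\<integral>\<^sup>+s. ennreal (?G * ?h n) * indicator {0..t} s \<partial>lborel)"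
      unfolding mean_sq_upto_eq(1)[OF D]
      by (intro nn_integral_mono) (auto simp: indicator_def intro!: sde_solution_euler_distance)
    also have "\<dots> = ennreal (t * ?G * ?h n)"
    proof -
      have "(\<integral>\<^sup>+s. ennreal (?G * ?h n) * indicator {0..t} s \<partial>lborel) = ennreal (?G * ?h n) * ennreal t"
        using t by (subst nn_integral_cmult_indicator) auto
      also have "\<dots> = ennreal (?G * ?h n * t)"
        using t euler_const_nonneg[of t] by (intro ennreal_mult[symmetric]) auto
      finally show ?thesis by (simp only: mult_ac)
    qed
    finally show ?thesis .
  qed
  have "has_ito_integral M F W (\<lambda>s \<omega>. C *v sde_solution s \<omega>) t Y"
  proof (rule has_ito_integralI)
    show "L2_process M F (\<lambda>s \<omega>. C *v sde_solution s \<omega>)" by (rule L2_process_linear[OF bl L])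
    show "step_data M F t (cells (?h n) t) (grid (?h n) t) (\<lambda>k \<omega>. C *v euler (?h n) k \<omega>)" for n
      by (rule euler_step_data[OF quarter_power(1) t])
    show "(\<lambda>n. mean_sq_upto t (\<lambda>s \<omega>. step_process (cells (?h n) t) (grid (?h n) t) (\<lambda>k \<omega>. C *v euler
        (?h n) k \<omega>) s \<omega>
                 - C *v sde_solution s \<omega>)) \<longlonglongrightarrow> 0"
      unfolding euler_step_process_eq[OF quarter_power(1)]
    proof (rule ennreal_geometric_tendsto_0)
      fix n
      have "mean_sq_upto t (\<lambda>s \<omega>. C *v euler_step (?h n) s \<omega> - C *v sde_solution s \<omega>)
          \<le> ennreal ((onorm ((*v) C))\<^sup>2) * mean_sq_upto t (\<lambda>s \<omega>. euler_step (?h n) s \<omega> -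
              sde_solution s \<omega>)"
        using mean_sq_upto_linear[OF bl D] by (simp add: matrix_vector_mult_diff_distrib)
      also have "\<dots> \<le> ennreal ((onorm ((*v) C))\<^sup>2) * ennreal (t * ?G * ?h n)"
        by (intro mult_left_mono dist) auto
      also have "\<dots> = ennreal ((onorm ((*v) C))\<^sup>2 * (t * ?G) * ?h n)"
        using t euler_const_nonneg[of t] by (subst ennreal_mult[symmetric]) (auto simp: mult_ac)
      finally show "mean_sq_upto t (\<lambda>s \<omega>. C *v euler_step (?h n) s \<omega> - C *v sde_solution s \<omega>)
          \<le> ennreal ((onorm ((*v) C))\<^sup>2 * (t * ?G) * ?h n)" .
    qed
    show "(\<lambda>n. mean_sq (\<lambda>\<omega>. ?S n \<omega> - Y \<omega>)) \<longlonglongrightarrow> 0"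
    proof (rule ennreal_geometric_tendsto_0)
      fix n
      let ?I = "\<lambda>\<omega>. (LINT s:{0..t}|lborel. A *v sde_solution s \<omega>) - (LINT s:{0..t}|lborel. A *v
          euler_step (?h n) s \<omega>)"
      have Zm: "euler_interp (?h n) t \<in> borel_measurable M" "euler_step (?h n) t \<in> borel_measurable M"
        using euler_approximate_solution[OF quarter_power(1)[of n] quarter_power(2)[of n], of t] t
            euler_step_measurable[OF quarter_power t]
        unfolding approximate_solution_def by auto
      have Im: "?I \<in> borel_measurable M"
        by (intro borel_measurable_diff time_integral_measurable jointly_measurable_linear[OF bl]
             L2_process_jointly_measurable LZ L t)
      have sym: "mean_sq_upto t (\<lambda>s \<omega>. sde_solution s \<omega> - euler_step (?h n) s \<omega>)
          = mean_sq_upto t (\<lambda>s \<omega>. euler_step (?h n) s \<omega> - sde_solution s \<omega>)"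
        unfolding mean_sq_upto_def by (simp add: norm_minus_commute)
      have "mean_sq (\<lambda>\<omega>. ?S n \<omega> - Y \<omega>)
          = mean_sq (\<lambda>\<omega>. (euler_interp (?h n) t \<omega> - euler_step (?h n) t \<omega>)
              + (euler_step (?h n) t \<omega> - sde_solution t \<omega>) + ?I \<omega>)"
        by (simp add: Y_def euler_interp_integral[OF quarter_power(1) t] algebra_simps)
      also have "\<dots> \<le> 3 * (mean_sq (\<lambda>\<omega>. euler_interp (?h n) t \<omega> - euler_step (?h n) t \<omega>)
              + mean_sq (\<lambda>\<omega>. euler_step (?h n) t \<omega> - sde_solution t \<omega>) + mean_sq ?I)"
        by (intro mean_sq_add3 borel_measurable_diff[OF Zm] borel_measurable_diff[OF Zm(2) X] Im)
      also have "\<dots> \<le> 3 * (ennreal (interp_const t * ?h n) + ennreal (?G * ?h n)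
              + ennreal (t * (onorm ((*v) A))\<^sup>2) * ennreal (t * ?G * ?h n))"
        using order_trans[OF drift_estimate[OF L LZ[of n] t, of A] mult_left_mono[OF dist[of n,
            folded sym]]] t
        by (intro mult_left_mono add_mono euler_interp_close quarter_power
            sde_solution_euler_distance) auto
      also have "\<dots> = ennreal (3 * (interp_const t + ?G + t * (onorm ((*v) A))\<^sup>2 * (t * ?G)) * ?h n)"
      proof -
        have e: "3 * (interp_const t + ?G + t * (onorm ((*v) A))\<^sup>2 * (t * ?G)) * ?h n
          = 3 * (interp_const t * ?h n + ?G * ?h n + t * (onorm ((*v) A))\<^sup>2 * (t * ?G * ?h n))"
          by (simp add: algebra_simps)
        have sum: "3 * (ennreal a + ennreal b + ennreal c * ennreal d) = ennreal (3 * (a + b + c * d))"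
          if "0 \<le> a" "0 \<le> b" "0 \<le> c" "0 \<le> d" for a b c d
          using that by (simp add: ennreal_mult ennreal_plus)
        show ?thesis
          unfolding e using t euler_const_nonneg[of t] interp_const_nonneg[of t] by (intro sum) auto
      qed
      finally show "mean_sq (\<lambda>\<omega>. ?S n \<omega> - Y \<omega>)
        \<le> ennreal (3 * (interp_const t + ?G + t * (onorm ((*v) A))\<^sup>2 * (t * ?G)) * ?h n)" .
    qed
  qed (rule Y)
  then show "\<exists>Y. has_ito_integral M F W (\<lambda>s \<omega>. C *v sde_solution s \<omega>) t Y \<and>
       (AE \<omega> in M. sde_solution t \<omega> = x0 + (LINT s:{0..t}|lborel. A *v sde_solution s \<omega>) + Y \<omega>)"
    by (intro exI[of _ Y] conjI) (auto simp: Y_def)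
qed

end

section \<open>Second moments and mean-square stability\<close>

text \<open>Young's inequality, with a free weight \<open>r\<close>.\<close>

lemma quadratic_difference_le:
  fixes x z :: "real^'n" and P :: "real^'n^'n"
  assumes r: "1 \<le> r"
  shows "\<bar>x \<bullet> (P *v x) - z \<bullet> (P *v z)\<bar> \<le> onorm ((*v) P) * (2 * r * (norm (x - z))\<^sup>2 + (norm z)\<^sup>2 / r)"
proof -
  let ?d = "x - z" and ?p = "onorm ((*v) P)"
  have p: "0 \<le> ?p" by (rule onorm_pos_le[OF matrix_vector_mul_bounded_linear])
  have "x \<bullet> (P *v x) - z \<bullet> (P *v z) = ?d \<bullet> (P *v ?d) + ?d \<bullet> (P *v z) + z \<bullet> (P *v ?d)"
    by (simp add: matrix_vector_mult_diff_distrib inner_diff_left inner_diff_right)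
  also have "\<bar>\<dots>\<bar> \<le> ?p * (norm ?d * norm ?d) + ?p * (norm ?d * norm z) + ?p * (norm z * norm ?d)"
    using abs_inner_matrix_le[of ?d P ?d] abs_inner_matrix_le[of ?d P z] abs_inner_matrix_le[of z P
        ?d] by linarith
  also have "\<dots> = ?p * ((norm ?d)\<^sup>2 + 2 * (norm ?d * norm z))"
    by (simp add: power2_eq_square algebra_simps)
  also have "\<dots> \<le> ?p * (2 * r * (norm ?d)\<^sup>2 + (norm z)\<^sup>2 / r)"
  proof (intro mult_left_mono p)
    have "0 \<le> (r * norm ?d - norm z)\<^sup>2 / r" using r by simp
    also have "\<dots> = r * (norm ?d)\<^sup>2 + (norm z)\<^sup>2 / r - 2 * (norm ?d * norm z)"
      using r by (simp add: power2_eq_square field_simps)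
    finally have "2 * (norm ?d * norm z) \<le> r * (norm ?d)\<^sup>2 + (norm z)\<^sup>2 / r" by simp
    moreover have "(norm ?d)\<^sup>2 \<le> r * (norm ?d)\<^sup>2" using mult_right_mono[OF r, of "(norm ?d)\<^sup>2"] by simp
    ultimately show "(norm ?d)\<^sup>2 + 2 * (norm ?d * norm z) \<le> 2 * r * (norm ?d)\<^sup>2 + (norm z)\<^sup>2 / r"
      by simp
  qed
  finally show ?thesis .
qed

context brownian_setting
begin

lemma integrable_quadratic:
  fixes Z :: "'w \<Rightarrow> real^'n" and P :: "real^'n^'n"
  assumes [measurable]: "Z \<in> borel_measurable M" and i: "integrable M (\<lambda>\<omega>. (norm (Z \<omega>))\<^sup>2)"
  shows "integrable M (\<lambda>\<omega>. Z \<omega> \<bullet> (P *v Z \<omega>))"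
proof (rule Bochner_Integration.integrable_bound)
  show "integrable M (\<lambda>\<omega>. onorm ((*v) P) * (norm (Z \<omega>))\<^sup>2)" using i by simp
  have "(\<lambda>\<omega>. P *v Z \<omega>) \<in> borel_measurable M"
    by (intro borel_measurable_continuous_on[OF matrix_vector_mult_linear_continuous_on]) measurable
  then show "(\<lambda>\<omega>. Z \<omega> \<bullet> (P *v Z \<omega>)) \<in> borel_measurable M" by measurable
qed (auto intro!: AE_I2 order_trans[OF form_upper_bound])

text \<open>The weight \<open>r = n + 1\<close> in Young's inequality balances an error of order \<open>1 / n\<^sup>2\<close> in mean square
  against a bounded second moment.\<close>

lemma quadratic_expectation_tendsto:
  fixes X :: "'w \<Rightarrow> real^'n" and Z :: "nat \<Rightarrow> 'w \<Rightarrow> real^'n" and P :: "real^'n^'n"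
  assumes X[measurable]: "X \<in> borel_measurable M" and Z[measurable]: "\<And>n. Z n \<in> borel_measurable M"
    and Zi: "\<And>n. integrable M (\<lambda>\<omega>. (norm (Z n \<omega>))\<^sup>2)"
    and Zm: "\<And>n. sq_mean (Z n) \<le> m"
    and K: "0 \<le> K" and d: "\<And>n. mean_sq (\<lambda>\<omega>. X \<omega> - Z n \<omega>) \<le> ennreal (K / (real (Suc n))\<^sup>2)"
  shows "integrable M (\<lambda>\<omega>. (norm (X \<omega>))\<^sup>2)"
    and "(\<lambda>n. quad_mean P (Z n)) \<longlonglongrightarrow> quad_mean P X"
proof -
  have Di: "integrable M (\<lambda>\<omega>. (norm (X \<omega> - Z n \<omega>))\<^sup>2)" for n
    using le_less_trans[OF d[of n] ennreal_less_top] unfolding mean_sq_def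
    by (intro integrableI_nonneg) auto
  have De: "expectation (\<lambda>\<omega>. (norm (X \<omega> - Z n \<omega>))\<^sup>2) \<le> K / (real (Suc n))\<^sup>2" for n
  proof -
    have "ennreal (expectation (\<lambda>\<omega>. (norm (X \<omega> - Z n \<omega>))\<^sup>2)) \<le> ennreal (K / (real (Suc n))\<^sup>2)"
      using d[of n] nn_integral_eq_integral[OF Di[of n]] unfolding mean_sq_def by simp
    then show ?thesis using K by (subst (asm) ennreal_le_iff) auto
  qed
  show Xi: "integrable M (\<lambda>\<omega>. (norm (X \<omega>))\<^sup>2)"
  proof (rule Bochner_Integration.integrable_bound)
    show "integrable M (\<lambda>\<omega>. 2 * (norm (X \<omega> - Z 0 \<omega>))\<^sup>2 + 2 * (norm (Z 0 \<omega>))\<^sup>2)"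
      using Di[of 0] Zi[of 0] by simp
    show "AE \<omega> in M. norm ((norm (X \<omega>))\<^sup>2) \<le> norm (2 * (norm (X \<omega> - Z 0 \<omega>))\<^sup>2 + 2 * (norm (Z 0 \<omega>))\<^sup>2)"
    proof (rule AE_I2)
      fix \<omega>
      show "norm ((norm (X \<omega>))\<^sup>2) \<le> norm (2 * (norm (X \<omega> - Z 0 \<omega>))\<^sup>2 + 2 * (norm (Z 0 \<omega>))\<^sup>2)"
        using norm_add_power2_le[of "X \<omega> - Z 0 \<omega>" "Z 0 \<omega>"] by simp
    qed
  qed measurable
  let ?p = "onorm ((*v) P)"
  have p: "0 \<le> ?p" by (rule onorm_pos_le[OF matrix_vector_mul_bounded_linear])
  have bound: "\<bar>quad_mean P (Z n) - quad_mean P X\<bar>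
      \<le> ?p * (2 * K + m) * inverse (real (Suc n))" for n
  proof -
    let ?r = "real (Suc n)"
    have "\<bar>quad_mean P X - quad_mean P (Z n)\<bar>
        = \<bar>expectation (\<lambda>\<omega>. X \<omega> \<bullet> (P *v X \<omega>) - Z n \<omega> \<bullet> (P *v Z n \<omega>))\<bar>"
      by (simp add: integrable_quadratic Xi Zi)
    also have "\<dots> \<le> expectation (\<lambda>\<omega>. \<bar>X \<omega> \<bullet> (P *v X \<omega>) - Z n \<omega> \<bullet> (P *v Z n \<omega>)\<bar>)"
      by (rule integral_abs_bound)
    also have "\<dots> \<le> expectation (\<lambda>\<omega>. ?p * (2 * ?r * (norm (X \<omega> - Z n \<omega>))\<^sup>2 + (norm (Z n \<omega>))\<^sup>2 / ?r))"
      using Di[of n] Zi[of n] Xi by (intro integral_mono quadratic_difference_le) (auto simp: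
          integrable_quadratic)
    also have "\<dots> = ?p * (2 * ?r * expectation (\<lambda>\<omega>. (norm (X \<omega> - Z n \<omega>))\<^sup>2) + sq_mean (Z n) / ?r)"
      using Di[of n] Zi[of n] by simp
    also have "\<dots> \<le> ?p * (2 * ?r * (K / ?r\<^sup>2) + m / ?r)"
      by (intro mult_left_mono add_mono De divide_right_mono Zm p) auto
    also have "\<dots> = ?p * (2 * K + m) * inverse ?r"
    proof -
      have "?p * (2 * r * (K / r\<^sup>2) + m / r) = ?p * (2 * K + m) * inverse r" if "0 < r" for r
        using that by (simp add: power2_eq_square field_simps)
      then show ?thesis by (simp del: of_nat_Suc)
    qed
    finally show ?thesis by (simp add: abs_minus_commute)
  qed
  have "(\<lambda>n. ?p * (2 * K + m) * inverse (real (Suc n))) \<longlonglongrightarrow> ?p * (2 * K + m) * 0"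
    by (intro tendsto_mult tendsto_const LIMSEQ_inverse_real_of_nat)
  then have lim: "(\<lambda>n. ?p * (2 * K + m) * inverse (real (Suc n))) \<longlonglongrightarrow> 0" by (simp only: mult_zero_right)
  have "(\<lambda>n. quad_mean P (Z n) - quad_mean P X) \<longlonglongrightarrow> 0"
    by (rule Lim_null_comparison[OF _ lim], rule always_eventually)
       (use bound in \<open>unfold real_norm_def, blast\<close>)
  then show "(\<lambda>n. quad_mean P (Z n)) \<longlonglongrightarrow> quad_mean P X"
    by (rule LIM_zero_cancel)
qed

end

context linear_sde
begin

text \<open>Each step multiplies the mean of the form by at most \<open>1 - \<kappa> h\<close>, up to an error of order \<open>h\<^sup>2\<close>.\<close>

lemma euler_quadratic_bound:
  fixes P :: "real^'n^'n"
  assumes h: "0 \<le> h" "h \<le> 1" and \<kappa>: "0 \<le> \<kappa>" "\<kappa> * h \<le> 1" 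
    and le: "\<And>x. x \<bullet> (lyap A C P *v x) \<le> - \<kappa> * (x \<bullet> (P *v x))"
    and k: "real k * h \<le> t"
  shows "quad_mean P (euler h k)
     \<le> (1 - \<kappa> * h) ^ k * (x0 \<bullet> (P *v x0))
        + real k * h\<^sup>2 * (onorm ((*v) P) * (onorm ((*v) A))\<^sup>2 * (exp (growth * t) * (norm x0)\<^sup>2))"
  using k
proof (induction k)
  case 0
  then show ?case by (simp add: prob_space)
next
  case (Suc k)
  let ?z = "euler h k" and ?p = "onorm ((*v) P)" and ?a = "onorm ((*v) A)"
  let ?m = "exp (growth * t) * (norm x0)\<^sup>2"
  let ?B = "?p * ?a\<^sup>2 * ?m"
  let ?f = "\<lambda>k. quad_mean P (euler h k)"
  have kh: "real k * h \<le> t" using Suc.prems h by (simp add: algebra_simps)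
  have p: "0 \<le> ?p" by (rule onorm_pos_le[OF matrix_vector_mul_bounded_linear])
  have zi: "integrable M (\<lambda>\<omega>. (norm (?z \<omega>))\<^sup>2)" using euler_L2_at[OF h(1)] unfolding L2_at_def by blast
  have I: "integrable M (\<lambda>\<omega>. ?z \<omega> \<bullet> (G *v ?z \<omega>))" for G :: "real^'n^'n"
    using euler_integrable_inner[OF h(1), of "mat 1" k G] by simp
  have IA: "integrable M (\<lambda>\<omega>. (A *v ?z \<omega>) \<bullet> (P *v (A *v ?z \<omega>)))"
    using euler_integrable_inner[OF h(1), of A k "P ** A"] by (simp add: matrix_vector_mul_assoc)
  have "quad_mean (lyap A C P) ?z \<le> expectation (\<lambda>\<omega>. - \<kappa> * (?z \<omega> \<bullet> (P *v ?z \<omega>)))"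
    by (intro integral_mono I integrable_mult_right le)
  then have e1: "quad_mean (lyap A C P) ?z \<le> - \<kappa> * ?f k" using I by simp
  have "(A *v x) \<bullet> (P *v (A *v x)) \<le> ?p * ?a\<^sup>2 * (norm x)\<^sup>2" for x
  proof -
    have "(A *v x) \<bullet> (P *v (A *v x)) \<le> ?p * (norm (A *v x))\<^sup>2"
      using form_upper_bound[of "A *v x" P] by simp
    also have "\<dots> \<le> ?p * (?a * norm x)\<^sup>2"
      by (intro mult_left_mono power_mono onorm matrix_vector_mul_bounded_linear p) auto
    finally show ?thesis by (simp add: power_mult_distrib mult_ac)
  qed
  then have "expectation (\<lambda>\<omega>. (A *v ?z \<omega>) \<bullet> (P *v (A *v ?z \<omega>)))
      \<le> expectation (\<lambda>\<omega>. ?p * ?a\<^sup>2 * (norm (?z \<omega>))\<^sup>2)"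
    by (intro integral_mono IA integrable_mult_right zi)
  also have "\<dots> = ?p * ?a\<^sup>2 * sq_mean ?z" by simp
  also have "\<dots> \<le> ?p * ?a\<^sup>2 * ?m"
  proof (intro mult_left_mono)
    have "sq_mean ?z \<le> exp (growth * (real k * h)) * (norm x0)\<^sup>2"
      by (rule euler_second_moment[OF h])
    also have "\<dots> \<le> ?m" using kh growth_nonneg by (intro mult_right_mono) (auto intro: mult_left_mono)
    finally show "sq_mean ?z \<le> ?m" .
  qed (use p in auto)
  finally have e2: "expectation (\<lambda>\<omega>. (A *v ?z \<omega>) \<bullet> (P *v (A *v ?z \<omega>))) \<le> ?B" .
  have "?f (Suc k) \<le> ?f k + h * (- \<kappa> * ?f k) + h\<^sup>2 * ?B"
    unfolding euler_quadratic_recursion[OF h(1)]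
    by (intro add_mono mult_left_mono e1 e2 h order_refl) auto
  also have "\<dots> = (1 - \<kappa> * h) * ?f k + h\<^sup>2 * ?B" by (simp add: algebra_simps)
  also have "\<dots> \<le> (1 - \<kappa> * h) * ((1 - \<kappa> * h) ^ k * (x0 \<bullet> (P *v x0)) + real k * h\<^sup>2 * ?B) + h\<^sup>2 * ?B"
    using \<kappa> by (intro add_right_mono mult_left_mono Suc.IH kh) auto
  also have "\<dots> \<le> (1 - \<kappa> * h) ^ Suc k * (x0 \<bullet> (P *v x0)) + real (Suc k) * h\<^sup>2 * ?B"
  proof -
    have "(1 - \<kappa> * h) * (real k * h\<^sup>2 * ?B) \<le> 1 * (real k * h\<^sup>2 * ?B)"
      using \<kappa> h p by (intro mult_right_mono) auto
    then show ?thesis by (simp add: algebra_simps)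
  qed
  finally show ?case .
qed

text \<open>The bound for the Euler scheme with \<open>N\<close> steps of length \<open>t / N\<close> tends to the claim as \<open>N\<close> grows.\<close>

lemma solution_quadratic_bound:
  fixes P :: "real^'n^'n"
  assumes X: "approximate_solution t X X" and t: "0 < t" and \<kappa>: "0 \<le> \<kappa>"
    and le: "\<And>x. x \<bullet> (lyap A C P *v x) \<le> - \<kappa> * (x \<bullet> (P *v x))"
  shows "integrable M (\<lambda>\<omega>. (norm (X t \<omega>))\<^sup>2)"
    and "quad_mean P (X t) \<le> exp (- \<kappa> * t) * (x0 \<bullet> (P *v x0))"
proof -
  obtain m :: nat where m: "1 + t + \<kappa> * t \<le> real m" using real_arch_simple by blast
  have "0 \<le> \<kappa> * t" using t \<kappa> by simp
  then have m1: "1 \<le> real m" "t \<le> real m" "\<kappa> * t \<le> real m" using m t by linarith+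
  \<comment> \<open>the factor \<open>m\<close> makes all steps short enough for \<open>euler_quadratic_bound\<close>; the square gives the
      rate for \<open>quadratic_expectation_tendsto\<close>\<close>
  define N where "N n = (m * Suc n)\<^sup>2" for n
  define h where "h n = t / real (N n)" for n
  have N: "real m \<le> real (N n)" "(real (Suc n))\<^sup>2 \<le> real (N n)" "0 < real (N n)" for n
  proof -
    have "1 * (real (Suc n))\<^sup>2 \<le> (real m)\<^sup>2 * (real (Suc n))\<^sup>2"
      using m1 by (intro mult_right_mono) (auto simp: one_le_power)
    then show "(real (Suc n))\<^sup>2 \<le> real (N n)"
      by (simp only: N_def of_nat_power of_nat_mult power_mult_distrib mult_1)
    have "real m * 1 \<le> (real m * real m) * (real (Suc n))\<^sup>2"
      using m1 by (intro mult_mono) (auto simp: one_le_power)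
    then show "real m \<le> real (N n)"
      by (simp only: N_def of_nat_power of_nat_mult power2_eq_square mult_1_right mult_ac)
    then show "0 < real (N n)" using m1 by linarith
  qed
  have h: "0 < h n" "h n \<le> 1" "\<kappa> * h n \<le> 1" "real (N n) * h n = t" for n
    using N(1,3)[of n] m1 t \<kappa> by (auto simp: h_def divide_le_eq)
  have fl: "nat \<lfloor>t / h n\<rfloor> = N n" for n
    using h(1,4)[of n] by (intro nat_floor_divide_unique) (auto simp: algebra_simps)
  then have st: "euler_step (h n) t = euler (h n) (N n)" for n by (simp add: euler_step_def)
  have Zi: "integrable M (\<lambda>\<omega>. (norm (euler_step (h n) t \<omega>))\<^sup>2)" for n
    using euler_L2_at[of "h n" "N n"] h(1)[of n] unfolding st L2_at_def by simp
  have Zm: "sq_mean (euler_step (h n) t) \<le> exp (growth * t) * (norm x0)\<^sup>2" for n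
    using euler_second_moment[of "h n" "N n"] h[of n] unfolding st by simp
  have d: "mean_sq (\<lambda>\<omega>. X t \<omega> - euler_step (h n) t \<omega>) \<le> ennreal (euler_const t * t / (real (Suc
      n))\<^sup>2)" for n
  proof -
    have "mean_sq (\<lambda>\<omega>. X t \<omega> - euler_step (h n) t \<omega>) \<le> ennreal (euler_const t * h n)"
      using t by (intro solution_euler_step_distance[OF X] h) auto
    also have "\<dots> \<le> ennreal (euler_const t * (t / (real (Suc n))\<^sup>2))"
      unfolding h_def using t N(2,3)[of n] euler_const_nonneg[of t]
      by (intro ennreal_leI mult_left_mono divide_left_mono) auto
    finally show ?thesis by simp
  qed
  have Xm: "X t \<in> borel_measurable M"
    using X t unfolding approximate_solution_def by auto
  have Zme: "euler_step (h n) t \<in> borel_measurable M" for n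
    using euler_step_measurable[of "h n" t] h[of n] t by simp
  have K: "0 \<le> euler_const t * t" using euler_const_nonneg[of t] t by simp
  note lim = quadratic_expectation_tendsto[OF Xm Zme Zi Zm K d]
  show "integrable M (\<lambda>\<omega>. (norm (X t \<omega>))\<^sup>2)" by (rule lim(1))
  let ?B = "onorm ((*v) P) * (onorm ((*v) A))\<^sup>2 * (exp (growth * t) * (norm x0)\<^sup>2)"
  have bound: "quad_mean P (euler_step (h n) t)
     \<le> (1 + (- \<kappa> * t) / real (N n)) ^ N n * (x0 \<bullet> (P *v x0)) + t\<^sup>2 * ?B / real (N n)" for n
  proof -
    have "quad_mean P (euler_step (h n) t)
      \<le> (1 - \<kappa> * h n) ^ N n * (x0 \<bullet> (P *v x0)) + real (N n) * (h n)\<^sup>2 * ?B"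
      unfolding st using h[of n] by (intro euler_quadratic_bound \<kappa> le) auto
    also have "real (N n) * (h n)\<^sup>2 * ?B = t\<^sup>2 * ?B / real (N n)"
      using N(3)[of n] by (simp add: h_def power2_eq_square)
    also have "1 - \<kappa> * h n = 1 + (- \<kappa> * t) / real (N n)" by (simp add: h_def)
    finally show ?thesis .
  qed
  have Nlim: "filterlim N at_top sequentially"
  proof (rule filterlim_at_top_mono[OF filterlim_ident])
    show "\<forall>\<^sub>F n in sequentially. n \<le> N n"
    proof (rule always_eventually, rule allI)
      fix n
      have "real n \<le> (real (Suc n))\<^sup>2" by (simp add: power2_eq_square algebra_simps)
      then show "n \<le> N n" using N(2)[of n] by linarith
    qed
  qed
  have "(\<lambda>n. (1 + (- \<kappa> * t) / real (N n)) ^ N n * (x0 \<bullet> (P *v x0)) + t\<^sup>2 * ?B / real (N n))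
      \<longlonglongrightarrow> exp (- \<kappa> * t) * (x0 \<bullet> (P *v x0)) + 0"
  proof (intro tendsto_add tendsto_mult tendsto_const)
    show "(\<lambda>n. (1 + (- \<kappa> * t) / real (N n)) ^ N n) \<longlonglongrightarrow> exp (- \<kappa> * t)"
      by (rule filterlim_compose[OF tendsto_exp_limit_sequentially Nlim])
    show "(\<lambda>n. t\<^sup>2 * ?B / real (N n)) \<longlonglongrightarrow> 0"
      by (intro real_tendsto_divide_at_top[OF tendsto_const] filterlim_compose[OF
          filterlim_real_sequentially Nlim])
  qed
  from lim(2) this
  have "quad_mean P (X t) \<le> exp (- \<kappa> * t) * (x0 \<bullet> (P *v x0)) + 0"
    by (rule LIMSEQ_le) (intro exI[of _ 0] allI impI bound)
  then show "quad_mean P (X t) \<le> exp (- \<kappa> * t) * (x0 \<bullet> (P *v x0))"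
    by (simp only: add_0_right)
qed

lemma solution_decays:
  assumes X: "\<And>t. approximate_solution t X X" and st: "lyapunov_stable A C"
  shows "((\<lambda>s. expectation (\<lambda>\<omega>. X s \<omega> \<bullet> X s \<omega>)) \<longlongrightarrow> 0) at_top"
proof -
  obtain P where P: "sym_mat P" "\<And>x. x \<noteq> 0 \<Longrightarrow> 0 < x \<bullet> (P *v x)"
    and neg: "\<And>x. x \<noteq> 0 \<Longrightarrow> x \<bullet> (lyap A C P *v x) < 0"
    using st unfolding lyapunov_stable_def pos_def_def by blast
  obtain \<mu> where \<mu>: "0 < \<mu>" "\<And>x. \<mu> * (norm x)\<^sup>2 \<le> x \<bullet> (P *v x)"
    using positive_form_lower_bound[of P] P(2) by blast
  have lneg: "(- lyap A C P) *v x = - (lyap A C P *v x)" for x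
    using matrix_vector_mult_scaleR_left[of "-1" "lyap A C P" x] by simp
  obtain \<nu> where \<nu>: "0 < \<nu>" "\<And>x. \<nu> * (norm x)\<^sup>2 \<le> x \<bullet> ((- lyap A C P) *v x)"
    using positive_form_lower_bound[of "- lyap A C P"] neg unfolding lneg by force
  let ?p = "onorm ((*v) P) + 1"
  have p: "0 < ?p" using onorm_pos_le[OF matrix_vector_mul_bounded_linear, of P] by linarith
  \<comment> \<open>chosen such that \<open>\<kappa> P \<le> \<nu> I \<le> - lyap A C P\<close>\<close>
  define \<kappa> where "\<kappa> = \<nu> / ?p"
  have \<kappa>: "0 < \<kappa>" using \<nu> p by (simp add: \<kappa>_def)
  have le: "x \<bullet> (lyap A C P *v x) \<le> - \<kappa> * (x \<bullet> (P *v x))" for x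
  proof -
    have "x \<bullet> (P *v x) \<le> ?p * (norm x)\<^sup>2"
    proof -
      have "x \<bullet> (P *v x) \<le> onorm ((*v) P) * (norm x)\<^sup>2"
        using form_upper_bound[of x P] by simp
      also have "\<dots> \<le> ?p * (norm x)\<^sup>2" by (intro mult_right_mono) auto
      finally show ?thesis .
    qed
    then have "\<kappa> * (x \<bullet> (P *v x)) \<le> \<kappa> * (?p * (norm x)\<^sup>2)" using \<kappa> by (intro mult_left_mono) auto
    also have "\<dots> = \<nu> * (norm x)\<^sup>2" using p by (simp add: \<kappa>_def)
    also have "\<dots> \<le> - (x \<bullet> (lyap A C P *v x))" using \<nu>(2)[of x] by (simp add: lneg)
    finally show ?thesis by simp
  qed
  let ?E = "\<lambda>s. expectation (\<lambda>\<omega>. X s \<omega> \<bullet> X s \<omega>)"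
  have bound: "?E s \<le> (x0 \<bullet> (P *v x0)) / \<mu> * exp (- \<kappa> * s)" if s: "0 < s" for s
  proof -
    have i: "integrable M (\<lambda>\<omega>. (norm (X s \<omega>))\<^sup>2)"
      using solution_quadratic_bound(1)[OF X s, of \<kappa> P] \<kappa> le by simp
    have m: "X s \<in> borel_measurable M"
      using X[of s] s unfolding approximate_solution_def by auto
    have "\<mu> * ?E s = expectation (\<lambda>\<omega>. \<mu> * (norm (X s \<omega>))\<^sup>2)" by (simp add: power2_norm_eq_inner)
    also have "\<dots> \<le> quad_mean P (X s)"
      by (intro integral_mono integrable_mult_right i integrable_quadratic m \<mu>)
    also have "\<dots> \<le> exp (- \<kappa> * s) * (x0 \<bullet> (P *v x0))"
      using \<kappa> by (intro solution_quadratic_bound(2)[OF X s] le) auto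
    finally show ?thesis using \<mu>(1) by (simp add: field_simps)
  qed
  have lim: "((\<lambda>s. (x0 \<bullet> (P *v x0)) / \<mu> * exp (- \<kappa> * s)) \<longlongrightarrow> (x0 \<bullet> (P *v x0)) / \<mu> * 0) at_top"
  proof (intro tendsto_mult tendsto_const)
    have "filterlim (\<lambda>s. - \<kappa> * s) at_bot at_top"
      using \<kappa> by (intro filterlim_tendsto_neg_mult_at_bot[OF tendsto_const] filterlim_ident) auto
    then show "((\<lambda>s. exp (- \<kappa> * s)) \<longlongrightarrow> 0) at_top" by (rule filterlim_compose[OF exp_at_bot])
  qed
  have upper: "\<forall>\<^sub>F s in at_top. ?E s \<le> (x0 \<bullet> (P *v x0)) / \<mu> * exp (- \<kappa> * s)"
    using eventually_gt_at_top[of 0] by (rule eventually_mono) (rule bound)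
  have lower: "\<forall>\<^sub>F s in at_top. 0 \<le> ?E s"
    by (intro always_eventually allI Bochner_Integration.integral_nonneg) simp
  show ?thesis
    by (rule tendsto_sandwich[OF lower upper tendsto_const lim[unfolded mult_zero_right]])
qed

text \<open>The mean of \<open>X \<bullet> P X\<close> tends to \<open>0\<close> and never exceeds its initial value.\<close>

lemma semidefinite_if_solution_decays:
  assumes X: "\<And>t. approximate_solution t X X"
    and decay: "((\<lambda>s. expectation (\<lambda>\<omega>. X s \<omega> \<bullet> X s \<omega>)) \<longlongrightarrow> 0) at_top"
    and le: "\<And>x. x \<bullet> (lyap A C P *v x) \<le> 0"
  shows "0 \<le> x0 \<bullet> (P *v x0)"
proof -
  let ?E = "\<lambda>s. expectation (\<lambda>\<omega>. X s \<omega> \<bullet> X s \<omega>)" and ?q = "\<lambda>s. quad_mean P (X s)"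
  have "\<bar>?q s\<bar> \<le> onorm ((*v) P) * ?E s" if s: "0 < s" for s
  proof -
    have i: "integrable M (\<lambda>\<omega>. (norm (X s \<omega>))\<^sup>2)"
      using solution_quadratic_bound(1)[OF X s, of 0 P] le by simp
    have m: "X s \<in> borel_measurable M"
      using X[of s] s unfolding approximate_solution_def by auto
    have "\<bar>?q s\<bar> \<le> expectation (\<lambda>\<omega>. \<bar>X s \<omega> \<bullet> (P *v X s \<omega>)\<bar>)" by (rule integral_abs_bound)
    also have "\<dots> \<le> expectation (\<lambda>\<omega>. onorm ((*v) P) * (norm (X s \<omega>))\<^sup>2)"
      by (intro integral_mono integrable_abs integrable_quadratic integrable_mult_right i m
          form_upper_bound)
    finally show ?thesis by (simp add: power2_norm_eq_inner)
  qed
  then have "(?q \<longlongrightarrow> 0) at_top"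
    by (intro Lim_null_comparison[OF _ tendsto_mult_right_zero[OF decay, of "onorm ((*v) P)"]])
       (auto intro: eventually_mono[OF eventually_gt_at_top[of 0]])
  moreover have "?q s \<le> x0 \<bullet> (P *v x0)" if "0 < s" for s
    using solution_quadratic_bound(2)[OF X that, of 0 P] le by simp
  ultimately show ?thesis
    by (intro tendsto_upperbound[of ?q 0 at_top])
       (auto intro: eventually_mono[OF eventually_gt_at_top[of 0]])
qed

end

context brownian_setting
begin

lemma closed_loop_solution:
  "system_solution M F W A B1 B2 C D (\<lambda>s \<omega>. Lu *v X s \<omega>) (\<lambda>s \<omega>. Lv *v X s \<omega>) x0 X
    \<longleftrightarrow> (\<forall>T. linear_sde.approximate_solution M F W (A + B1 ** Lu + B2 ** Lv) (C + D ** Lu) x0 T X X)"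
proof -
  interpret S: linear_sde M F W "A + B1 ** Lu + B2 ** Lv" "C + D ** Lu" x0 by unfold_locales
  have e: "A *v x + B1 *v (Lu *v x) + B2 *v (Lv *v x) = (A + B1 ** Lu + B2 ** Lv) *v x"
    "C *v x + D *v (Lu *v x) = (C + D ** Lu) *v x" for x
    by (simp_all add: matrix_vector_mult_add_rdistrib matrix_vector_mul_assoc)
  have L: "L2_process M F (\<lambda>s \<omega>. G *v X s \<omega>)" if "L2_process M F X" for G :: "real^'a^'k"
    by (rule L2_process_linear[OF matrix_vector_mul_bounded_linear that])
  have m: "X t \<in> borel_measurable M" if "L2_process M F X" "0 \<le> t" for t
    using jointly_measurable_at[OF L2_process_jointly_measurable[OF that], of t] that by simp
  let ?Q = "\<lambda>t. \<exists>Y. has_ito_integral M F W (\<lambda>s \<omega>. (C + D ** Lu) *v X s \<omega>) t Y \<and>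
     (AE \<omega> in M. X t \<omega> = x0 + (LINT s:{0..t}|lborel. (A + B1 ** Lu + B2 ** Lv) *v X s \<omega>) + Y \<omega>)"
  have "(L2_process M F X \<and> L2_process M F (\<lambda>s \<omega>. Lu *v X s \<omega>) \<and> L2_process M F (\<lambda>s \<omega>. Lv *v X s \<omega>)
       \<and> (\<forall>t\<ge>0. ?Q t))
     \<longleftrightarrow> (\<forall>T. L2_process M F X \<and> (\<forall>t\<in>{0..T}. X t \<in> borel_measurable M \<and> ?Q t))" (is "?l \<longleftrightarrow> ?r")
  proof
    assume l: ?l
    then have X: "L2_process M F X" and Q: "\<And>t. 0 \<le> t \<Longrightarrow> ?Q t" by blast+
    show ?r
    proof (intro allI conjI ballI)
      fix T t :: real assume "t \<in> {0..T}"
      then have t: "0 \<le> t" by simp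
      show "X t \<in> borel_measurable M" by (rule m[OF X t])
      show "?Q t" by (rule Q[OF t])
    qed (rule X)
  next
    assume r: ?r
    then have X: "L2_process M F X" by blast
    have "?Q t" if "0 \<le> t" for t
    proof -
      have "t \<in> {0..t}" using that by simp
      then show ?thesis using r by blast
    qed
    then show ?l using X L[OF X, of Lu] L[OF X, of Lv] by blast
  qed
  then show ?thesis
    unfolding system_solution_def S.approximate_solution_def e .
qed

text \<open>If all closed-loop solutions decay, \<open>semidefinite_if_solution_decays\<close> applied to \<open>P\<close> and \<open>- P\<close>
  shows that \<open>lyap\<close> is injective on symmetric matrices; so \<open>lyap P = - I\<close> has a solution, which is
  positive definite.\<close>

theorem stabilizer_iff_lyapunov_stable:
  "stabilizer M F W A B1 B2 C D Lu Lv \<longleftrightarrow> lyapunov_stable (A + B1 ** Lu + B2 ** Lv) (C + D ** Lu)"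
    (is "?L \<longleftrightarrow> lyapunov_stable ?A ?C")
proof
  assume "lyapunov_stable ?A ?C"
  then show ?L
    unfolding stabilizer_def closed_loop_solution
    using linear_sde.solution_decays[OF linear_sde.intro[OF brownian_setting_axioms]] by blast
next
  assume L: ?L
  have psd: "0 \<le> x0 \<bullet> (P *v x0)" if "\<And>x. x \<bullet> (lyap ?A ?C P *v x) \<le> 0" for P x0
  proof -
    interpret S: linear_sde M F W ?A ?C x0 by unfold_locales
    show ?thesis
      using L S.sde_solution_is_solution that
      unfolding stabilizer_def closed_loop_solution
      by (intro S.semidefinite_if_solution_decays[of S.sde_solution]) auto
  qed
  have "P = 0" if P: "sym_mat P" "lyap ?A ?C P = 0" for P
  proof (rule sym_mat_eq_0[OF P(1)])
    fix x
    have "lyap ?A ?C ((-1) *\<^sub>R P) = 0" unfolding lyap_linear using P(2) by simp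
    then have "0 \<le> x \<bullet> (((-1) *\<^sub>R P) *v x)" by (intro psd) simp
    then have "x \<bullet> (P *v x) \<le> 0" unfolding matrix_vector_mult_scaleR_left by simp
    moreover have "0 \<le> x \<bullet> (P *v x)" using P(2) by (intro psd) simp
    ultimately show "x \<bullet> (P *v x) = 0" by simp
  qed
  then obtain P where P: "sym_mat P" "lyap ?A ?C P = (-1) *\<^sub>R mat 1"
    using lyap_solvable[OF _ sym_mat_scaleR[OF sym_mat_mat1]] by blast
  have neg: "x \<bullet> (lyap ?A ?C P *v x) = - (norm x)\<^sup>2" for x
    unfolding P(2) matrix_vector_mult_scaleR_left by (simp add: power2_norm_eq_inner)
  have "pos_def P"
    by (rule positive_definite_if_lyap_negative[OF P(1), of ?A ?C]) (auto simp: neg intro!: psd)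
  then show "lyapunov_stable ?A ?C"
    unfolding lyapunov_stable_def by (intro exI[of _ P]) (auto simp: neg)
qed

end

section \<open>Norms of matrices\<close>

lemma norm_matrix_vector_mult_le: "norm ((G::real^'n^'m) *v x) \<le> norm G * norm x"
proof -
  have "norm (G *v x) = L2_set (\<lambda>i. norm ((G *v x) $ i)) UNIV" by (simp add: norm_vec_def)
  also have "\<dots> \<le> L2_set (\<lambda>i. norm (G $ i) * norm x) UNIV"
    by (intro L2_set_mono) (auto simp: matrix_vector_mul_component Cauchy_Schwarz_ineq2)
  also have "\<dots> = norm G * norm x" by (simp add: L2_set_left_distrib norm_vec_def[of G])
  finally show ?thesis .
qed

lemma norm_matrix_mult_le:
  fixes G :: "real^'n^'m" and H :: "real^'k^'n"
  shows "norm (G ** H) \<le> norm G * norm H"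
proof -
  have row: "(G ** H) $ i = (\<Sum>k\<in>UNIV. (G $ i $ k) *\<^sub>R (H $ k))" for i
    by (simp add: vec_eq_iff matrix_matrix_mult_def)
  have "norm ((G ** H) $ i) \<le> norm (G $ i) * norm H" for i
  proof -
    have "norm ((G ** H) $ i) \<le> (\<Sum>k\<in>UNIV. norm ((G $ i $ k) *\<^sub>R (H $ k)))"
      unfolding row by (rule norm_sum)
    also have "\<dots> = (\<Sum>k\<in>UNIV. \<bar>G $ i $ k\<bar> * \<bar>norm (H $ k)\<bar>)" by simp
    also have "\<dots> \<le> L2_set (\<lambda>k. G $ i $ k) UNIV * L2_set (\<lambda>k. norm (H $ k)) UNIV"
      by (rule L2_set_mult_ineq)
    also have "\<dots> = norm (G $ i) * norm H" by (simp add: norm_vec_def L2_set_def)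
    finally show ?thesis .
  qed
  then have "L2_set (\<lambda>i. norm ((G ** H) $ i)) UNIV \<le> L2_set (\<lambda>i. norm (G $ i) * norm H) UNIV"
    by (intro L2_set_mono) auto
  then show ?thesis by (simp add: L2_set_left_distrib norm_vec_def[of G] norm_vec_def[of "G ** H"])
qed

lemma bounded_bilinear_matrix_mult: "bounded_bilinear (\<lambda>(G::real^'n^'m) (H::real^'k^'n). G ** H)"
proof
  fix G G' :: "real^'n^'m" and H H' :: "real^'k^'n" and r :: real
  show "(G + G') ** H = G ** H + G' ** H"
    by (simp add: vec_eq_iff matrix_matrix_mult_def algebra_simps sum.distrib)
  show "G ** (H + H') = G ** H + G ** H'" by (rule matrix_add_ldistrib)
  show "r *\<^sub>R G ** H = r *\<^sub>R (G ** H)"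
    by (simp add: vec_eq_iff matrix_matrix_mult_def sum_distrib_left mult_ac)
  show "G ** r *\<^sub>R H = r *\<^sub>R (G ** H)"
    by (simp add: vec_eq_iff matrix_matrix_mult_def sum_distrib_left mult_ac)
  show "\<exists>K. \<forall>(G::real^'n^'m) (H::real^'k^'n). norm (G ** H) \<le> norm G * norm H * K"
    using norm_matrix_mult_le by (intro exI[of _ 1]) auto
qed

lemmas tendsto_matrix_mult = bounded_bilinear.tendsto[OF bounded_bilinear_matrix_mult]
lemmas matrix_mult_diff_left = bounded_bilinear.diff_left[OF bounded_bilinear_matrix_mult]
lemmas matrix_mult_diff_right = bounded_bilinear.diff_right[OF bounded_bilinear_matrix_mult]
lemmas matrix_mult_minus_right = bounded_bilinear.minus_right[OF bounded_bilinear_matrix_mult]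

lemma tendsto_transpose: "(f \<longlongrightarrow> G) F \<Longrightarrow> ((\<lambda>x. transpose (f x)) \<longlongrightarrow> transpose (G::real^'n^'m)) F"
  unfolding transpose_def by (intro tendsto_vec_lambda tendsto_vec_nth)

lemma form_le_norm: "\<bar>x \<bullet> ((N::real^'n^'n) *v x)\<bar> \<le> norm N * (norm x)\<^sup>2"
proof -
  have "\<bar>x \<bullet> (N *v x)\<bar> \<le> norm x * norm (N *v x)" by (rule Cauchy_Schwarz_ineq2)
  also have "\<dots> \<le> norm x * (norm N * norm x)" by (intro mult_left_mono norm_matrix_vector_mult_le) auto
  finally show ?thesis by (simp add: power2_eq_square mult_ac)
qed

lemma sym_mat_entry:
  assumes "sym_mat (Z::real^'n^'n)"
  shows "Z $ i $ j = ((axis i 1 + axis j 1) \<bullet> (Z *v (axis i 1 + axis j 1))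
      - (axis i 1 - axis j 1) \<bullet> (Z *v (axis i 1 - axis j 1))) / 4"
proof -
  have e: "axis k 1 \<bullet> (Z *v axis l 1) = Z $ k $ l" for k l
    by (simp add: inner_axis' matrix_vector_mult_basis column_def)
  have "axis j 1 \<bullet> (Z *v axis i 1) = axis i 1 \<bullet> (Z *v axis j 1)"
    using sym_mat_inner[OF assms, of "axis i 1" "axis j 1"] by (simp add: inner_commute)
  then show ?thesis
    using e[of i j]
    by (simp add: matrix_vector_right_distrib matrix_vector_mult_diff_distrib inner_add_left
        inner_add_right
        inner_diff_left inner_diff_right)
qed

text \<open>The entries are obtained from the form by polarization, and the parallelogram law bounds them by
  \<open>b\<close>.\<close>

lemma sym_mat_norm_le:
  fixes Z :: "real^'n^'n"
  assumes s: "sym_mat Z" and b: "\<And>x. \<bar>x \<bullet> (Z *v x)\<bar> \<le> b * (norm x)\<^sup>2"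
  shows "norm Z \<le> (real CARD('n))\<^sup>2 * b"
proof -
  have "\<bar>Z $ i $ j\<bar> \<le> b" for i j
  proof -
    let ?p = "axis i 1 + axis j 1 :: real^'n" and ?m = "axis i 1 - axis j 1 :: real^'n"
    have par: "(norm ?p)\<^sup>2 + (norm ?m)\<^sup>2 = 4"
      by (simp add: power2_norm_eq_inner inner_add_left inner_add_right inner_diff_left inner_diff_right
          inner_axis_axis)
    have "\<bar>Z $ i $ j\<bar> \<le> (\<bar>?p \<bullet> (Z *v ?p)\<bar> + \<bar>?m \<bullet> (Z *v ?m)\<bar>) / 4"
      unfolding sym_mat_entry[OF s, of i j] by simp
    also have "\<dots> \<le> (b * (norm ?p)\<^sup>2 + b * (norm ?m)\<^sup>2) / 4"
      by (intro divide_right_mono add_mono b) auto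
    also have "\<dots> = b" using par by (simp add: distrib_left[symmetric])
    finally show ?thesis .
  qed
  note entry = this
  have "norm Z \<le> (\<Sum>i\<in>UNIV. norm (Z $ i))"
    unfolding norm_vec_def[of Z] by (intro L2_set_le_sum) auto
  also have "\<dots> \<le> (\<Sum>i\<in>(UNIV::'n set). \<Sum>j\<in>(UNIV::'n set). b)"
    by (intro sum_mono order_trans[OF norm_le_l1_cart] entry)
  also have "\<dots> = (real CARD('n))\<^sup>2 * b" by (simp add: power2_eq_square)
  finally show ?thesis .
qed

lemma matrix_inv_right: "invertible S \<Longrightarrow> S ** matrix_inv S = mat 1"
  and matrix_inv_left: "invertible S \<Longrightarrow> matrix_inv S ** S = mat 1"
  for S :: "real^'m^'m"
  unfolding invertible_def matrix_inv_def by (rule someI2_ex, assumption, simp)+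

lemma matrix_inv_solves:
  fixes S :: "real^'m^'m" and T :: "real^'n^'m"
  assumes "invertible S"
  shows "S ** (matrix_inv S ** T) = T" "matrix_inv S ** (S ** T) = T"
  using matrix_inv_left[OF assms] matrix_inv_right[OF assms]
  by (simp_all add: matrix_mul_assoc)

text \<open>The solutions \<open>X\<close>, \<open>X0\<close> of \<open>S X = T\<close>, \<open>S0 X0 = T0\<close> satisfy
  \<open>S0 (X - X0) = (T - T0) - (S - S0) (X - X0) - (S - S0) X0\<close>; if \<open>S\<close> is close to \<open>S0\<close>, the term
  with \<open>X - X0\<close> on the right is absorbed on the left.\<close>

lemma matrix_inv_mult_lipschitz:
  fixes S0 :: "real^'m^'m" and T0 :: "real^'n^'m"
  assumes inv: "invertible S0"
  shows "\<exists>\<rho>>0. \<exists>c>0. \<forall>S T. norm (S - S0) < \<rho> \<longrightarrow> invertible S \<and>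
    norm (matrix_inv S ** T - matrix_inv S0 ** T0) \<le> c * (norm (S - S0) + norm (T - T0))"
proof -
  define k where "k = norm (matrix_inv S0) + 1"
  have k: "0 < k" "norm (matrix_inv S0) \<le> k" by (auto simp: k_def add_nonneg_pos)
  define X0 where "X0 = matrix_inv S0 ** T0"
  define c where "c = 2 * k * (1 + norm X0)"
  have c: "0 < c" using k by (auto simp: c_def intro!: mult_pos_pos add_pos_nonneg)
  have "invertible S \<and> norm (matrix_inv S ** T - X0) \<le> c * (norm (S - S0) + norm (T - T0))"
    if S: "norm (S - S0) < 1 / (2 * k)" for S T
  proof
    let ?s = "norm (S - S0)"
    have ks: "k * ?s \<le> 1/2" using S k by (simp add: field_simps)
    have "x = 0" if "S *v x = 0" for x
    proof -
      have "x = matrix_inv S0 *v (S0 *v x)"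
        using matrix_inv_left[OF inv] by (simp add: matrix_vector_mul_assoc)
      also have "S0 *v x = - ((S - S0) *v x)"
        using that by (simp add: matrix_vector_mult_diff_rdistrib)
      finally have "norm x = norm (matrix_inv S0 *v (- ((S - S0) *v x)))" by simp
      also have "\<dots> \<le> norm (matrix_inv S0) * norm (- ((S - S0) *v x))"
        by (rule norm_matrix_vector_mult_le)
      also have "\<dots> \<le> k * (?s * norm x)"
        using k norm_matrix_vector_mult_le[of "S - S0" x] by (intro mult_mono) auto
      also have "\<dots> \<le> 1/2 * norm x" using mult_right_mono[OF ks, of "norm x"] by (simp add: mult_ac)
      finally show "x = 0" by simp
    qed
    then show invS: "invertible S"
      unfolding invertible_left_inverse matrix_left_invertible_ker by blast
    let ?X = "matrix_inv S ** T"
    let ?d = "norm (?X - X0)"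
    have "?X - X0 = matrix_inv S0 ** (S0 ** (?X - X0))"
      by (simp add: matrix_inv_solves[OF inv])
    also have "S0 ** (?X - X0) = (T - T0) - (S - S0) ** (?X - X0) - (S - S0) ** X0"
      using matrix_inv_solves(1)[OF invS, of T] matrix_inv_solves(1)[OF inv, of T0]
      by (simp add: X0_def matrix_mult_diff_left matrix_mult_diff_right)
    finally have "?d = norm (matrix_inv S0 ** ((T - T0) - (S - S0) ** (?X - X0) - (S - S0) ** X0))"
      by simp
    also have "\<dots> \<le> norm (matrix_inv S0) * norm ((T - T0) - (S - S0) ** (?X - X0) - (S - S0) ** X0)"
      by (rule norm_matrix_mult_le)
    also have "\<dots> \<le> k * (norm (T - T0) + ?s * ?d + ?s * norm X0)"
    proof (rule mult_mono)
      have "norm ((T - T0) - (S - S0) ** (?X - X0) - (S - S0) ** X0)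
         \<le> norm (T - T0) + norm ((S - S0) ** (?X - X0)) + norm ((S - S0) ** X0)"
        using norm_triangle_ineq4[of "(T - T0) - (S - S0) ** (?X - X0)" "(S - S0) ** X0"]
          norm_triangle_ineq4[of "T - T0" "(S - S0) ** (?X - X0)"] by linarith
      also have "\<dots> \<le> norm (T - T0) + ?s * ?d + ?s * norm X0"
        by (intro add_mono order_refl norm_matrix_mult_le)
      finally show "norm ((T - T0) - (S - S0) ** (?X - X0) - (S - S0) ** X0)
        \<le> norm (T - T0) + ?s * ?d + ?s * norm X0" .
    qed (use k in auto)
    also have "\<dots> = k * norm (T - T0) + (k * ?s) * ?d + k * (?s * norm X0)" by (simp add: algebra_simps)
    also have "\<dots> \<le> k * norm (T - T0) + 1/2 * ?d + k * (?s * norm X0)"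
      by (intro add_mono mult_right_mono ks order_refl) auto
    finally have "?d \<le> 2 * k * (norm (T - T0) + ?s * norm X0)" by (simp add: algebra_simps)
    also have "\<dots> \<le> 2 * k * ((1 + norm X0) * (?s + norm (T - T0)))"
    proof (intro mult_left_mono)
      have "0 \<le> ?s" "0 \<le> norm X0 * norm (T - T0)" by auto
      then show "norm (T - T0) + ?s * norm X0 \<le> (1 + norm X0) * (?s + norm (T - T0))"
        by (simp add: algebra_simps)
    qed (use k in auto)
    finally show "norm (matrix_inv S ** T - X0) \<le> c * (norm (S - S0) + norm (T - T0))"
      by (simp add: c_def mult.assoc)
  qed
  moreover have "0 < 1 / (2 * k)" using k by simp
  ultimately show ?thesis using c unfolding X0_def by blast
qed

section \<open>Policy evaluation and policy improvement\<close>

text \<open>The disturbance player's gain \<open>Lv\<close> is fixed and absorbed: \<open>A\<close> stands for \<open>A + B2 Lv\<close> and \<open>Q\<close> for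
  \<open>Q_v\<close>. What remains is policy iteration for a linear-quadratic problem with control only.\<close>

locale policy_iteration =
  fixes A C Q :: "real^'n^'n" and B D :: "real^'m^'n" and R :: "real^'m^'m"
  assumes R: "pos_def R" and Q: "pos_def Q"
begin

text \<open>The left-hand side of the equation that the cost matrix of the policy \<open>L\<close> satisfies.\<close>

definition residual :: "real^'n^'m \<Rightarrow> real^'n^'n \<Rightarrow> real^'n^'n" where
  "residual L P = lyap (A + B ** L) (C + D ** L) P + (transpose L ** R ** L + Q)"

definition evaluates :: "real^'n^'m \<Rightarrow> real^'n^'n \<Rightarrow> bool" where
  "evaluates L P \<longleftrightarrow> sym_mat P \<and> residual L P = 0"

definition admissible :: "real^'n^'m \<Rightarrow> bool" where
  "admissible L \<longleftrightarrow> lyapunov_stable (A + B ** L) (C + D ** L)"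

text \<open>At \<open>P\<close>, \<open>weight\<close> and \<open>cross\<close> are the blocks \<open>uu\<close> and \<open>ux\<close> of the matrix of the game.\<close>

definition weight :: "real^'n^'n \<Rightarrow> real^'m^'m" where
  "weight P = R + transpose D ** P ** D"

definition cross :: "real^'n^'n \<Rightarrow> real^'n^'m" where
  "cross P = transpose B ** P + transpose D ** P ** C"

definition disturbed_gain :: "real^'n^'n \<Rightarrow> real^'m^'m \<Rightarrow> real^'n^'m \<Rightarrow> real^'n^'m" where
  "disturbed_gain P U V = - (matrix_inv (weight P + U) ** (cross P + V))"

abbreviation gain :: "real^'n^'n \<Rightarrow> real^'n^'m" where
  "gain P \<equiv> disturbed_gain P 0 0"

lemma symR: "sym_mat R" and symQ: "sym_mat Q"
  using R Q unfolding pos_def_def by auto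

lemma Rpos: "0 \<le> u \<bullet> (R *v u)"
  using R unfolding pos_def_def by (cases "u = 0") (auto intro: less_imp_le)

lemma cost_form: "x \<bullet> ((transpose L ** R ** L + Q) *v x) = (L *v x) \<bullet> (R *v (L *v x)) + x \<bullet> (Q *v x)"
  by (simp only: matrix_vector_mult_add_rdistrib inner_add_right inner_transpose_mult
      matrix_vector_mul_assoc[symmetric])

lemma cost_ge: "x \<bullet> (Q *v x) \<le> x \<bullet> ((transpose L ** R ** L + Q) *v x)"
  unfolding cost_form using Rpos by simp

lemma residual_form:
  "x \<bullet> (residual L P *v x) = x \<bullet> (lyap (A + B ** L) (C + D ** L) P *v x)
      + x \<bullet> ((transpose L ** R ** L + Q) *v x)"
  unfolding residual_def by (simp add: matrix_vector_mult_add_rdistrib inner_add_right)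

lemma sym_cost: "sym_mat (transpose L ** R ** L + Q)"
proof -
  have "sym_mat (transpose L ** R ** L)"
    using symR unfolding sym_mat_def by (simp add: matrix_transpose_mul matrix_mul_assoc)
  then show ?thesis using symQ by (rule sym_mat_add)
qed

lemma sym_residual: "sym_mat P \<Longrightarrow> sym_mat (residual L P)"
  unfolding residual_def by (intro sym_mat_add sym_mat_lyap sym_cost)

lemma evaluation_exists:
  assumes "admissible L"
  shows "\<exists>!P. evaluates L P"
proof -
  let ?l = "lyap (A + B ** L) (C + D ** L)" and ?c = "transpose L ** R ** L + Q"
  note st = assms[unfolded admissible_def]
  have neg: "?l P = (-1) *\<^sub>R ?c \<longleftrightarrow> residual L P = 0" for P
    unfolding residual_def by (simp only: scaleR_minus_left scaleR_one eq_neg_iff_add_eq_0)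
  obtain P where P: "sym_mat P" "?l P = (-1) *\<^sub>R ?c"
    using lyap_solvable[OF lyapunov_stable_unique[OF st] sym_mat_scaleR[OF sym_cost, of "-1" L]]
      by blast
  show ?thesis
  proof (rule ex1I)
    show "evaluates L P" using P neg unfolding evaluates_def by blast
    fix P' assume "evaluates L P'"
    then have P': "sym_mat P'" "?l P' = (-1) *\<^sub>R ?c" using neg unfolding evaluates_def by blast+
    have "?l (P' + (-1) *\<^sub>R P) = 0" unfolding lyap_linear P P' by simp
    then have "P' + (-1) *\<^sub>R P = 0"
      by (rule lyapunov_stable_unique[OF st sym_mat_add[OF P'(1) sym_mat_scaleR[OF P(1)]]])
    then show "P' = P" by simp
  qed
qed

lemma evaluation_form: "evaluates L P \<Longrightarrow>
    x \<bullet> (lyap (A + B ** L) (C + D ** L) P *v x) = - (x \<bullet> ((transpose L ** R ** L + Q) *v x))"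
  using residual_form[of x L P] unfolding evaluates_def by simp

lemma Qpos: "x \<noteq> 0 \<Longrightarrow> 0 < x \<bullet> (Q *v x)"
  using Q unfolding pos_def_def by auto

lemma Qnonneg: "0 \<le> x \<bullet> (Q *v x)"
  using Qpos[of x] by (cases "x = 0") auto

text \<open>The evaluation equation gives \<open>lyap P \<le> - Q\<close>.\<close>

lemma evaluation_pos_def:
  assumes a: "admissible L" and e: "evaluates L P"
  shows "pos_def P"
proof (rule positive_definite_if_lyap_negative)
  show s: "sym_mat P" using e unfolding evaluates_def by blast
  have le: "x \<bullet> (lyap (A + B ** L) (C + D ** L) P *v x) \<le> - (x \<bullet> (Q *v x))" for x
    using evaluation_form[OF e, of x] cost_ge[of x L] by simp
  show "x \<bullet> (lyap (A + B ** L) (C + D ** L) P *v x) < 0" if "x \<noteq> 0" for x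
    using le[of x] Qpos[OF that] by simp
  show "0 \<le> x \<bullet> (P *v x)" for x
    using semidefinite_if_lyap_nonpos[OF a[unfolded admissible_def] s] order_trans[OF le] Qnonneg
      by simp
qed

lemma sym_weight: "sym_mat P \<Longrightarrow> sym_mat (weight P)"
  unfolding weight_def
  by (rule sym_mat_add[OF symR]) (simp add: sym_mat_def matrix_transpose_mul matrix_mul_assoc)

lemma weight_form: "u \<bullet> (weight P *v u) = u \<bullet> (R *v u) + (D *v u) \<bullet> (P *v (D *v u))"
  unfolding weight_def
  by (simp only: matrix_vector_mult_add_rdistrib inner_add_right inner_transpose_mult
      matrix_vector_mul_assoc[symmetric])

lemma weight_pos:
  assumes "\<And>x. 0 \<le> x \<bullet> (P *v x)"
  shows "u \<noteq> 0 \<Longrightarrow> 0 < u \<bullet> (weight P *v u)" "invertible (weight P)"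
proof -
  show pos: "0 < u \<bullet> (weight P *v u)" if "u \<noteq> 0" for u
    unfolding weight_form using assms[of "D *v u"] R that unfolding pos_def_def
      by (auto intro: add_pos_nonneg)
  have "u = 0" if "weight P *v u = 0" for u
    using pos[of u] that by (cases "u = 0") auto
  then show "invertible (weight P)"
    unfolding invertible_left_inverse matrix_left_invertible_ker by blast
qed

lemma gain_equation:
  assumes "invertible (weight P)"
  shows "weight P *v (gain P *v x) = - (cross P *v x)"
proof -
  have "weight P ** gain P = - cross P"
    unfolding disturbed_gain_def
    by (simp add: matrix_mult_minus_right matrix_inv_solves[OF assms])
  then have "(weight P ** gain P) *v x = (-1) *\<^sub>R cross P *v x" by simp
  then show ?thesis unfolding matrix_vector_mult_scaleR_left matrix_vector_mul_assoc by simp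
qed

text \<open>Completion of squares: as a function of \<open>u = L x\<close> the form of the residual is quadratic with
  Hessian \<open>2 weight P\<close>, and \<open>u = gain P x\<close> is its critical point.\<close>

lemma residual_gain:
  assumes s: "sym_mat P" and inv: "invertible (weight P)"
  shows "x \<bullet> (residual L P *v x)
    = x \<bullet> (residual (gain P) P *v x) + (L *v x - gain P *v x) \<bullet> (weight P *v (L *v x - gain P *v x))"
proof -
  have res: "x \<bullet> (residual L P *v x) = 2 * ((A *v x) \<bullet> (P *v x)) + (C *v x) \<bullet> (P *v (C *v x))
      + x \<bullet> (Q *v x)
      + 2 * ((L *v x) \<bullet> (cross P *v x)) + (L *v x) \<bullet> (weight P *v (L *v x))" for L
  proof -
    let ?u = "L *v x"
    have c: "?u \<bullet> (cross P *v x) = (B *v ?u) \<bullet> (P *v x) + (D *v ?u) \<bullet> (P *v (C *v x))"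
      unfolding cross_def
      by (simp only: matrix_vector_mult_add_rdistrib inner_add_right inner_transpose_mult
          matrix_vector_mul_assoc[symmetric])
    have l: "(A + B ** L) *v x = A *v x + B *v ?u" "(C + D ** L) *v x = C *v x + D *v ?u"
      by (simp_all only: matrix_vector_mult_add_rdistrib matrix_vector_mul_assoc[symmetric])
    show ?thesis
      unfolding residual_form lyap_quadratic l cost_form weight_form c
      using sym_mat_inner[OF s, of x "A *v x"] sym_mat_inner[OF s, of x "B *v ?u"]
        sym_mat_inner[OF s, of "C *v x" "D *v ?u"]
      by (simp add: matrix_vector_right_distrib inner_add_left inner_add_right inner_commute)
  qed
  define k where "k = gain P *v x"
  define w where "w = L *v x - k"
  have u: "L *v x = k + w" by (simp add: w_def)
  have wk: "w \<bullet> (weight P *v k) = - (w \<bullet> (cross P *v x))"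
    unfolding k_def gain_equation[OF inv] by simp
  have kw: "k \<bullet> (weight P *v w) = w \<bullet> (weight P *v k)"
    using sym_mat_inner[OF sym_weight[OF s], of w k] by (simp add: inner_commute)
  show ?thesis
    unfolding res[of L] res[of "gain P"] k_def[symmetric] w_def[symmetric] u
    using wk kw by (simp add: matrix_vector_right_distrib inner_add_left inner_add_right)
qed

text \<open>The residual exceeds \<open>lyap\<close> by the running cost, which is at least \<open>Q\<close>; so \<open>P\<close> itself is a
  Lyapunov matrix.\<close>

lemma admissible_if_negative:
  assumes "pos_def P" "\<And>x. x \<bullet> (residual L P *v x) \<le> 1/2 * (x \<bullet> (Q *v x))"
  shows "admissible L"
  unfolding admissible_def lyapunov_stable_def
proof (intro exI conjI allI impI)
  fix x :: "real^'n" assume "x \<noteq> 0"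
  then show "x \<bullet> (lyap (A + B ** L) (C + D ** L) P *v x) < 0"
    using assms(2)[of x] residual_form[of x L P] cost_ge[of x L] Qpos[of x] by linarith
qed (rule assms(1))

text \<open>By \<open>residual_gain\<close> the residual of the improved policy at \<open>P\<close> is nonpositive. So \<open>P\<close> is a
  Lyapunov matrix for it, and \<open>lyap (P - P') \<le> 0\<close>, which gives \<open>P - P' \<ge> 0\<close>.\<close>

lemma policy_improvement:
  assumes a: "admissible L" and e: "evaluates L P"
  shows "admissible (gain P)" and "evaluates (gain P) P' \<Longrightarrow> x \<bullet> (P' *v x) \<le> x \<bullet> (P *v x)"
proof -
  have pd: "pos_def P" by (rule evaluation_pos_def[OF a e])
  then have s: "sym_mat P" and nn: "0 \<le> x \<bullet> (P *v x)" for x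
    unfolding pos_def_def by (auto, cases "x = 0", auto intro: less_imp_le)
  note w = weight_pos[OF nn]
  have wnn: "0 \<le> u \<bullet> (weight P *v u)" for u using w(1)[of u] by (cases "u = 0") auto
  have le: "x \<bullet> (residual (gain P) P *v x) \<le> 0" for x
    using residual_gain[OF s w(2), of x L] e wnn[of "L *v x - gain P *v x"] unfolding evaluates_def
      by simp
  show ad: "admissible (gain P)"
  proof (rule admissible_if_negative[OF pd])
    show "x \<bullet> (residual (gain P) P *v x) \<le> 1/2 * (x \<bullet> (Q *v x))" for x
      using le[of x] Qnonneg[of x] by simp
  qed
  assume e': "evaluates (gain P) P'"
  let ?l = "lyap (A + B ** gain P) (C + D ** gain P)"
  have "x \<bullet> (?l (P + (-1) *\<^sub>R P') *v x) \<le> 0" for x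
    unfolding lyap_quadratic_add lyap_quadratic_scaleR
    using evaluation_form[OF e', of x] residual_form[of x "gain P" P] le[of x] by simp
  then have "0 \<le> x \<bullet> ((P + (-1) *\<^sub>R P') *v x)"
    using e' unfolding evaluates_def
    by (intro semidefinite_if_lyap_nonpos[OF ad[unfolded admissible_def]] sym_mat_add sym_mat_scaleR
        s) auto
  then show "x \<bullet> (P' *v x) \<le> x \<bullet> (P *v x)"
    unfolding matrix_vector_mult_add_rdistrib matrix_vector_mult_scaleR_left
      by (simp add: inner_diff_right)
qed

lemma tendsto_residual:
  assumes "(f \<longlongrightarrow> L) F" "(g \<longlongrightarrow> P) F"
  shows "((\<lambda>x. residual (f x) (g x)) \<longlongrightarrow> residual L P) F"
  unfolding residual_def lyap_def
  by (intro tendsto_add tendsto_matrix_mult tendsto_transpose tendsto_const assms)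

text \<open>By continuity \<open>P\<close> remains a Lyapunov matrix for nearby policies, with \<open>lyap P \<le> - Q / 2\<close>. The
  difference \<open>P - P'\<close> is mapped by \<open>lyap\<close> to the residual, which is dominated by a multiple \<open>\<sigma>\<close> of
  \<open>- lyap P\<close>; positivity then bounds \<open>P - P'\<close> between \<open>- \<sigma> P\<close> and \<open>\<sigma> P\<close>.\<close>

lemma evaluation_perturbation:
  assumes pd: "pos_def P" and e: "evaluates L P"
  shows "\<exists>\<rho>>0. \<exists>c>0. \<forall>L'. norm (L' - L) < \<rho> \<longrightarrow> admissible L' \<and>
     (\<forall>P'. evaluates L' P' \<longrightarrow> norm (P' - P) \<le> c * norm (residual L' P))"
proof -
  have s: "sym_mat P" using e unfolding evaluates_def by blast
  obtain q where q: "0 < q" "\<And>x. q * (norm x)\<^sup>2 \<le> x \<bullet> (Q *v x)"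
    using positive_form_lower_bound[of Q] Qpos by blast
  have "((\<lambda>L'. residual L' P) \<longlongrightarrow> residual L P) (at L)"
    by (intro tendsto_residual tendsto_ident_at tendsto_const)
  then have "((\<lambda>L'. residual L' P) \<longlongrightarrow> 0) (at L)" using e unfolding evaluates_def by simp
  then obtain \<rho> where \<rho>: "0 < \<rho>" "\<And>L'. L' \<noteq> L \<Longrightarrow> norm (L' - L) < \<rho> \<Longrightarrow> norm (residual L' P) < q / 2"
    using q(1) LIM_D[of "\<lambda>L'. residual L' P" 0 L "q / 2"] by auto
  define c where "c = (real CARD('n))\<^sup>2 * (2 / q * norm P) + 1"
  have c: "0 < c" using q by (auto simp: c_def intro!: add_nonneg_pos)
  have "admissible L' \<and> (\<forall>P'. evaluates L' P' \<longrightarrow> norm (P' - P) \<le> c * norm (residual L' P))"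
    if L': "norm (L' - L) < \<rho>" for L'
  proof
    let ?e = "norm (residual L' P)" and ?l = "lyap (A + B ** L') (C + D ** L')"
    have small: "?e \<le> q / 2"
      using \<rho>(2)[OF _ L'] e q unfolding evaluates_def by (cases "L' = L") auto
    have E: "\<bar>x \<bullet> (residual L' P *v x)\<bar> \<le> ?e * (norm x)\<^sup>2" for x by (rule form_le_norm)
    have half: "x \<bullet> (residual L' P *v x) \<le> 1/2 * (x \<bullet> (Q *v x))" for x
    proof -
      have "?e * (norm x)\<^sup>2 \<le> q / 2 * (norm x)\<^sup>2" by (intro mult_right_mono small) auto
      then show ?thesis using E[of x] q(2)[of x] by linarith
    qed
    show ad: "admissible L'" by (rule admissible_if_negative[OF pd half])
    have lP: "x \<bullet> (?l P *v x) \<le> - (q / 2 * (norm x)\<^sup>2)" for x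
      using half[of x] residual_form[of x L' P] cost_ge[of x L'] q(2)[of x] by linarith
    show "\<forall>P'. evaluates L' P' \<longrightarrow> norm (P' - P) \<le> c * ?e"
    proof (intro allI impI)
      fix P' assume e': "evaluates L' P'"
      then have s': "sym_mat P'" unfolding evaluates_def by blast
      \<comment> \<open>for this multiple, \<open>\<sigma> lyap P\<close> outweighs the residual\<close>
      define \<sigma> where "\<sigma> = 2 * ?e / q"
      have \<sigma>: "0 \<le> \<sigma>" using q by (simp add: \<sigma>_def)
      have d: "x \<bullet> (?l P *v x) - x \<bullet> (?l P' *v x) = x \<bullet> (residual L' P *v x)" for x
        using evaluation_form[OF e', of x] residual_form[of x L' P] by simp
      have sl: "\<sigma> * (x \<bullet> (?l P *v x)) \<le> - (?e * (norm x)\<^sup>2)" for x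
      proof -
        have "\<sigma> * (x \<bullet> (?l P *v x)) \<le> \<sigma> * (- (q / 2 * (norm x)\<^sup>2))" by (intro mult_left_mono lP \<sigma>)
        also have "\<dots> = - (?e * (norm x)\<^sup>2)" using q by (simp add: \<sigma>_def)
        finally show ?thesis .
      qed
      have "0 \<le> x \<bullet> ((P + (-1) *\<^sub>R P' + \<sigma> *\<^sub>R P) *v x)" for x
      proof (rule semidefinite_if_lyap_nonpos[OF ad[unfolded admissible_def]])
        show "x \<bullet> (?l (P + (-1) *\<^sub>R P' + \<sigma> *\<^sub>R P) *v x) \<le> 0" for x
          unfolding lyap_quadratic_add lyap_quadratic_scaleR using d[of x] sl[of x] E[of x] by linarith
      qed (intro sym_mat_add sym_mat_scaleR s s')
      moreover have "0 \<le> x \<bullet> ((P' + (-1) *\<^sub>R P + \<sigma> *\<^sub>R P) *v x)" for x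
      proof (rule semidefinite_if_lyap_nonpos[OF ad[unfolded admissible_def]])
        show "x \<bullet> (?l (P' + (-1) *\<^sub>R P + \<sigma> *\<^sub>R P) *v x) \<le> 0" for x
          unfolding lyap_quadratic_add lyap_quadratic_scaleR using d[of x] sl[of x] E[of x] by linarith
      qed (intro sym_mat_add sym_mat_scaleR s s')
      ultimately have two: "\<bar>x \<bullet> ((P' - P) *v x)\<bar> \<le> \<sigma> * (x \<bullet> (P *v x))" for x
        unfolding matrix_vector_mult_add_rdistrib matrix_vector_mult_scaleR_left
            matrix_vector_mult_diff_rdistrib
          inner_add_right inner_diff_right inner_scaleR_right
        by (smt (verit))
      have "norm (P' - P) \<le> (real CARD('n))\<^sup>2 * (\<sigma> * norm P)"
      proof (rule sym_mat_norm_le[OF sym_mat_diff[OF s' s]])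
        fix x
        have "\<sigma> * (x \<bullet> (P *v x)) \<le> \<sigma> * (norm P * (norm x)\<^sup>2)"
          using form_le_norm[of x P] by (intro mult_left_mono \<sigma>) auto
        then show "\<bar>x \<bullet> ((P' - P) *v x)\<bar> \<le> \<sigma> * norm P * (norm x)\<^sup>2" using two[of x]
          by (simp add: mult_ac)
      qed
      also have "\<dots> = (c - 1) * ?e" by (simp add: c_def \<sigma>_def mult_ac)
      also have "\<dots> \<le> c * ?e" by (intro mult_right_mono) auto
      finally show "norm (P' - P) \<le> c * ?e" .
    qed
  qed
  then show ?thesis using \<rho>(1) c by blast
qed

text \<open>Both \<open>weight\<close> and \<open>cross\<close> are affine in \<open>P\<close>, so \<open>matrix_inv_mult_lipschitz\<close> applies.\<close>

lemma disturbed_gain_lipschitz: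
  assumes inv: "invertible (weight P0)"
  shows "\<exists>\<rho>>0. \<exists>c>0. \<forall>P U V. norm (P - P0) < \<rho> \<and> norm U < \<rho> \<longrightarrow> invertible (weight P + U) \<and>
     norm (disturbed_gain P U V - gain P0) \<le> c * (norm (P - P0) + norm U + norm V)"
proof -
  obtain \<rho> c where \<rho>: "0 < \<rho>" and c: "0 < c" and H: "\<And>S T. norm (S - weight P0) < \<rho> \<Longrightarrow> invertible S \<and>
     norm (matrix_inv S ** T - matrix_inv (weight P0) ** cross P0) \<le> c * (norm (S - weight P0)
         + norm (T - cross P0))"
    using matrix_inv_mult_lipschitz[OF inv, of "cross P0"] by blast
  define k where "k = norm (transpose D) * norm D + norm (transpose B) + norm (transpose D) * norm C
      + 1"
  have k: "1 \<le> k" by (simp add: k_def)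
  have S: "norm (weight P + U - weight P0) \<le> k * norm (P - P0) + norm U" for P U
  proof -
    have "weight P + U - weight P0 = transpose D ** (P - P0) ** D + U"
      by (simp add: weight_def matrix_mult_diff_left matrix_mult_diff_right)
    also have "norm \<dots> \<le> norm (transpose D) * norm (P - P0) * norm D + norm U"
      by (intro norm_triangle_mono order_trans[OF norm_matrix_mult_le] mult_right_mono
          norm_matrix_mult_le) auto
    also have "\<dots> \<le> k * norm (P - P0) + norm U"
    proof -
      have "norm (transpose D) * norm D \<le> k" by (simp add: k_def)
      from mult_right_mono[OF this, of "norm (P - P0)"] show ?thesis by (simp add: mult_ac)
    qed
    finally show ?thesis .
  qed
  have T: "norm (cross P + V - cross P0) \<le> k * norm (P - P0) + norm V" for P V
  proof -
    have "cross P + V - cross P0 = transpose B ** (P - P0) + transpose D ** (P - P0) ** C + V"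
      by (simp add: cross_def matrix_mult_diff_left matrix_mult_diff_right)
    also have "norm \<dots> \<le> norm (transpose B) * norm (P - P0)
        + norm (transpose D) * norm (P - P0) * norm C + norm V"
      by (intro norm_triangle_mono norm_matrix_mult_le order_trans[OF norm_matrix_mult_le]
          mult_right_mono) auto
    also have "\<dots> \<le> k * norm (P - P0) + norm V"
    proof -
      have "norm (transpose B) + norm (transpose D) * norm C \<le> k" by (simp add: k_def)
      from mult_right_mono[OF this, of "norm (P - P0)"] show ?thesis by (simp add: algebra_simps)
    qed
    finally show ?thesis .
  qed
  have "invertible (weight P + U) \<and>
     norm (disturbed_gain P U V - gain P0) \<le> (2 * c * k) * (norm (P - P0) + norm U + norm V)"
    if small: "norm (P - P0) < \<rho> / (2 * k)" "norm U < \<rho> / (2 * k)" for P U V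
  proof -
    have "k * norm (P - P0) < \<rho> / 2" using small(1) k by (simp add: field_simps)
    moreover have "norm U < \<rho> / 2"
    proof -
      have "\<rho> / (2 * k) \<le> \<rho> / 2" using \<rho> k by (simp add: field_simps)
      then show ?thesis using small(2) by simp
    qed
    ultimately have near: "norm (weight P + U - weight P0) < \<rho>" using S[of P U] by linarith
    have "norm (disturbed_gain P U V - gain P0)
       = norm (matrix_inv (weight P + U) ** (cross P + V) - matrix_inv (weight P0) ** cross P0)"
      unfolding disturbed_gain_def by (simp add: norm_minus_commute)
    also have "\<dots> \<le> c * (norm (weight P + U - weight P0) + norm (cross P + V - cross P0))"
      using H[OF near] by blast
    also have "\<dots> \<le> c * ((k * norm (P - P0) + norm U) + (k * norm (P - P0) + norm V))"
      using c by (intro mult_left_mono add_mono S T) auto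
    also have "\<dots> \<le> c * (2 * k * (norm (P - P0) + norm U + norm V))"
    proof (intro mult_left_mono)
      have "1 * norm U \<le> k * norm U" "1 * norm V \<le> k * norm V"
        by (intro mult_right_mono k norm_ge_zero)+
      moreover have "0 \<le> k * norm U" "0 \<le> k * norm V" using k by auto
      moreover have "2 * k * (norm (P - P0) + norm U + norm V)
          = 2 * (k * norm (P - P0)) + 2 * (k * norm U) + 2 * (k * norm V)" by (simp add: algebra_simps)
      ultimately show "(k * norm (P - P0) + norm U) + (k * norm (P - P0) + norm V)
          \<le> 2 * k * (norm (P - P0) + norm U + norm V)"
        by linarith
    qed (use c in auto)
    finally show ?thesis using H[OF near] by (simp add: mult_ac)
  qed
  moreover have "0 < \<rho> / (2 * k)" "0 < 2 * c * k" using \<rho> c k by auto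
  ultimately show ?thesis by blast
qed

end

section \<open>Convergence and robustness of policy iteration\<close>

lemma tendsto_matrix_vector:
  assumes "(f \<longlongrightarrow> (G::real^'n^'m)) F"
  shows "((\<lambda>x. f x *v v) \<longlongrightarrow> G *v v) F"
proof -
  have "linear (\<lambda>G::real^'n^'m. G *v v)"
    by (rule linearI) (simp_all add: matrix_vector_mult_add_rdistrib matrix_vector_mult_scaleR_left)
  then have "bounded_linear (\<lambda>G::real^'n^'m. G *v v)" by (simp only: linear_conv_bounded_linear)
  then show ?thesis by (rule bounded_linear.tendsto[OF _ assms])
qed

text \<open>Once \<open>w\<close> stays below \<open>\<eta> / 2\<close>, the recursion gives \<open>e (m + k) \<le> 2\<^sup>-\<^sup>k e m + \<eta> / 2\<close>.\<close>

lemma halving_tendsto_0: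
  fixes e w :: "nat \<Rightarrow> real"
  assumes e0: "\<And>j. 0 \<le> e j" and step: "\<And>j. N \<le> j \<Longrightarrow> e (Suc j) \<le> 1/2 * (e j + w (Suc j))"
    and w: "w \<longlonglongrightarrow> 0"
  shows "e \<longlonglongrightarrow> 0"
proof (rule LIMSEQ_I)
  fix \<eta> :: real assume \<eta>: "0 < \<eta>"
  obtain N1 where N1: "\<And>j. N1 \<le> j \<Longrightarrow> norm (w j - 0) < \<eta> / 2"
    using LIMSEQ_D[OF w, of "\<eta> / 2"] \<eta> by auto
  define m where "m = max N N1"
  have b: "e (m + k) \<le> (1/2) ^ k * e m + \<eta> / 2" for k
  proof (induction k)
    case (Suc k)
    have "N1 \<le> Suc (m + k)" by (simp add: m_def)
    from N1[OF this] have "w (Suc (m + k)) < \<eta> / 2" by simp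
    moreover have "e (Suc (m + k)) \<le> 1/2 * (e (m + k) + w (Suc (m + k)))"
      by (rule step) (simp add: m_def)
    moreover define g where "g = (1/2) ^ k * e m"
    ultimately have "e (Suc (m + k)) \<le> 1/2 * g + \<eta> / 2" using Suc unfolding g_def[symmetric] by argo
    then show ?case by (simp add: g_def)
  qed (use \<eta> in simp)
  have "(\<lambda>k. (1/2) ^ k * e m) \<longlonglongrightarrow> 0 * e m"
    by (intro tendsto_mult LIMSEQ_power_zero tendsto_const) simp
  then obtain K where K: "\<And>k. K \<le> k \<Longrightarrow> norm ((1/2) ^ k * e m) < \<eta> / 2"
    using LIMSEQ_D[of "\<lambda>k. (1/2) ^ k * e m" 0 "\<eta> / 2"] \<eta> by auto
  show "\<exists>n0. \<forall>n\<ge>n0. norm (e n - 0) < \<eta>"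
  proof (intro exI allI impI)
    fix n assume n: "m + K \<le> n"
    have "e n \<le> (1/2) ^ (n - m) * e m + \<eta> / 2" using b[of "n - m"] n by simp
    moreover have "K \<le> n - m" using n by simp
    from K[OF this] have "(1/2) ^ (n - m) * e m < \<eta> / 2" by simp
    ultimately have "e n < \<eta>" by linarith
    then show "norm (e n - 0) < \<eta>" using e0[of n] by simp
  qed
qed

context policy_iteration
begin

definition evaluation :: "real^'n^'m \<Rightarrow> real^'n^'n" where
  "evaluation L = (THE P. evaluates L P)"

lemma evaluates_iff: "admissible L \<Longrightarrow> evaluates L P \<longleftrightarrow> P = evaluation L"
  unfolding evaluation_def using evaluation_exists[of L] theI'[of "evaluates L"] by blast

lemma evaluates_evaluation: "admissible L \<Longrightarrow> evaluates L (evaluation L)"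
  using evaluates_iff by blast

primrec policies :: "real^'n^'m \<Rightarrow> (nat \<Rightarrow> real^'m^'m) \<Rightarrow> (nat \<Rightarrow> real^'n^'m) \<Rightarrow> nat \<Rightarrow> real^'n^'m" where
  "policies L0 U V 0 = L0"
| "policies L0 U V (Suc j) = disturbed_gain (evaluation (policies L0 U V j)) (U (Suc j)) (V (Suc j))"

abbreviation undisturbed :: "real^'n^'m \<Rightarrow> nat \<Rightarrow> real^'n^'m" where
  "undisturbed L0 \<equiv> policies L0 (\<lambda>_. 0) (\<lambda>_. 0)"

lemma undisturbed_admissible: "admissible L0 \<Longrightarrow> admissible (undisturbed L0 j)"
  by (induction j) (auto intro: policy_improvement(1) evaluates_evaluation)

definition fixpoint :: "real^'n^'n \<Rightarrow> bool" where
  "fixpoint P \<longleftrightarrow> pos_def P \<and> evaluates (gain P) P"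

lemma pos_defD: "pos_def P \<Longrightarrow> sym_mat P" "pos_def P \<Longrightarrow> 0 \<le> x \<bullet> (P *v x)"
  unfolding pos_def_def by (auto, cases "x = 0", auto intro: less_imp_le)

text \<open>The iterates decrease and are bounded below by \<open>0\<close>, so their forms converge and, by
  polarization, so do their entries. The limit satisfies the evaluation equation of its own gain
  by continuity.\<close>

lemma undisturbed_converges:
  assumes a: "admissible L0"
  shows "\<exists>P. (\<lambda>j. evaluation (undisturbed L0 j)) \<longlonglongrightarrow> P \<and> fixpoint P"
proof -
  define p where "p j = evaluation (undisturbed L0 j)" for j
  have ad: "admissible (undisturbed L0 j)" for j by (rule undisturbed_admissible[OF a])
  have ev: "evaluates (undisturbed L0 j) (p j)" for j unfolding p_def
    by (rule evaluates_evaluation[OF ad])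
  have improve: "undisturbed L0 (Suc j) = gain (p j)" for j by (simp add: p_def)
  have pd: "pos_def (p j)" for j by (rule evaluation_pos_def[OF ad ev])
  note sp = pos_defD(1)[OF pd] and nn = pos_defD(2)[OF pd]
  have dec: "x \<bullet> (p (Suc j) *v x) \<le> x \<bullet> (p j *v x)" for x j
    using policy_improvement(2)[OF ad[of j] ev[of j], of "p (Suc j)" x] ev[of "Suc j"] unfolding
        improve by simp
  have conv: "convergent (\<lambda>j. x \<bullet> (p j *v x))" for x
  proof -
    have dq: "decseq (\<lambda>j. x \<bullet> (p j *v x))" by (rule decseq_SucI) (rule dec)
    have "\<forall>j. 0 \<le> x \<bullet> (p j *v x)" using nn by blast
    then show ?thesis by (rule decseq_convergent[OF dq]) (rule convergentI)
  qed
  have entry: "convergent (\<lambda>j. p j $ i $ k)" for i k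
    unfolding sym_mat_entry[OF sp, of _ i k] divide_inverse
    by (intro convergent_mult convergent_diff convergent_const conv)
  define P where "P = (\<chi> i k. lim (\<lambda>j. p j $ i $ k))"
  have lim: "p \<longlonglongrightarrow> P"
  proof (intro vec_tendstoI)
    show "(\<lambda>j. p j $ i $ k) \<longlonglongrightarrow> P $ i $ k" for i k
      unfolding P_def vec_lambda_beta by (rule entry[THEN convergent_LIMSEQ_iff[THEN iffD1]])
  qed
  have s: "sym_mat P"
  proof -
    have "(\<lambda>j. transpose (p j)) = p" using sp unfolding sym_mat_def by blast
    with tendsto_transpose[OF lim] have "p \<longlonglongrightarrow> transpose P" by simp
    then show ?thesis unfolding sym_mat_def by (rule LIMSEQ_unique[OF _ lim])
  qed
  have psd: "0 \<le> x \<bullet> (P *v x)" for x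
  proof (rule LIMSEQ_le_const)
    show "(\<lambda>j. x \<bullet> (p j *v x)) \<longlonglongrightarrow> x \<bullet> (P *v x)"
      by (intro tendsto_inner tendsto_const tendsto_matrix_vector lim)
  qed (use nn in auto)
  note inv = weight_pos(2)[OF psd]
  obtain \<rho> c where \<rho>: "0 < \<rho>" and L: "\<And>P' U V. norm (P' - P) < \<rho> \<and> norm U < \<rho> \<Longrightarrow>
     norm (disturbed_gain P' U V - gain P) \<le> c * (norm (P' - P) + norm U + norm V)"
    using disturbed_gain_lipschitz[OF inv] by blast
  have diff: "(\<lambda>j. norm (p j - P)) \<longlonglongrightarrow> 0" using LIM_zero[OF lim] by (rule tendsto_norm_zero)
  have glim: "(\<lambda>j. gain (p j)) \<longlonglongrightarrow> gain P"
  proof (rule LIM_zero_cancel, rule Lim_null_comparison)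
    have "\<forall>\<^sub>F j in sequentially. norm (p j - P) < \<rho>" using order_tendstoD(2)[OF diff \<rho>] .
    then show "\<forall>\<^sub>F j in sequentially. norm (gain (p j) - gain P) \<le> c * norm (p j - P)"
    proof eventually_elim
      case (elim j)
      then show ?case using L[of "p j" 0 0] \<rho> by simp
    qed
    show "(\<lambda>j. c * norm (p j - P)) \<longlonglongrightarrow> 0" using tendsto_mult_right_zero[OF diff] .
  qed
  have "(\<lambda>j. residual (gain (p j)) (p (Suc j))) \<longlonglongrightarrow> residual (gain P) P"
    by (rule tendsto_residual[OF glim LIMSEQ_Suc[OF lim]])
  moreover have "residual (gain (p j)) (p (Suc j)) = 0" for j
    using ev[of "Suc j"] unfolding improve evaluates_def by simp
  ultimately have "residual (gain P) P = 0" by (simp add: LIMSEQ_const_iff)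
  then have evP: "evaluates (gain P) P" using s unfolding evaluates_def by simp
  have "pos_def P"
  proof (rule positive_definite_if_lyap_negative[OF s psd])
    fix x :: "real^'n" assume "x \<noteq> 0"
    then show "x \<bullet> (lyap (A + B ** gain P) (C + D ** gain P) P *v x) < 0"
      using evaluation_form[OF evP, of x] cost_ge[of x "gain P"] Qpos[of x] by linarith
  qed
  then show ?thesis using lim evP unfolding fixpoint_def p_def by blast
qed

text \<open>Composition of two continuous dependences: that of the gain on \<open>P\<close> and the disturbance, and that
  of the cost matrix on the gain.\<close>

lemma step_continuous:
  assumes inv: "invertible (weight P0)" and pd: "pos_def P1" and ev: "evaluates (gain P0) P1" and \<epsilon>:
      "0 < \<epsilon>"
  shows "\<exists>\<delta>>0. \<forall>P U V. norm (P - P0) < \<delta> \<and> norm U + norm V < \<delta> \<longrightarrow> invertible (weight P + U) \<and>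
    admissible (disturbed_gain P U V) \<and> norm (evaluation (disturbed_gain P U V) - P1) < \<epsilon>"
proof -
  obtain \<rho>1 c1 where 1: "0 < \<rho>1" "0 < c1" and G: "\<And>P U V. norm (P - P0) < \<rho>1 \<and> norm U < \<rho>1 \<Longrightarrow>
     invertible (weight P + U) \<and> norm (disturbed_gain P U V - gain P0) \<le> c1 * (norm (P - P0)
         + norm U + norm V)"
    using disturbed_gain_lipschitz[OF inv] by blast
  obtain \<rho>2 c2 where 2: "0 < \<rho>2" "0 < c2" and E: "\<And>L'. norm (L' - gain P0) < \<rho>2 \<Longrightarrow> admissible L' \<and>
     (\<forall>P'. evaluates L' P' \<longrightarrow> norm (P' - P1) \<le> c2 * norm (residual L' P1))"
    using evaluation_perturbation[OF pd ev] by blast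
  have "((\<lambda>L'. residual L' P1) \<longlongrightarrow> residual (gain P0) P1) (at (gain P0))"
    by (intro tendsto_residual tendsto_ident_at tendsto_const)
  then have "((\<lambda>L'. residual L' P1) \<longlongrightarrow> 0) (at (gain P0))" using ev unfolding evaluates_def by simp
  then obtain \<rho>3 where 3: "0 < \<rho>3" "\<And>L'. L' \<noteq> gain P0 \<Longrightarrow> norm (L' - gain P0) < \<rho>3
      \<Longrightarrow> norm (residual L' P1) < \<epsilon> / c2"
    using 2 \<epsilon> LIM_D[of "\<lambda>L'. residual L' P1" 0 "gain P0" "\<epsilon> / c2"] by auto
  define \<delta> where "\<delta> = min \<rho>1 (min \<rho>2 \<rho>3 / (2 * c1))"
  have \<delta>: "0 < \<delta>" using 1 2 3 by (simp add: \<delta>_def)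
  have "invertible (weight P + U) \<and> admissible (disturbed_gain P U V) \<and>
      norm (evaluation (disturbed_gain P U V) - P1) < \<epsilon>"
    if near: "norm (P - P0) < \<delta>" "norm U + norm V < \<delta>" for P U V
  proof -
    let ?L = "disturbed_gain P U V"
    have "norm U < \<delta>" using near norm_ge_zero[of V] by linarith
    then have g: "invertible (weight P + U)" "norm (?L - gain P0) \<le> c1 * (norm (P - P0) + norm U
        + norm V)"
      using G[of P U V] near by (auto simp: \<delta>_def)
    have "norm (P - P0) + norm U + norm V < 2 * \<delta>" using near by linarith
    then have "c1 * (norm (P - P0) + norm U + norm V) < c1 * (2 * \<delta>)" using 1
      by (intro mult_strict_left_mono)
    also have "\<dots> \<le> c1 * (2 * (min \<rho>2 \<rho>3 / (2 * c1)))" using 1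
      by (intro mult_left_mono) (auto simp: \<delta>_def)
    also have "\<dots> = min \<rho>2 \<rho>3" using 1 by simp
    finally have n: "norm (?L - gain P0) < \<rho>2" "norm (?L - gain P0) < \<rho>3" using g(2) by linarith+
    have ad: "admissible ?L" using E[OF n(1)] by blast
    have "norm (residual ?L P1) < \<epsilon> / c2"
      using 3(2)[OF _ n(2)] ev 2 \<epsilon> unfolding evaluates_def by (cases "?L = gain P0") auto
    then have "c2 * norm (residual ?L P1) < \<epsilon>" using 2 by (simp add: field_simps)
    then show ?thesis using E[OF n(1)] evaluates_evaluation[OF ad] g(1) by fastforce
  qed
  then show ?thesis using \<delta> by blast
qed

text \<open>At the fixed point the residual of a policy is quadratic in its distance from \<open>gain Ps\<close>, so the
  new error is at most \<open>b t\<^sup>2\<close> for \<open>t\<close> the sum of the old error and the disturbance. The radius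
  \<open>r\<close> makes \<open>b t \<le> 1/2\<close>.\<close>

lemma local_contraction:
  assumes fp: "fixpoint Ps"
  shows "\<exists>r>0. \<forall>P U V. norm (P - Ps) < r \<and> norm U + norm V < r \<longrightarrow> invertible (weight P + U) \<and>
    admissible (disturbed_gain P U V) \<and>
    norm (evaluation (disturbed_gain P U V) - Ps) \<le> 1/2 * (norm (P - Ps) + (norm U + norm V))"
proof -
  have pd: "pos_def Ps" and ev: "evaluates (gain Ps) Ps" using fp unfolding fixpoint_def by auto
  note s = pos_defD(1)[OF pd]
  note inv = weight_pos(2)[OF pos_defD(2)[OF pd]]
  obtain \<rho>1 c1 where 1: "0 < \<rho>1" "0 < c1" and G: "\<And>P U V. norm (P - Ps) < \<rho>1 \<and> norm U < \<rho>1 \<Longrightarrow>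
     invertible (weight P + U) \<and> norm (disturbed_gain P U V - gain Ps) \<le> c1 * (norm (P - Ps)
         + norm U + norm V)"
    using disturbed_gain_lipschitz[OF inv] by blast
  obtain \<rho>2 c2 where 2: "0 < \<rho>2" "0 < c2" and E: "\<And>L'. norm (L' - gain Ps) < \<rho>2 \<Longrightarrow> admissible L' \<and>
     (\<forall>P'. evaluates L' P' \<longrightarrow> norm (P' - Ps) \<le> c2 * norm (residual L' Ps))"
    using evaluation_perturbation[OF pd ev] by blast
  define k where "k = (real CARD('n))\<^sup>2 * norm (weight Ps) + 1"
  have k: "0 < k" by (simp add: k_def add_nonneg_pos)
  have quad: "norm (residual L' Ps) \<le> k * (norm (L' - gain Ps))\<^sup>2" for L'
  proof -
    have "norm (residual L' Ps) \<le> (real CARD('n))\<^sup>2 * (norm (weight Ps) * (norm (L' - gain Ps))\<^sup>2)"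
    proof (rule sym_mat_norm_le[OF sym_residual[OF s]])
      fix x
      let ?w = "L' *v x - gain Ps *v x"
      have "x \<bullet> (residual L' Ps *v x) = ?w \<bullet> (weight Ps *v ?w)"
        using residual_gain[OF s inv, of x L'] ev unfolding evaluates_def by simp
      then have "\<bar>x \<bullet> (residual L' Ps *v x)\<bar> \<le> norm (weight Ps) * (norm ?w)\<^sup>2"
        using form_le_norm[of ?w] by simp
      also have "\<dots> \<le> norm (weight Ps) * (norm (L' - gain Ps) * norm x)\<^sup>2"
        using norm_matrix_vector_mult_le[of "L' - gain Ps" x]
        by (intro mult_left_mono power_mono) (auto simp: matrix_vector_mult_diff_rdistrib)
      finally show "\<bar>x \<bullet> (residual L' Ps *v x)\<bar> \<le> norm (weight Ps) * (norm (L' - gain Ps))\<^sup>2 * (norm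
          x)\<^sup>2"
        by (simp add: power_mult_distrib mult_ac)
    qed
    also have "\<dots> \<le> k * (norm (L' - gain Ps))\<^sup>2"
      by (simp add: k_def mult.assoc[symmetric] mult_right_mono)
    finally show ?thesis .
  qed
  define b where "b = c2 * k * c1\<^sup>2"
  have b: "0 < b" using 1 2 k by (simp add: b_def)
  define r where "r = min \<rho>1 (min (\<rho>2 / (2 * c1)) (1 / (4 * b)))"
  have r: "0 < r" using 1 2 b by (simp add: r_def)
  have "invertible (weight P + U) \<and> admissible (disturbed_gain P U V) \<and>
      norm (evaluation (disturbed_gain P U V) - Ps) \<le> 1/2 * (norm (P - Ps) + (norm U + norm V))"
    if near: "norm (P - Ps) < r" "norm U + norm V < r" for P U V
  proof -
    let ?L = "disturbed_gain P U V" and ?t = "norm (P - Ps) + (norm U + norm V)"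
    have "norm U < r" using near norm_ge_zero[of V] by linarith
    then have g: "invertible (weight P + U)" "norm (?L - gain Ps) \<le> c1 * ?t"
      using G[of P U V] near by (auto simp: r_def add.assoc)
    have t: "0 \<le> ?t" "?t < 2 * r" using near by auto
    have "c1 * ?t < c1 * (2 * r)" using 1 t by (intro mult_strict_left_mono)
    also have "\<dots> \<le> c1 * (2 * (\<rho>2 / (2 * c1)))" using 1 by (intro mult_left_mono) (auto simp: r_def)
    also have "\<dots> = \<rho>2" using 1 by simp
    finally have n: "norm (?L - gain Ps) < \<rho>2" using g(2) by linarith
    have ad: "admissible ?L" using E[OF n] by blast
    have "norm (evaluation ?L - Ps) \<le> c2 * norm (residual ?L Ps)"
      using E[OF n] evaluates_evaluation[OF ad] by blast
    also have "\<dots> \<le> c2 * (k * (norm (?L - gain Ps))\<^sup>2)" using 2 by (intro mult_left_mono quad) auto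
    also have "\<dots> \<le> c2 * (k * (c1 * ?t)\<^sup>2)" using 2 k g(2) by (intro mult_left_mono power_mono) auto
    also have "\<dots> = (b * ?t) * ?t" by (simp add: b_def power2_eq_square algebra_simps)
    also have "\<dots> \<le> 1/2 * ?t"
    proof (intro mult_right_mono t)
      have "b * ?t \<le> b * (2 * r)" using b t by (intro mult_left_mono) auto
      also have "\<dots> \<le> b * (2 * (1 / (4 * b)))" using b by (intro mult_left_mono) (auto simp: r_def)
      also have "\<dots> = 1/2" using b by simp
      finally show "b * ?t \<le> 1/2" .
    qed
    finally show ?thesis using g(1) ad by blast
  qed
  then show ?thesis using r by blast
qed

text \<open>Induction on the number of steps: the tolerance after \<open>n\<close> steps has to meet both the goal and
  the requirement of \<open>step_continuous\<close> for the next step.\<close>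

lemma finitely_many_steps:
  assumes a: "admissible L0"
  shows "0 < \<epsilon> \<Longrightarrow> \<exists>\<delta>>0. \<forall>U V. (\<forall>j\<ge>1. norm (U j) + norm (V j) < \<delta>) \<longrightarrow>
    (\<forall>j\<le>n. admissible (policies L0 U V j)) \<and>
    (\<forall>j<n. invertible (weight (evaluation (policies L0 U V j)) + U (Suc j))) \<and>
    (\<forall>j\<le>n. norm (evaluation (policies L0 U V j) - evaluation (undisturbed L0 j)) < \<epsilon>)"
proof (induction n arbitrary: \<epsilon>)
  case 0
  then show ?case using a by (intro exI[of _ 1]) auto
next
  case (Suc n)
  let ?p = "\<lambda>j. evaluation (undisturbed L0 j)"
  have ad: "admissible (undisturbed L0 j)" for j by (rule undisturbed_admissible[OF a])
  have ev: "evaluates (undisturbed L0 j) (?p j)" for j by (rule evaluates_evaluation[OF ad])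
  have pd: "pos_def (?p j)" for j by (rule evaluation_pos_def[OF ad ev])
  have ev': "evaluates (gain (?p n)) (?p (Suc n))" using ev[of "Suc n"] by simp
  obtain \<delta>1 where 1: "0 < \<delta>1" "\<And>P U V. norm (P - ?p n) < \<delta>1 \<and> norm U + norm V < \<delta>1 \<Longrightarrow>
      invertible (weight P + U) \<and> admissible (disturbed_gain P U V) \<and>
      norm (evaluation (disturbed_gain P U V) - ?p (Suc n)) < \<epsilon>"
    using step_continuous[OF weight_pos(2)[OF pos_defD(2)[OF pd]] pd ev' Suc.prems] by blast
  have "0 < min \<epsilon> \<delta>1" using 1 Suc.prems by simp
  from Suc.IH[OF this] obtain \<delta>2 where 2: "0 < \<delta>2" "\<And>U V. (\<forall>j\<ge>1. norm (U j) + norm (V j) < \<delta>2) \<Longrightarrow>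
    (\<forall>j\<le>n. admissible (policies L0 U V j)) \<and>
    (\<forall>j<n. invertible (weight (evaluation (policies L0 U V j)) + U (Suc j))) \<and>
    (\<forall>j\<le>n. norm (evaluation (policies L0 U V j) - ?p j) < min \<epsilon> \<delta>1)" by blast
  show ?case
  proof (intro exI[of _ "min \<delta>1 \<delta>2"] conjI allI impI)
    show "0 < min \<delta>1 \<delta>2" using 1 2 by simp
    fix U :: "nat \<Rightarrow> real^'m^'m" and V :: "nat \<Rightarrow> real^'n^'m"
    assume UV: "\<forall>j\<ge>1. norm (U j) + norm (V j) < min \<delta>1 \<delta>2"
    then have ih: "\<forall>j\<le>n. admissible (policies L0 U V j)"
      "\<forall>j<n. invertible (weight (evaluation (policies L0 U V j)) + U (Suc j))"
      "\<forall>j\<le>n. norm (evaluation (policies L0 U V j) - ?p j) < min \<epsilon> \<delta>1"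
      using 2(2)[of U V] by auto
    have st: "invertible (weight (evaluation (policies L0 U V n)) + U (Suc n))"
      "admissible (policies L0 U V (Suc n))"
      "norm (evaluation (policies L0 U V (Suc n)) - ?p (Suc n)) < \<epsilon>"
      using 1(2)[of "evaluation (policies L0 U V n)" "U (Suc n)" "V (Suc n)"] ih(3) UV by auto
    show "admissible (policies L0 U V j)" if "j \<le> Suc n" for j using that ih(1) st(2) le_Suc_eq by blast
    show "invertible (weight (evaluation (policies L0 U V j)) + U (Suc j))" if "j < Suc n" for j
      using that ih(2) st(1) less_Suc_eq by blast
    show "norm (evaluation (policies L0 U V j) - ?p j) < \<epsilon>" if "j \<le> Suc n" for j
      using that ih(3) st(3) le_Suc_eq by (metis min_less_iff_conj)
  qed
qed

text \<open>Up to the first index \<open>N\<close> at which the undisturbed iterate is well inside the neighbourhood of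
  \<open>local_contraction\<close>, \<open>finitely_many_steps\<close> controls the disturbed iterates; from then on the
  contraction keeps them there.\<close>

theorem robust_policy_iteration:
  assumes a: "admissible L0" and fp: "fixpoint Ps" and conv: "(\<lambda>j. evaluation (undisturbed L0 j)) \<longlonglongrightarrow> Ps"
    and \<epsilon>: "0 < \<epsilon>"
  shows "\<exists>\<delta>>0. \<exists>M0>0. \<forall>U V. (\<forall>j\<ge>1. norm (U j) + norm (V j) < \<delta>) \<longrightarrow>
    (\<forall>j. admissible (policies L0 U V j)) \<and>
    (\<forall>j. invertible (weight (evaluation (policies L0 U V j)) + U (Suc j))) \<and>
    (\<forall>j. norm (evaluation (policies L0 U V j)) < M0) \<and>
    (\<forall>\<^sub>F j in sequentially. norm (evaluation (policies L0 U V j) - Ps) < \<epsilon>) \<and>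
    ((\<lambda>j. norm (U j) + norm (V j)) \<longlonglongrightarrow> 0 \<longrightarrow> (\<lambda>j. evaluation (policies L0 U V j)) \<longlonglongrightarrow> Ps)"
proof -
  let ?p = "\<lambda>j. evaluation (undisturbed L0 j)"
  obtain r0 where r0: "0 < r0" "\<And>P U V. norm (P - Ps) < r0 \<and> norm U + norm V < r0
      \<Longrightarrow> invertible (weight P + U) \<and>
    admissible (disturbed_gain P U V) \<and>
    norm (evaluation (disturbed_gain P U V) - Ps) \<le> 1/2 * (norm (P - Ps) + (norm U + norm V))"
    using local_contraction[OF fp] by blast
  define r where "r = min r0 \<epsilon>"
  have r: "0 < r" "r \<le> r0" "r \<le> \<epsilon>" using r0 \<epsilon> by (auto simp: r_def)
  have "\<exists>N. \<forall>n\<ge>N. norm (?p n - Ps) < r / 2" using LIMSEQ_D[OF conv, of "r / 2"] r by simp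
  then obtain N where N: "norm (?p N - Ps) < r / 2" by blast
  obtain \<delta>1 where 1: "0 < \<delta>1" "\<And>U V. (\<forall>j\<ge>1. norm (U j) + norm (V j) < \<delta>1) \<Longrightarrow>
    (\<forall>j\<le>N. admissible (policies L0 U V j)) \<and>
    (\<forall>j<N. invertible (weight (evaluation (policies L0 U V j)) + U (Suc j))) \<and>
    (\<forall>j\<le>N. norm (evaluation (policies L0 U V j) - ?p j) < r / 2)"
    using finitely_many_steps[OF a, of "r / 2" N] r by auto
  define \<delta> where "\<delta> = min \<delta>1 r"
  define M0 where "M0 = (\<Sum>j\<le>N. norm (?p j)) + norm Ps + 2 * r"
  have "0 \<le> (\<Sum>j\<le>N. norm (?p j))" by (intro sum_nonneg) auto
  then have M0: "0 < M0" unfolding M0_def using r norm_ge_zero[of Ps] by linarith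
  have "(\<forall>j. admissible (policies L0 U V j)) \<and>
    (\<forall>j. invertible (weight (evaluation (policies L0 U V j)) + U (Suc j))) \<and>
    (\<forall>j. norm (evaluation (policies L0 U V j)) < M0) \<and>
    (\<forall>\<^sub>F j in sequentially. norm (evaluation (policies L0 U V j) - Ps) < \<epsilon>) \<and>
    ((\<lambda>j. norm (U j) + norm (V j)) \<longlonglongrightarrow> 0 \<longrightarrow> (\<lambda>j. evaluation (policies L0 U V j)) \<longlonglongrightarrow> Ps)"
    if UV: "\<forall>j\<ge>1. norm (U j) + norm (V j) < \<delta>" for U V
  proof -
    let ?q = "\<lambda>j. evaluation (policies L0 U V j)"
    have small: "norm (U (Suc j)) + norm (V (Suc j)) < r" for j using UV by (auto simp: \<delta>_def)
    have init: "\<forall>j\<le>N. admissible (policies L0 U V j)"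
      "\<forall>j<N. invertible (weight (?q j) + U (Suc j))"
      "\<forall>j\<le>N. norm (?q j - ?p j) < r / 2"
      using 1(2)[of U V] UV by (auto simp: \<delta>_def)
    have step: "invertible (weight (?q j) + U (Suc j)) \<and> admissible (policies L0 U V (Suc j)) \<and>
        norm (?q (Suc j) - Ps) \<le> 1/2 * (norm (?q j - Ps) + (norm (U (Suc j)) + norm (V (Suc j))))"
      if "norm (?q j - Ps) < r" for j
      using r0(2)[of "?q j" "U (Suc j)" "V (Suc j)"] small[of j] that r by simp
    have tail: "norm (?q (N + k) - Ps) < r \<and> admissible (policies L0 U V (N + k))" for k
    proof (induction k)
      case 0
      have "norm (?q N - Ps) \<le> norm (?q N - ?p N) + norm (?p N - Ps)"
        using norm_triangle_ineq[of "?q N - ?p N" "?p N - Ps"] by simp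
      then show ?case using init(1,3) N by fastforce
    next
      case (Suc k)
      then have n: "norm (?q (N + k) - Ps) < r" by simp
      have "norm (?q (Suc (N + k)) - Ps)
          \<le> 1/2 * (norm (?q (N + k) - Ps) + (norm (U (Suc (N + k))) + norm (V (Suc (N + k)))))"
        using step[OF n] by blast
      then have "norm (?q (Suc (N + k)) - Ps) < r"
        using n small[of "N + k"] by argo
      then show ?case using step[OF n] by simp
    qed
    have tail': "norm (?q j - Ps) < r" if "N \<le> j" for j
      using tail[of "j - N"] that by simp
    have adm: "admissible (policies L0 U V j)" for j
      using init(1) tail[of "j - N"] by (cases "j \<le> N") auto
    moreover have "invertible (weight (?q j) + U (Suc j))" for j
      using init(2) step[OF tail'[of j]] by (cases "j < N") auto
    moreover have "norm (?q j) < M0" for j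
    proof (cases "j \<le> N")
      case True
      have "norm (?q j) \<le> norm (?q j - ?p j) + norm (?p j)"
        using norm_triangle_ineq[of "?q j - ?p j" "?p j"] by simp
      also have "\<dots> < r + norm (?p j)" using init(3) True r by fastforce
      also have "norm (?p j) \<le> (\<Sum>j\<le>N. norm (?p j))" using True by (intro member_le_sum) auto
      finally show ?thesis using r norm_ge_zero[of Ps] unfolding M0_def by linarith
    next
      case False
      have "norm (?q j) \<le> norm (?q j - Ps) + norm Ps"
        using norm_triangle_ineq[of "?q j - Ps" Ps] by simp
      moreover have "0 \<le> (\<Sum>j\<le>N. norm (?p j))" by (intro sum_nonneg) auto
      ultimately show ?thesis using tail'[of j] False r unfolding M0_def by linarith
    qed
    moreover have "\<forall>\<^sub>F j in sequentially. norm (?q j - Ps) < \<epsilon>"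
      using tail' r(3) by (intro eventually_sequentiallyI[of N]) (auto intro: less_le_trans)
    moreover have "?q \<longlonglongrightarrow> Ps" if w: "(\<lambda>j. norm (U j) + norm (V j)) \<longlonglongrightarrow> 0"
    proof -
      have "(\<lambda>j. norm (?q j - Ps)) \<longlonglongrightarrow> 0"
        by (rule halving_tendsto_0[OF _ _ w, of _ N]) (use step tail' in auto)
      then have "(\<lambda>j. ?q j - Ps) \<longlonglongrightarrow> 0" by (rule tendsto_norm_zero_cancel)
      then show ?thesis by (rule LIM_zero_cancel)
    qed
    ultimately show ?thesis by blast
  qed
  moreover have "0 < \<delta>" using 1 r by (simp add: \<delta>_def)
  ultimately show ?thesis using M0 by blast
qed

end

section \<open>From the game to policy iteration\<close>

lemma block_uu_game_mat:
  "block_uu (game_mat A B1 B2 C D Q R \<gamma> P + N) = R + transpose D ** P ** D + block_uu N"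
  by (simp add: block_uu_def game_mat_def block_mat_def vec_eq_iff)

lemma block_ux_game_mat:
  "block_ux (game_mat A B1 B2 C D Q R \<gamma> P + N) = transpose B1 ** P + transpose D ** P ** C + block_ux N"
  by (simp add: block_ux_def game_mat_def block_mat_def vec_eq_iff)

lemma blocks_bounded:
  "\<exists>k>0. \<forall>N :: real^('n::finite + ('m1::finite + 'm2::finite))^('n + ('m1 + 'm2)).
     norm (block_uu N :: real^'m1^'m1) + norm (block_ux N :: real^'n^'m1) \<le> k * norm N"
proof -
  have "linear (block_uu :: real^('n + ('m1 + 'm2))^('n + ('m1 + 'm2)) \<Rightarrow> real^'m1^'m1)"
    by (rule linearI) (simp_all add: block_uu_def vec_eq_iff)
  then obtain k1 where k1: "0 < k1"
      "\<And>N :: real^('n + ('m1 + 'm2))^('n + ('m1 + 'm2)). norm (block_uu N :: real^'m1^'m1)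
          \<le> k1 * norm N"
    using linear_bounded_pos by blast
  have "linear (block_ux :: real^('n + ('m1 + 'm2))^('n + ('m1 + 'm2)) \<Rightarrow> real^'n^'m1)"
    by (rule linearI) (simp_all add: block_ux_def vec_eq_iff)
  then obtain k2 where k2: "0 < k2"
      "\<And>N :: real^('n + ('m1 + 'm2))^('n + ('m1 + 'm2)). norm (block_ux N :: real^'n^'m1) \<le> k2 * norm N"
    using linear_bounded_pos by blast
  show ?thesis
  proof (intro exI[of _ "k1 + k2"] conjI allI)
    fix N :: "real^('n + ('m1 + 'm2))^('n + ('m1 + 'm2))"
    show "norm (block_uu N :: real^'m1^'m1) + norm (block_ux N :: real^'n^'m1) \<le> (k1 + k2) * norm N"
      using k1(2)[of N] k2(2)[of N] by (simp add: distrib_right)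
  qed (use k1 k2 in simp)
qed

lemma (in policy_iteration) policy_eq_iff_residual:
  fixes A' Q' :: "real^'n^'n" and B2 :: "real^'m2^'n" and Lv :: "real^'n^'m2"
  assumes "A = A' + B2 ** Lv" "Q = Q_v Q' \<gamma> Lv"
  shows "policy_eq A' B B2 C D Q' R \<gamma> Lv L P \<longleftrightarrow> residual L P = 0"
  unfolding policy_eq_def Let_def assms[symmetric] residual_def lyap_def by (simp only: add.assoc)

context policy_iteration
begin

text \<open>As long as the policies are admissible, the Lyapunov equations have unique solutions, and the
  disturbances determine the whole iteration.\<close>

lemma inner_iteration_iff:
  fixes A' Q' :: "real^'n^'n" and B2 :: "real^'m2^'n" and Lv :: "real^'n^'m2"
    and \<Delta> :: "nat \<Rightarrow> real^('n + ('m + 'm2))^('n + ('m + 'm2))"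
  assumes e: "A = A' + B2 ** Lv" "Q = Q_v Q' \<gamma> Lv"
    and ad: "\<And>j. admissible (policies L0 (\<lambda>j. block_uu (\<Delta> j)) (\<lambda>j. block_ux (\<Delta> j)) j)"
  shows "inner_iteration A' B B2 C D Q' R \<gamma> Lv L0 \<Delta> P L \<longleftrightarrow>
    (\<forall>j. L j = policies L0 (\<lambda>j. block_uu (\<Delta> j)) (\<lambda>j. block_ux (\<Delta> j)) j \<and> P (Suc j) = evaluation (L j))"
    (is "_ \<longleftrightarrow> (\<forall>j. L j = ?L j \<and> _)")
proof -
  have iter: "inner_iteration A' B B2 C D Q' R \<gamma> Lv L0 \<Delta> P L \<longleftrightarrow> L 0 = L0
      \<and> (\<forall>j. evaluates (L j) (P (Suc j)) \<and>
      L (Suc j) = disturbed_gain (P (Suc j)) (block_uu (\<Delta> (Suc j))) (block_ux (\<Delta> (Suc j))))"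
    unfolding inner_iteration_def policy_eq_iff_residual[OF e] M_hat_def block_uu_game_mat
        block_ux_game_mat
      evaluates_def disturbed_gain_def weight_def cross_def by (simp add: conj_assoc)
  show ?thesis
  proof
    assume "inner_iteration A' B B2 C D Q' R \<gamma> Lv L0 \<Delta> P L"
    then have L0: "L 0 = L0" and ev: "evaluates (L j) (P (Suc j))"
      and L: "L (Suc j) = disturbed_gain (P (Suc j)) (block_uu (\<Delta> (Suc j))) (block_ux (\<Delta> (Suc j)))"
          for j
      unfolding iter by blast+
    have P: "P (Suc j) = evaluation (L j)" if "L j = ?L j" for j
      using ev[of j] evaluates_iff[OF ad[of j]] that by simp
    have Leq: "L j = ?L j" for j
    proof (induction j)
      case (Suc j)
      then show ?case using L[of j] P[of j] by simp
    qed (simp add: L0)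
    then show "\<forall>j. L j = ?L j \<and> P (Suc j) = evaluation (L j)" using P by blast
  next
    assume H: "\<forall>j. L j = ?L j \<and> P (Suc j) = evaluation (L j)"
    have L: "L j = ?L j" and P: "P (Suc j) = evaluation (?L j)" for j using H by metis+
    have "evaluates (L j) (P (Suc j))" for j unfolding L P by (rule evaluates_evaluation[OF ad])
    moreover have "L (Suc j) = disturbed_gain (P (Suc j)) (block_uu (\<Delta> (Suc j))) (block_ux (\<Delta> (Suc
        j)))" for j
      unfolding L P by simp
    ultimately show "inner_iteration A' B B2 C D Q' R \<gamma> Lv L0 \<Delta> P L"
      unfolding iter using L[of 0] by simp
  qed
qed

text \<open>The iterates of an undisturbed iteration are unique from index \<open>1\<close> on, so its limit is too.\<close>

lemma P_star_eq:
  fixes A' Q' :: "real^'n^'n" and B2 :: "real^'m2^'n" and Lv :: "real^'n^'m2"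
  assumes e: "A = A' + B2 ** Lv" "Q = Q_v Q' \<gamma> Lv" and a: "admissible L0"
    and conv: "(\<lambda>j. evaluation (undisturbed L0 j)) \<longlonglongrightarrow> Ps"
  shows "P_star A' B B2 C D Q' R \<gamma> Lv L0 = Ps"
proof -
  let ?\<Delta> = "\<lambda>_::nat. 0 :: real^('n + ('m + 'm2))^('n + ('m + 'm2))"
  have z: "block_uu (?\<Delta> j) = (0 :: real^'m^'m)" "block_ux (?\<Delta> j) = (0 :: real^'n^'m)" for j
    by (simp_all add: block_uu_def block_ux_def vec_eq_iff)
  have iff: "inner_iteration A' B B2 C D Q' R \<gamma> Lv L0 ?\<Delta> P L \<longleftrightarrow>
      (\<forall>j. L j = undisturbed L0 j \<and> P (Suc j) = evaluation (L j))" for P L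
    using inner_iteration_iff[OF e, of L0 ?\<Delta> P L] undisturbed_admissible[OF a] unfolding z by blast
  show ?thesis
    unfolding P_star_def iff
  proof (rule the_equality)
    show "\<exists>P L. (\<forall>j. L j = undisturbed L0 j \<and> P (Suc j) = evaluation (L j)) \<and> P \<longlonglongrightarrow> Ps"
    proof (intro exI conjI allI)
      let ?P = "\<lambda>j. evaluation (undisturbed L0 (j - 1))"
      show "undisturbed L0 j = undisturbed L0 j" for j ..
      show "?P (Suc j) = evaluation (undisturbed L0 j)" for j by simp
      have "(\<lambda>j. ?P (Suc j)) \<longlonglongrightarrow> Ps" using conv by simp
      then show "?P \<longlonglongrightarrow> Ps" by (rule LIMSEQ_imp_Suc)
    qed
    fix Pl assume "\<exists>P L. (\<forall>j. L j = undisturbed L0 j \<and> P (Suc j) = evaluation (L j)) \<and> P \<longlonglongrightarrow> Pl"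
    then obtain P L where PL: "\<And>j. L j = undisturbed L0 j" "\<And>j. P (Suc j) = evaluation (L j)" "P
        \<longlonglongrightarrow> Pl" by blast
    have "(\<lambda>j. evaluation (undisturbed L0 j)) \<longlonglongrightarrow> Pl"
      using LIMSEQ_Suc[OF PL(3)] unfolding PL(2) PL(1) .
    then show "Pl = Ps" using conv by (rule LIMSEQ_unique)
  qed
qed

end

theorem theorem4p6:
  fixes M :: "'w measure" and F :: "real \<Rightarrow> 'w measure" and W :: "real \<Rightarrow> 'w \<Rightarrow> real"
    and A C Q :: "real^'n^'n" and B1 D :: "real^'m1^'n" and B2 :: "real^'m2^'n"
    and R :: "real^'m1^'m1" and \<gamma> \<epsilon> :: real
    and L0 :: "real^'n^'m1" and Lv :: "real^'n^'m2"
  assumes "filtered_space M F" and "brownian_motion M F W"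
    and "pos_semidef Q" and "pos_def R" and "\<gamma> > 0"
    and "\<exists>Lu' Lv'. stabilizer M F W A B1 B2 C D Lu' Lv'"
    and "stabilizer M F W A B1 B2 C D L0 Lv"
    and "\<epsilon> > 0"
  shows "\<exists>\<delta>2>0. pos_def (Q_v Q \<gamma> Lv) \<longrightarrow> (\<exists>M0>0.
    \<forall>\<Delta> :: nat \<Rightarrow> real^('n + ('m1 + 'm2))^('n + ('m1 + 'm2)).
      (\<forall>j\<ge>1. sym_mat (\<Delta> j)) \<and> sup_norm \<Delta> < ereal \<delta>2 \<longrightarrow>
      (\<exists>P L. inner_iteration A B1 B2 C D Q R \<gamma> Lv L0 \<Delta> P L) \<and>
      (\<forall>P L. inner_iteration A B1 B2 C D Q R \<gamma> Lv L0 \<Delta> P L \<longrightarrow>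
        (\<forall>j>0. invertible (block_uu (M_hat A B1 B2 C D Q R \<gamma> \<Delta> P j)) \<and>
               stabilizer M F W A B1 B2 C D (L j) Lv \<and> norm (P j) < M0) \<and>
        limsup (\<lambda>j. ereal (norm (P j - P_star A B1 B2 C D Q R \<gamma> Lv L0))) < ereal \<epsilon> \<and>
        ((\<lambda>j. norm (\<Delta> j)) \<longlonglongrightarrow> 0 \<longrightarrow>
         (\<lambda>j. norm (P j - P_star A B1 B2 C D Q R \<gamma> Lv L0)) \<longlonglongrightarrow> 0)))"
proof (cases "pos_def (Q_v Q \<gamma> Lv)")
  case False
  then show ?thesis by (intro exI[of _ 1]) simp
next
  case True
  interpret brownian_setting M F W by unfold_locales (fact assms(1), fact assms(2))
  interpret I: policy_iteration "A + B2 ** Lv" C "Q_v Q \<gamma> Lv" B1 D R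
    by unfold_locales (fact assms(4), fact True)
  have stab: "stabilizer M F W A B1 B2 C D L Lv \<longleftrightarrow> I.admissible L" for L
    unfolding stabilizer_iff_lyapunov_stable I.admissible_def by (simp add: add_ac)
  have a: "I.admissible L0" using assms(7) stab by simp
  obtain Ps where conv: "(\<lambda>j. I.evaluation (I.undisturbed L0 j)) \<longlonglongrightarrow> Ps" and fp: "I.fixpoint Ps"
    using I.undisturbed_converges[OF a] by blast
  have Pstar: "P_star A B1 B2 C D Q R \<gamma> Lv L0 = Ps"
    by (rule I.P_star_eq[OF refl refl a conv])
  \<comment> \<open>half of \<open>\<epsilon>\<close>, because the upper limit has to be strictly less than \<open>\<epsilon>\<close>\<close>
  have "0 < \<epsilon> / 2" using assms(8) by simp
  from I.robust_policy_iteration[OF a fp conv this]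
  obtain \<delta> M0 where \<delta>: "0 < \<delta>" and M0: "0 < M0" and rob: "\<And>U V. (\<forall>j\<ge>1. norm (U j) + norm (V j) < \<delta>) \<Longrightarrow>
    (\<forall>j. I.admissible (I.policies L0 U V j)) \<and>
    (\<forall>j. invertible (I.weight (I.evaluation (I.policies L0 U V j)) + U (Suc j))) \<and>
    (\<forall>j. norm (I.evaluation (I.policies L0 U V j)) < M0) \<and>
    (\<forall>\<^sub>F j in sequentially. norm (I.evaluation (I.policies L0 U V j) - Ps) < \<epsilon> / 2) \<and>
    ((\<lambda>j. norm (U j) + norm (V j)) \<longlonglongrightarrow> 0 \<longrightarrow> (\<lambda>j. I.evaluation (I.policies L0 U V j)) \<longlonglongrightarrow> Ps)"
    by blast
  obtain k where k: "0 < k" and blocks: "\<And>N :: real^('n + ('m1 + 'm2))^('n + ('m1 + 'm2)).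
     norm (block_uu N :: real^'m1^'m1) + norm (block_ux N :: real^'n^'m1) \<le> k * norm N"
    using blocks_bounded by blast
  have main: "(\<exists>P L. inner_iteration A B1 B2 C D Q R \<gamma> Lv L0 \<Delta> P L) \<and>
      (\<forall>P L. inner_iteration A B1 B2 C D Q R \<gamma> Lv L0 \<Delta> P L \<longrightarrow>
        (\<forall>j>0. invertible (block_uu (M_hat A B1 B2 C D Q R \<gamma> \<Delta> P j)) \<and>
               stabilizer M F W A B1 B2 C D (L j) Lv \<and> norm (P j) < M0) \<and>
        limsup (\<lambda>j. ereal (norm (P j - P_star A B1 B2 C D Q R \<gamma> Lv L0))) < ereal \<epsilon> \<and>
        ((\<lambda>j. norm (\<Delta> j)) \<longlonglongrightarrow> 0 \<longrightarrow>
         (\<lambda>j. norm (P j - P_star A B1 B2 C D Q R \<gamma> Lv L0)) \<longlonglongrightarrow> 0))"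
    if small: "sup_norm \<Delta> < ereal (\<delta> / k)"
    for \<Delta> :: "nat \<Rightarrow> real^('n + ('m1 + 'm2))^('n + ('m1 + 'm2))"
  proof -
    define U :: "nat \<Rightarrow> real^'m1^'m1" where "U j = block_uu (\<Delta> j)" for j
    define V :: "nat \<Rightarrow> real^'n^'m1" where "V j = block_ux (\<Delta> j)" for j
    have \<Delta>j: "norm (\<Delta> j) < \<delta> / k" if "1 \<le> j" for j
    proof -
      have "ereal (norm (\<Delta> j)) \<le> sup_norm \<Delta>" unfolding sup_norm_def using that by (intro SUP_upper) auto
      then have "ereal (norm (\<Delta> j)) < ereal (\<delta> / k)" using small by (rule le_less_trans)
      then show ?thesis by simp
    qed
    have UV: "\<forall>j\<ge>1. norm (U j) + norm (V j) < \<delta>"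
    proof (intro allI impI)
      fix j :: nat assume "1 \<le> j"
      then have "k * norm (\<Delta> j) < \<delta>" using \<Delta>j[of j] k by (simp add: field_simps)
      then show "norm (U j) + norm (V j) < \<delta>" using blocks[of "\<Delta> j"] by (simp add: U_def V_def)
    qed
    let ?L = "I.policies L0 U V" and ?P = "\<lambda>j. I.evaluation (I.policies L0 U V j)"
    have ad: "I.admissible (?L j)" and inv: "invertible (I.weight (?P j) + U (Suc j))"
      and bd: "norm (?P j) < M0" for j
      using rob[OF UV] by blast+
    have ev: "\<forall>\<^sub>F j in sequentially. norm (?P j - Ps) < \<epsilon> / 2"
      and null: "(\<lambda>j. norm (U j) + norm (V j)) \<longlonglongrightarrow> 0 \<Longrightarrow> ?P \<longlonglongrightarrow> Ps"
      using rob[OF UV] by blast+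
    have iff: "inner_iteration A B1 B2 C D Q R \<gamma> Lv L0 \<Delta> P L \<longleftrightarrow>
        (\<forall>j. L j = ?L j \<and> P (Suc j) = I.evaluation (L j))" for P L
      using I.inner_iteration_iff[OF refl refl, of L0 \<Delta> P L] ad unfolding U_def V_def by blast
    have ex: "\<exists>P L. inner_iteration A B1 B2 C D Q R \<gamma> Lv L0 \<Delta> P L"
      unfolding iff by (intro exI[of _ "\<lambda>j. ?P (j - 1)"] exI[of _ ?L]) simp
    have all: "(\<forall>j>0. invertible (block_uu (M_hat A B1 B2 C D Q R \<gamma> \<Delta> P j)) \<and>
               stabilizer M F W A B1 B2 C D (L j) Lv \<and> norm (P j) < M0) \<and>
        limsup (\<lambda>j. ereal (norm (P j - Ps))) < ereal \<epsilon> \<and>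
        ((\<lambda>j. norm (\<Delta> j)) \<longlonglongrightarrow> 0 \<longrightarrow> (\<lambda>j. norm (P j - Ps)) \<longlonglongrightarrow> 0)"
      if it: "inner_iteration A B1 B2 C D Q R \<gamma> Lv L0 \<Delta> P L" for P L
    proof (intro conjI allI impI)
      have L: "L j = ?L j" and P: "P (Suc j) = ?P j" for j
        using it unfolding iff by metis+
      fix j :: nat assume "0 < j"
      then obtain i where j: "j = Suc i" by (cases j) auto
      show "invertible (block_uu (M_hat A B1 B2 C D Q R \<gamma> \<Delta> P j))"
        using inv[of i] unfolding M_hat_def block_uu_game_mat j P I.weight_def U_def .
      show "stabilizer M F W A B1 B2 C D (L j) Lv" unfolding stab L by (rule ad)
      show "norm (P j) < M0" unfolding j P by (rule bd)
    next
      have P: "P (Suc j) = ?P j" for j using it unfolding iff by metis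
      have "\<forall>\<^sub>F j in sequentially. norm (P (Suc j) - Ps) < \<epsilon> / 2" unfolding P by (rule ev)
      then have "\<forall>\<^sub>F j in sequentially. norm (P j - Ps) < \<epsilon> / 2"
        by (subst (asm) eventually_sequentially_Suc)
      then have "limsup (\<lambda>j. ereal (norm (P j - Ps))) \<le> ereal (\<epsilon> / 2)"
        by (intro Limsup_bounded) (auto elim!: eventually_mono)
      also have "\<dots> < ereal \<epsilon>" using assms(8) by simp
      finally show "limsup (\<lambda>j. ereal (norm (P j - Ps))) < ereal \<epsilon>" .
    next
      have P: "P (Suc j) = ?P j" for j using it unfolding iff by metis
      assume "(\<lambda>j. norm (\<Delta> j)) \<longlonglongrightarrow> 0"
      then have "(\<lambda>j. k * norm (\<Delta> j)) \<longlonglongrightarrow> 0" by (rule tendsto_mult_right_zero)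
      then have "(\<lambda>j. norm (U j) + norm (V j)) \<longlonglongrightarrow> 0"
      proof (rule Lim_null_comparison[rotated])
        show "\<forall>\<^sub>F j in sequentially. norm (norm (U j) + norm (V j)) \<le> k * norm (\<Delta> j)"
          using blocks by (intro always_eventually allI) (simp add: U_def V_def)
      qed
      from null[OF this] have "(\<lambda>j. P (Suc j)) \<longlonglongrightarrow> Ps" unfolding P .
      then have "P \<longlonglongrightarrow> Ps" by (rule LIMSEQ_imp_Suc)
      then show "(\<lambda>j. norm (P j - Ps)) \<longlonglongrightarrow> 0" by (intro tendsto_norm_zero LIM_zero)
    qed
    show ?thesis unfolding Pstar using ex all by blast
  qed
  have \<delta>k: "0 < \<delta> / k" using \<delta> k by simp
  show ?thesis
    by (rule exI[of _ "\<delta> / k"], rule conjI[OF \<delta>k], rule impI, rule exI[of _ M0], rule conjI[OF M0],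
        rule allI, rule impI, erule conjE, rule main)
qed

end
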